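(* Let $\xi\in[-1,1]$, let $g$ be analytic in a neighborhood of $[-1,1]$, and let $f(x)=|x-\xi|^{\sigma}g(x)$, where $\sigma>0$ is not an even integer when $\xi\in(-1,1)$ and is not an integer when $\xi=\pm1$. Let $p_n$ be the polynomial of degree $n$ interpolating $f$ at the Chebyshev--Lobatto points $x_j=\cos(j\pi/n)$, $j=0,\dots,n$, and let $m$ be a nonnegative integer. As $n\to\infty$, the following hold pointwise in $x\in[-1,1]$. (a) If $\xi\in(-1,1)$ and $m<\min\{\sigma,\ 1+\sigma/2\}$, then $$f^{(m)}(x)-p_n^{(m)}(x)=\begin{cases} O(n^{m-\sigma}), & x=\xi,\\ O(n^{m-1-\sigma}), & x\in(-1,\xi)\cup(\xi,1),\\ O(n^{2m-2-\sigma}), & x=\pm1,\end{cases}$$ where the last estimate ($x=\pm1$) is for $m\ge1$, the error there being zero when $m=0$. (b) If $\xi=\pm1$ and $m<\sigma$, then $$f^{(m)}(x)-p_n^{(m)}(x)=\begin{cases} O(n^{m-1-2\sigma}), & x\in(-1,1),\\ O(n^{2m-2\sigma}), & x=\xi,\\ O(n^{2m-2-2\sigma}), & x=-\xi,\end{cases}$$ where the last two estimates ($x=\xi$ and $x=-\xi$) are for $m\ge1$, the errors there being zero when $m=0$.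
   Context: The estimates are pointwise: $\sigma,\xi,g,m$ and $x$ are fixed as $n\to\infty$, and the implied constants may depend on them. *)

theory Defs
  imports
    "HOL-Complex_Analysis.Complex_Analysis"
    "HOL-Computational_Algebra.Polynomial"
    "HOL-Library.Landau_Symbols"
begin

definition sing_fun :: "real \<Rightarrow> real \<Rightarrow> (complex \<Rightarrow> complex) \<Rightarrow> real \<Rightarrow> complex" where
  "sing_fun \<xi> \<sigma> g x = of_real (\<bar>x - \<xi>\<bar> powr \<sigma>) * g (of_real x)"

text \<open>The derivative of order \<open>m\<close> of a function on \<open>[-1,1]\<close>; it is one-sided at the end points.\<close>

definition nth_deriv :: "nat \<Rightarrow> (real \<Rightarrow> complex) \<Rightarrow> real \<Rightarrow> complex" where
  "nth_deriv m f = ((\<lambda>h x. vector_derivative h (at x within {-1..1})) ^^ m) f"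

definition lobatto_point :: "nat \<Rightarrow> nat \<Rightarrow> real" where
  "lobatto_point n j = cos (real j * pi / real n)"

text \<open>As usual for interpolation, ``of degree \<open>n\<close>'' means of degree at most \<open>n\<close>; for \<open>n \<ge> 1\<close>
  exactly one polynomial satisfies the following predicate.\<close>

definition lobatto_interpolant :: "nat \<Rightarrow> (real \<Rightarrow> complex) \<Rightarrow> complex poly \<Rightarrow> bool" where
  "lobatto_interpolant n f p \<longleftrightarrow> degree p \<le> n \<and>
     (\<forall>j\<le>n. poly p (of_real (lobatto_point n j)) = f (lobatto_point n j))"

definition interp_error :: "nat \<Rightarrow> (real \<Rightarrow> complex) \<Rightarrow> complex poly \<Rightarrow> real \<Rightarrow> complex" where
  "interp_error m f p x = nth_deriv m f x - poly ((pderiv ^^ m) p) (of_real x)"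

end

theory Submission
  imports Defs "HOL-Real_Asymp.Real_Asymp"
begin

text \<open>Interpolation errors are linear in the interpolated function, and for a simple pole they are
explicit.  Let \<open>L z = (1 - z\<^sup>2) U z\<close>, where \<open>U\<close> is the Chebyshev polynomial of the second kind of degree
\<open>n - 1\<close>.  Then \<open>L (cos w) = sin w * sin (n * w)\<close>, so \<open>L\<close> vanishes exactly at the Chebyshev--Lobatto
points, and the error of interpolating \<open>1 / (w - x)\<close> is \<open>L x / (L w * (w - x))\<close>.  It is therefore
enough to write \<open>f\<close> on \<open>[-1,1]\<close> as a superposition \<open>\<integral> \<mu> u / (r u - x) du\<close> of simple poles at points
\<open>r u\<close> off \<open>[-1,1]\<close>: the same superposition of the explicit errors is the error of \<open>f\<close>
(\<open>interp_error_pole_integrals\<close>).  Differentiation under the integral sign is possible up to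
order \<open>m\<close> at \<^emph>\<open>every\<close> point of \<open>[-1,1]\<close>, the singular point \<open>\<xi>\<close> included, because \<open>m < \<sigma>\<close> makes
\<open>\<bar>\<mu> u\<bar> / d u ^ (m + 1)\<close> integrable, where \<open>d u\<close> is the distance from \<open>r u\<close> to \<open>[-1,1]\<close>.

The superposition comes from the Stieltjes formula
\<open>v powr (\<kappa> / 2) = C * \<integral> u powr (\<kappa> + 1) / (u\<^sup>2 + v) du\<close> over \<open>u > 0\<close>, valid for \<open>-2 < \<kappa> < 0\<close>.
Truncating the integral to \<open>0 < u < T\<close> costs only a term that is holomorphic in \<open>v\<close> for
\<open>Re v > - T\<^sup>2\<close>, and with another such term the formula extends to all positive \<open>\<kappa>\<close> that are not even
integers (\<open>powr_as_pole_integral\<close>).  For interior \<open>\<xi>\<close> one takes \<open>\<kappa> = \<sigma>\<close> and \<open>v = (x - \<xi>)\<^sup>2\<close>, and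
partial fractions put poles at \<open>\<xi> \<plusminus> \<i> u\<close> with weight of order \<open>u powr \<sigma>\<close>.  For \<open>\<xi> = \<plusminus>1\<close> one takes
\<open>\<kappa> = 2 * \<sigma>\<close> and \<open>v = 1 - \<xi> * x\<close>, with poles at \<open>\<xi> * (1 + u\<^sup>2)\<close> and weight of order
\<open>u powr (2 * \<sigma> + 1)\<close>.  In this parametrization \<open>\<bar>L (r u)\<bar>\<close> is at least of order \<open>sinh (n * u / 2)\<close> in the
first case and \<open>u * sinh (n * u / 2)\<close> in the second.  Multiplication by \<open>g\<close> multiplies the weight by
the values of \<open>g\<close> at the poles and adds a holomorphic term (\<open>multiply_pole_integrals\<close>).  By Cauchy's
formula a holomorphic term is a superposition of poles on a rectangle around \<open>[-1,1]\<close>, where \<open>L\<close>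
is exponentially large, so it never matters.

The rates are now read off from \<open>\<integral> u powr \<beta> * exp (- c * n * u) du = O(n powr (- \<beta> - 1))\<close> and from the
growth of the derivatives of \<open>L\<close> at the evaluation point: the derivative of order \<open>k\<close> is \<open>O(n ^ k)\<close>
at interior points and, for \<open>k \<ge> 1\<close>, \<open>O(n ^ (2 * k - 1))\<close> at \<open>\<plusminus>1\<close>.  If \<open>x \<noteq> \<xi>\<close>, the distance from \<open>x\<close> to
the poles is bounded below and the integral is \<open>O(n powr (- 1 - \<sigma>))\<close>, or
\<open>O(n powr (- 1 - 2 * \<sigma>))\<close> when \<open>\<xi> = \<plusminus>1\<close> (\<open>away_estimate\<close>).  At \<open>x = \<xi>\<close> each negative power of the
distance costs powers of \<open>n\<close> (\<open>singularity_estimate\<close>).\<close>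

section \<open>Chebyshev polynomials and the nodal polynomial\<close>

text \<open>These are the Chebyshev polynomials \<open>T\<close> of degree \<open>n\<close> and \<open>U\<close> of degree \<open>n - 1\<close>.  The simultaneous recursion
is the addition theorem for cosine and sine, which makes their trigonometric form and the formulas
for their derivatives immediate inductions.\<close>

fun chebT :: "nat \<Rightarrow> complex poly" and chebS :: "nat \<Rightarrow> complex poly" where
  "chebT 0 = 1"
| "chebT (Suc n) = [:0, 1:] * chebT n - [:1, 0, -1:] * chebS n"
| "chebS 0 = 0"
| "chebS (Suc n) = [:0, 1:] * chebS n + chebT n"

lemma one_minus_cos_squared: "1 - (cos w)\<^sup>2 = (sin (w::complex))\<^sup>2"
  using sin_cos_squared_add [of w] by (simp add: algebra_simps)

lemma poly_cheb_cos:
  "poly (chebT n) (cos w) = cos (of_nat n * w)"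
  "sin w * poly (chebS n) (cos w) = sin (of_nat n * w)"
proof (induction n)
  case (Suc n)
  {
    case 1
    have "poly (chebT (Suc n)) (cos w)
        = cos w * poly (chebT n) (cos w) - (1 - cos w ^ 2) * poly (chebS n) (cos w)"
      by (simp add: power2_eq_square algebra_simps)
    also have "\<dots> = cos w * poly (chebT n) (cos w) - sin w * (sin w * poly (chebS n) (cos w))"
      unfolding one_minus_cos_squared by (simp add: power2_eq_square algebra_simps)
    also have "\<dots> = cos (of_nat (Suc n) * w)"
      using Suc by (simp add: algebra_simps cos_add)
    finally show ?case .
  next
    case 2
    have "sin w * poly (chebS (Suc n)) (cos w)
        = cos w * (sin w * poly (chebS n) (cos w)) + sin w * poly (chebT n) (cos w)"
      by (simp add: algebra_simps)
    also have "\<dots> = sin (of_nat (Suc n) * w)"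
      using Suc by (simp add: algebra_simps sin_add)
    finally show ?case .
  }
qed auto

lemma pderiv_cheb:
  "pderiv (chebT n) = smult (of_nat n) (chebS n)"
  "[:1, 0, -1:] * pderiv (chebS n) = [:0, 1:] * chebS n - smult (of_nat n) (chebT n)"
proof (induction n)
  case (Suc n)
  define x q where "x = [:0, 1::complex:]" and "q = [:1, 0, -1::complex:]"
  have q: "q = 1 - x * x" by (simp add: x_def q_def one_pCons)
  have px: "pderiv x = 1" by (simp add: x_def pderiv_pCons)
  have pq: "pderiv q = - 2 * x"
    unfolding q by (simp add: pderiv_diff pderiv_mult px)
  note IH = Suc [folded x_def q_def]
  have IH1: "pderiv (chebT n) = of_nat n * chebS n" using IH(1) by (simp add: of_nat_poly)
  have IH2: "q * pderiv (chebS n) = x * chebS n - of_nat n * chebT n" using IH(2) by (simp add: of_nat_poly)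
  {
    case 1
    have "pderiv (chebT (Suc n)) = chebT n + x * (of_nat n * chebS n) - (q * pderiv (chebS n) + pderiv q * chebS n)"
      by (simp add: x_def [symmetric] q_def [symmetric] pderiv_diff pderiv_mult px IH1 algebra_simps del: pderiv_pCons)
    also have "\<dots> = of_nat (Suc n) * chebS (Suc n)"
      unfolding IH2 pq by (simp add: x_def [symmetric] algebra_simps)
    finally show ?case by (simp add: of_nat_poly)
  next
    case 2
    have "q * pderiv (chebS (Suc n)) = q * (chebS n + x * pderiv (chebS n) + of_nat n * chebS n)"
      by (simp add: x_def [symmetric] pderiv_add pderiv_mult px IH1 algebra_simps del: pderiv_pCons)
    also have "\<dots> = q * chebS n + x * (q * pderiv (chebS n)) + of_nat n * (q * chebS n)"
      by (simp add: algebra_simps)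
    also have "\<dots> = x * chebS (Suc n) - of_nat (Suc n) * chebT (Suc n)"
      unfolding IH2 by (simp add: x_def [symmetric] q_def [symmetric] algebra_simps)
    finally show ?case by (simp add: x_def q_def of_nat_poly)
  }
qed (auto)

lemma degree_cheb: "degree (chebT n) \<le> n" "degree (chebS n) \<le> n - 1"
proof (induction n)
  case (Suc n)
  {
    case 1
    have "degree ([:0, 1:] * chebT n) \<le> Suc n"
      using degree_mult_le [of "[:0, 1:]" "chebT n"] Suc(1) by simp
    moreover have "degree ([:1, 0, -1:] * chebS n) \<le> Suc n"
      using degree_mult_le [of "[:1, 0, -1:]" "chebS n"] Suc(2) by (cases n) auto
    ultimately show ?case by (simp only: chebT.simps degree_diff_le)
  next
    case 2
    have "degree ([:0, 1:] * chebS n) \<le> n"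
      using degree_mult_le [of "[:0, 1:]" "chebS n"] Suc(2) by (cases n) auto
    thus ?case using Suc(1) by (simp only: chebS.simps degree_add_le diff_Suc_1)
  }
qed auto

text \<open>Up to a constant factor this is \<open>\<Prod>\<^sub>j (z - x\<^sub>j)\<close> over the Lobatto points \<open>x\<^sub>j\<close>; the normalization is the
one that gives \<open>sin w sin (n w)\<close> at \<open>cos w\<close>.\<close>

definition nodal :: "nat \<Rightarrow> complex poly" where
  "nodal n = [:1, 0, -1:] * chebS n"

lemma poly_nodal: "poly (nodal n) z = (1 - z\<^sup>2) * poly (chebS n) z"
  by (simp add: nodal_def power2_eq_square algebra_simps)

lemma poly_nodal_cos: "poly (nodal n) (cos w) = sin w * sin (of_nat n * w)"
proof -
  have "poly (nodal n) (cos w) = sin w * (sin w * poly (chebS n) (cos w))"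
    by (simp add: poly_nodal one_minus_cos_squared) (simp add: power2_eq_square)
  thus ?thesis by (simp add: poly_cheb_cos)
qed

lemma degree_nodal: "n \<ge> 1 \<Longrightarrow> degree (nodal n) \<le> Suc n"
  using degree_mult_le [of "[:1, 0, -1:]" "chebS n"] degree_cheb(2) [of n] by (simp add: nodal_def)

abbreviation derivs :: "nat \<Rightarrow> complex poly \<Rightarrow> complex poly" where
  "derivs k p \<equiv> (pderiv ^^ k) p"

text \<open>The Gegenbauer differential equation of \<open>chebS n\<close>, differentiated \<open>k\<close> times.  It is a three-term
recursion for the derivatives at a fixed point, and all growth estimates for derivatives rest on it:
at \<open>z = \<plusminus>1\<close> the leading term drops out and each derivative costs a factor \<open>n\<^sup>2\<close>, while at interior
points two derivatives cost a factor \<open>n\<^sup>2\<close>.\<close>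

lemma chebS_ode:
  "[:1, 0, -1:] * derivs (k + 2) (chebS n) =
     of_nat (2 * k + 3) * ([:0, 1:] * derivs (Suc k) (chebS n))
     + (of_nat (k * (k + 2)) + 1 - of_nat (n\<^sup>2)) * derivs k (chebS n)"
proof (induction k)
  define x q where "x = [:0, 1::complex:]" and "q = [:1, 0, -1::complex:]"
  have q: "q = 1 - x * x" by (simp add: x_def q_def one_pCons)
  have px: "pderiv x = 1" by (simp add: x_def pderiv_pCons)
  have pq: "pderiv q = - 2 * x"
    unfolding q by (simp add: pderiv_diff pderiv_mult px)
  have pn: "pderiv (of_nat i * y) = of_nat i * pderiv y" for i and y :: "complex poly"
    by (simp add: pderiv_mult)
  {
    case 0
    have "pderiv (q * pderiv (chebS n)) = pderiv (x * chebS n - of_nat n * chebT n)"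
      unfolding x_def q_def pderiv_cheb(2) by (simp add: of_nat_poly)
    moreover have "pderiv (chebT n) = of_nat n * chebS n"
      by (simp add: pderiv_cheb(1) of_nat_poly)
    ultimately have "q * pderiv (pderiv (chebS n))
        = 2 * x * pderiv (chebS n) + (chebS n + x * pderiv (chebS n)) - of_nat n * (of_nat n * chebS n)"
      by (simp add: pderiv_mult pderiv_diff px pq pn algebra_simps)
    thus ?case
      unfolding x_def [symmetric] q_def [symmetric]
      by (simp add: algebra_simps power2_eq_square)
  next
    case (Suc k)
    have pc: "pderiv ((of_nat i + 1 - of_nat j) * y) = (of_nat i + 1 - of_nat j) * pderiv y" for i j and y :: "complex poly"
      by (simp add: pderiv_mult pderiv_add pderiv_diff)
    have "pderiv (q * derivs (k + 2) (chebS n)) = pderiv (of_nat (2 * k + 3) * (x * derivs (Suc k) (chebS n))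
     + (of_nat (k * (k + 2)) + 1 - of_nat (n\<^sup>2)) * derivs k (chebS n))"
      unfolding x_def q_def Suc.IH ..
    hence "q * derivs (Suc k + 2) (chebS n) = 2 * x * derivs (k + 2) (chebS n)
        + of_nat (2 * k + 3) * (derivs (Suc k) (chebS n) + x * derivs (k + 2) (chebS n))
        + (of_nat (k * (k + 2)) + 1 - of_nat (n\<^sup>2)) * derivs (Suc k) (chebS n)"
      by (simp only: pderiv_mult [of q] pderiv_mult [of x] pderiv_add px pq pn pc) (simp add: algebra_simps)
    thus ?case unfolding x_def [symmetric] q_def [symmetric] by (simp add: algebra_simps)
  }
qed

lemma poly_chebS_ode:
  "(1 - z\<^sup>2) * poly (derivs (k + 2) (chebS n)) z =
     of_nat (2 * k + 3) * z * poly (derivs (Suc k) (chebS n)) z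
     + (of_nat (k * (k + 2)) + 1 - of_nat (n\<^sup>2)) * poly (derivs k (chebS n)) z"
proof -
  have "poly [:1, 0, -1:] z = 1 - z\<^sup>2" "poly [:0, 1:] z = z" by (auto simp: power2_eq_square)
  thus ?thesis
    using arg_cong [OF chebS_ode [of k n], of "\<lambda>p. poly p z"]
    by (simp only: poly_add poly_diff poly_mult poly_of_nat poly_1 mult.assoc)
qed

lemma poly_derivs_nodal:
  "poly (derivs k (nodal n)) z = (1 - z\<^sup>2) * poly (derivs k (chebS n)) z
     - of_nat (2 * k) * z * poly (derivs (k - 1) (chebS n)) z
     - of_nat (k * (k - 1)) * poly (derivs (k - 2) (chebS n)) z"
proof -
  define x q where "x = [:0, 1::complex:]" and "q = [:1, 0, -1::complex:]"
  have q: "q = 1 - x * x" by (simp add: x_def q_def one_pCons)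
  have px: "pderiv x = 1" by (simp add: x_def pderiv_pCons)
  have pq: "pderiv q = - 2 * x"
    unfolding q by (simp add: pderiv_diff pderiv_mult px)
  have "derivs k (nodal n) = q * derivs k (chebS n)
     - of_nat (2 * k) * (x * derivs (k - 1) (chebS n))
     - of_nat (k * (k - 1)) * derivs (k - 2) (chebS n)"
  proof (induction k)
    case 0
    show ?case by (simp add: nodal_def q_def)
  next
    case (Suc k)
    have pn: "pderiv (of_nat i * y) = of_nat i * pderiv y" for i and y :: "complex poly"
      by (simp add: pderiv_mult)
    have *: "derivs (Suc k) (nodal n) = q * derivs (Suc k) (chebS n) - 2 * x * derivs k (chebS n)
        - of_nat (2 * k) * (derivs (k - 1) (chebS n) + x * derivs (Suc (k - 1)) (chebS n))
        - of_nat (k * (k - 1)) * derivs (Suc (k - 2)) (chebS n)"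
      by (simp only: funpow.simps o_apply Suc.IH pderiv_diff pn pderiv_mult [of q] pderiv_mult [of x] px pq)
         (simp add: algebra_simps)
    consider "k = 0" | "k = 1" | j where "k = Suc (Suc j)"
      by (metis One_nat_def not0_implies_Suc)
    thus ?case
    proof cases
      case 1
      show ?thesis using * unfolding 1 by simp
    next
      case 2
      show ?thesis using * unfolding 2 by (simp add: algebra_simps)
    next
      case (3 j)
      show ?thesis using * unfolding 3 by (simp add: algebra_simps)
    qed
  qed
  moreover have "poly q z = 1 - z\<^sup>2" "poly x z = z"
    by (auto simp: x_def q_def power2_eq_square)
  ultimately show ?thesis
    by (simp only: poly_diff poly_mult poly_of_nat mult.assoc)
qed

lemma norm_ode_coeff_le:
  assumes "n \<ge> 1"
  shows "norm (of_nat a + 1 - of_nat (n\<^sup>2) :: complex) \<le> (real a + 2) * real n ^ 2"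
proof -
  have n2: "1 \<le> real n ^ 2" using assms by simp
  have "(of_nat a + 1 - of_nat (n\<^sup>2) :: complex) = of_real (real a + 1 - real n ^ 2)" by simp
  hence "norm (of_nat a + 1 - of_nat (n\<^sup>2) :: complex) = \<bar>real a + 1 - real n ^ 2\<bar>"
    by (simp only: norm_of_real)
  also have "\<dots> \<le> real a * 1 + 1 * 1 + real n ^ 2" by (simp add: abs_le_iff)
  also have "\<dots> \<le> real a * real n ^ 2 + 1 * real n ^ 2 + real n ^ 2"
    using n2 by (intro add_mono mult_left_mono) auto
  finally show ?thesis by (simp add: algebra_simps)
qed

lemma chebS_endpoint_bound:
  assumes "z = 1 \<or> z = -1"
  shows "\<exists>C\<ge>0. \<forall>n\<ge>1. norm (poly (derivs k (chebS n)) z) \<le> C * real n ^ (2 * k + 1)"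
proof (induction k)
  case 0
  have "norm (poly (chebT n) z) = 1 \<and> norm (poly (chebS n) z) \<le> real n" for n
  proof (induction n)
    case (Suc n)
    have "norm z = 1" using assms by auto
    have "poly (chebT (Suc n)) z = z * poly (chebT n) z"
      using assms by (elim disjE) simp_all
    hence "norm (poly (chebT (Suc n)) z) = 1"
      using Suc \<open>norm z = 1\<close> by (simp only: norm_mult)
    moreover have "norm (poly (chebS (Suc n)) z) \<le> norm (z * poly (chebS n) z) + norm (poly (chebT n) z)"
      using norm_triangle_ineq by (simp only: chebS.simps poly_add poly_mult) simp
    ultimately show ?case using Suc \<open>norm z = 1\<close> by (simp add: norm_mult)
  qed auto
  thus ?case by (intro exI [of _ 1]) auto
next
  case (Suc k)
  then obtain C where C: "C \<ge> 0" "\<And>n. n \<ge> 1 \<Longrightarrow> norm (poly (derivs k (chebS n)) z) \<le> C * real n ^ (2 * k + 1)"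
    by blast
  have "norm (poly (derivs (Suc k) (chebS n)) z) \<le> (real (k * (k + 2)) + 2) * C * real n ^ (2 * Suc k + 1)"
    if n: "n \<ge> 1" for n
  proof -
    have z: "norm z = 1" "z\<^sup>2 = 1" using assms by auto
    have n2: "real n ^ 2 \<ge> 1" using n by simp
    have "of_nat (2 * k + 3) * z * poly (derivs (Suc k) (chebS n)) z
      = - ((of_nat (k * (k + 2)) + 1 - of_nat (n\<^sup>2)) * poly (derivs k (chebS n)) z)"
      using poly_chebS_ode [of z k n] unfolding z(2) by (simp only: diff_self mult_zero_left) (metis add_eq_0_iff2)
    from arg_cong [OF this, of norm] have "real (2 * k + 3) * norm (poly (derivs (Suc k) (chebS n)) z)
       = norm (of_nat (k * (k + 2)) + 1 - of_nat (n\<^sup>2) :: complex) * norm (poly (derivs k (chebS n)) z)"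
      by (simp only: norm_minus_cancel norm_mult norm_of_nat z(1) mult_1_right)
    also have "\<dots> \<le> ((real (k * (k + 2)) + 2) * real n ^ 2) * (C * real n ^ (2 * k + 1))"
    proof (intro mult_mono C n)
      show "norm (of_nat (k * (k + 2)) + 1 - of_nat (n\<^sup>2) :: complex) \<le> (real (k * (k + 2)) + 2) * real n ^ 2"
        by (rule norm_ode_coeff_le [OF n])
    qed auto
    also have "\<dots> = (real (k * (k + 2)) + 2) * C * real n ^ (2 * Suc k + 1)"
      by (simp add: power_add power2_eq_square algebra_simps)
    finally have "real (2 * k + 3) * norm (poly (derivs (Suc k) (chebS n)) z)
      \<le> (real (k * (k + 2)) + 2) * C * real n ^ (2 * Suc k + 1)" .
    moreover have "1 * norm (poly (derivs (Suc k) (chebS n)) z) \<le> real (2 * k + 3) * norm (poly (derivs (Suc k) (chebS n)) z)"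
      by (intro mult_right_mono) auto
    ultimately show ?thesis by linarith
  qed
  thus ?case using C(1) by (intro exI [of _ "(real (k * (k + 2)) + 2) * C"]) auto
qed

text \<open>The factor \<open>1 - z\<^sup>2\<close> vanishes at the end point, so only derivatives of \<open>chebS n\<close> of lower order
survive, and the exponent is one less than for \<open>chebT n\<close>.\<close>

lemma nodal_endpoint_bound:
  assumes z: "z = 1 \<or> z = -1"
  shows "\<exists>C\<ge>0. \<forall>n\<ge>1. norm (poly (derivs (Suc k) (nodal n)) z) \<le> C * real n ^ (2 * k + 1)"
proof -
  obtain C where C: "C \<ge> 0" "\<And>n. n \<ge> 1 \<Longrightarrow> norm (poly (derivs k (chebS n)) z) \<le> C * real n ^ (2 * k + 1)"
    using chebS_endpoint_bound [OF z] by blast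
  obtain C' where C': "C' \<ge> 0" "\<And>n. n \<ge> 1 \<Longrightarrow> norm (poly (derivs (k - 1) (chebS n)) z) \<le> C' * real n ^ (2 * (k - 1) + 1)"
    using chebS_endpoint_bound [OF z] by blast
  have "norm (poly (derivs (Suc k) (nodal n)) z) \<le> (real (2 * Suc k) * C + real (Suc k * k) * C') * real n ^ (2 * k + 1)"
    if n: "n \<ge> 1" for n
  proof -
    have z': "norm z = 1" "z\<^sup>2 = 1" using z by auto
    have "real n ^ (2 * (k - 1) + 1) \<le> real n ^ (2 * k + 1)"
      using n by (intro power_increasing) auto
    hence *: "norm (poly (derivs (k - 1) (chebS n)) z) \<le> C' * real n ^ (2 * k + 1)"
      using C'(2) [OF n] C'(1) by (meson mult_left_mono order_trans)
    have "poly (derivs (Suc k) (nodal n)) z = - (of_nat (2 * Suc k) * z * poly (derivs k (chebS n)) z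
       + of_nat (Suc k * k) * poly (derivs (k - 1) (chebS n)) z)"
      unfolding poly_derivs_nodal z'(2) by (simp add: numeral_2_eq_2)
    hence "norm (poly (derivs (Suc k) (nodal n)) z) \<le> norm (of_nat (2 * Suc k) * z * poly (derivs k (chebS n)) z)
       + norm (of_nat (Suc k * k) * poly (derivs (k - 1) (chebS n)) z)"
      by (metis norm_minus_cancel norm_triangle_ineq)
    also have "\<dots> = real (2 * Suc k) * norm (poly (derivs k (chebS n)) z) + real (Suc k * k) * norm (poly (derivs (k - 1) (chebS n)) z)"
      by (simp only: norm_mult norm_of_nat z')
    also have "\<dots> \<le> real (2 * Suc k) * (C * real n ^ (2 * k + 1)) + real (Suc k * k) * (C' * real n ^ (2 * k + 1))"
      by (intro add_mono mult_left_mono C n *) auto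
    finally show ?thesis by (simp add: algebra_simps)
  qed
  thus ?thesis using C(1) C'(1) by (intro exI [of _ "real (2 * Suc k) * C + real (Suc k * k) * C'"]) auto
qed

lemma chebS_interior_bound:
  assumes x: "x \<in> {-1<..<1::real}"
  shows "\<exists>C\<ge>0. \<forall>n\<ge>1. norm (poly (derivs k (chebS n)) (of_real x)) \<le> C * real n ^ k"
proof -
  define \<theta> where "\<theta> = arccos x"
  define s where "s = sin \<theta>"
  have cs: "cos \<theta> = x" unfolding \<theta>_def using x by simp
  have s: "s > 0" unfolding s_def \<theta>_def using x
    by (metis arccos_lt_bounded greaterThanLessThan_iff sin_gt_zero)
  have xc: "complex_of_real x = cos (of_real \<theta>)" using cs by (simp add: cos_of_real)
  have s2: "1 - x\<^sup>2 = s\<^sup>2" unfolding s_def cs [symmetric] by (simp add: sin_squared_eq)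
  have T: "norm (poly (chebT n) (of_real x)) \<le> 1" for n
  proof -
    have "poly (chebT n) (of_real x) = of_real (cos (real n * \<theta>))"
      unfolding xc poly_cheb_cos by (simp flip: cos_of_real)
    thus ?thesis by simp
  qed
  have S: "norm (poly (chebS n) (of_real x)) \<le> 1 / s" for n
  proof -
    have "of_real s * poly (chebS n) (of_real x) = of_real (sin (real n * \<theta>))"
      using poly_cheb_cos(2) [of "of_real \<theta>" n] unfolding xc s_def by (simp flip: sin_of_real)
    from arg_cong [OF this, of norm] have "s * norm (poly (chebS n) (of_real x)) = \<bar>sin (real n * \<theta>)\<bar>"
      using s by (simp only: norm_mult norm_of_real abs_of_pos)
    also have "\<dots> \<le> 1" by simp
    finally show ?thesis using s by (simp add: field_simps)
  qed
  show ?thesis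
  proof (induction k rule: less_induct)
    case (less k)
    consider "k = 0" | "k = 1" | j where "k = j + 2"
      by (metis One_nat_def add_2_eq_Suc' not0_implies_Suc)
    thus ?case
    proof cases
      case 1
      thus ?thesis using S s by (intro exI [of _ "1 / s"]) auto
    next
      case 2
      have "norm (poly (derivs k (chebS n)) (of_real x)) \<le> (1 / s + 1) / s\<^sup>2 * real n ^ k" if n: "n \<ge> 1" for n
      proof -
        have "of_real (s\<^sup>2) * poly (pderiv (chebS n)) (of_real x)
           = of_real x * poly (chebS n) (of_real x) - of_nat n * poly (chebT n) (of_real x)"
          using arg_cong [OF pderiv_cheb(2) [of n], of "\<lambda>p. poly p (of_real x)"]
          unfolding s2 [symmetric] by (simp add: algebra_simps power2_eq_square)
        from arg_cong [OF this, of norm] have "s\<^sup>2 * norm (poly (pderiv (chebS n)) (of_real x))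
           = norm (of_real x * poly (chebS n) (of_real x) - of_nat n * poly (chebT n) (of_real x))"
          by (simp only: norm_mult [of "of_real _"] norm_of_real abs_power2)
        also have "\<dots> \<le> \<bar>x\<bar> * norm (poly (chebS n) (of_real x)) + real n * norm (poly (chebT n) (of_real x))"
          by (rule order_trans [OF norm_triangle_ineq4]) (simp add: norm_mult)
        also have "\<dots> \<le> 1 * (1 / s) + real n * 1"
          using x by (intro add_mono mult_mono S T) auto
        also have "\<dots> \<le> (1 / s + 1) * real n"
          using n s by (simp add: field_simps)
        finally show ?thesis using s 2 by (simp add: field_simps)
      qed
      thus ?thesis using s by (intro exI [of _ "(1 / s + 1) / s\<^sup>2"]) auto
    next
      case (3 j)
      obtain C where C: "C \<ge> 0" "\<And>n. n \<ge> 1 \<Longrightarrow> norm (poly (derivs (Suc j) (chebS n)) (of_real x)) \<le> C * real n ^ (Suc j)"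
        using less [of "Suc j"] 3 by auto
      obtain C' where C': "C' \<ge> 0" "\<And>n. n \<ge> 1 \<Longrightarrow> norm (poly (derivs j (chebS n)) (of_real x)) \<le> C' * real n ^ j"
        using less [of j] 3 by auto
      have "norm (poly (derivs k (chebS n)) (of_real x))
           \<le> (real (2 * j + 3) * C + (real (j * (j + 2)) + 2) * C') / s\<^sup>2 * real n ^ k" if n: "n \<ge> 1" for n
      proof -
        have n2: "real n ^ 2 \<ge> 1" using n by simp
        have "of_real (s\<^sup>2) * poly (derivs k (chebS n)) (of_real x) =
            of_nat (2 * j + 3) * of_real x * poly (derivs (Suc j) (chebS n)) (of_real x)
          + (of_nat (j * (j + 2)) + 1 - of_nat (n\<^sup>2)) * poly (derivs j (chebS n)) (of_real x)"
          using poly_chebS_ode [of "of_real x" j n] unfolding 3 s2 [symmetric] by simp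
        from arg_cong [OF this, of norm] have "s\<^sup>2 * norm (poly (derivs k (chebS n)) (of_real x)) =
            norm (of_nat (2 * j + 3) * of_real x * poly (derivs (Suc j) (chebS n)) (of_real x)
          + (of_nat (j * (j + 2)) + 1 - of_nat (n\<^sup>2)) * poly (derivs j (chebS n)) (of_real x))"
          by (simp only: norm_mult [of "of_real _"] norm_of_real abs_power2)
        also have "\<dots> \<le> real (2 * j + 3) * \<bar>x\<bar> * norm (poly (derivs (Suc j) (chebS n)) (of_real x))
          + norm (of_nat (j * (j + 2)) + 1 - of_nat (n\<^sup>2) :: complex) * norm (poly (derivs j (chebS n)) (of_real x))"
          by (rule order_trans [OF norm_triangle_ineq]) (simp only: norm_mult norm_of_nat norm_of_real)
        also have "\<dots> \<le> real (2 * j + 3) * 1 * (C * real n ^ Suc j)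
          + ((real (j * (j + 2)) + 2) * real n ^ 2) * (C' * real n ^ j)"
        proof (intro add_mono mult_mono C C' n)
          show "norm (of_nat (j * (j + 2)) + 1 - of_nat (n\<^sup>2) :: complex) \<le> (real (j * (j + 2)) + 2) * real n ^ 2"
            by (rule norm_ode_coeff_le [OF n])
        qed (use x C(1) C'(1) in auto)
        also have "\<dots> \<le> real (2 * j + 3) * 1 * (C * real n ^ k)
          + ((real (j * (j + 2)) + 2) * real n ^ 2) * (C' * real n ^ j)"
          using n C(1) C'(1) 3 by (intro add_mono mult_left_mono power_increasing) auto
        finally show ?thesis using s 3 by (simp add: field_simps power_add power2_eq_square)
      qed
      thus ?thesis using s C(1) C'(1)
        by (intro exI [of _ "(real (2 * j + 3) * C + (real (j * (j + 2)) + 2) * C') / s\<^sup>2"]) auto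
    qed
  qed
qed

lemma nodal_interior_bound:
  assumes x: "x \<in> {-1<..<1::real}"
  shows "\<exists>C\<ge>0. \<forall>n\<ge>1. norm (poly (derivs k (nodal n)) (of_real x)) \<le> C * real n ^ k"
proof -
  have "\<forall>j. \<exists>C\<ge>0. \<forall>n\<ge>1. norm (poly (derivs j (chebS n)) (of_real x)) \<le> C * real n ^ j"
    using chebS_interior_bound [OF x] by blast
  then obtain C where C: "\<And>j. C j \<ge> 0" "\<And>j n. n \<ge> 1 \<Longrightarrow> norm (poly (derivs j (chebS n)) (of_real x)) \<le> C j * real n ^ j"
    by metis
  have C': "norm (poly (derivs j (chebS n)) (of_real x)) \<le> C j * real n ^ k" if "n \<ge> 1" "j \<le> k" for n j
  proof -
    have "real n ^ j \<le> real n ^ k" using that by (intro power_increasing) auto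
    thus ?thesis using C(2) [OF that(1), of j] C(1) [of j] by (meson mult_left_mono order_trans)
  qed
  have "norm (poly (derivs k (nodal n)) (of_real x))
      \<le> (C k + real (2 * k) * C (k - 1) + real (k * (k - 1)) * C (k - 2)) * real n ^ k" if n: "n \<ge> 1" for n
  proof -
    have "norm (poly (derivs k (nodal n)) (of_real x)) \<le> norm ((1 - (complex_of_real x)\<^sup>2) * poly (derivs k (chebS n)) (of_real x))
        + norm (of_nat (2 * k) * complex_of_real x * poly (derivs (k - 1) (chebS n)) (of_real x))
        + norm (of_nat (k * (k - 1)) * poly (derivs (k - 2) (chebS n)) (of_real x))"
      unfolding poly_derivs_nodal by (meson norm_triangle_ineq4 order_trans add_right_mono)
    also have "\<dots> = \<bar>1 - x\<^sup>2\<bar> * norm (poly (derivs k (chebS n)) (of_real x))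
        + real (2 * k) * \<bar>x\<bar> * norm (poly (derivs (k - 1) (chebS n)) (of_real x))
        + real (k * (k - 1)) * norm (poly (derivs (k - 2) (chebS n)) (of_real x))"
    proof -
      have "1 - (complex_of_real x)\<^sup>2 = of_real (1 - x\<^sup>2)" by simp
      thus ?thesis by (simp only: norm_mult norm_of_nat norm_of_real)
    qed
    also have "\<dots> \<le> 1 * (C k * real n ^ k) + real (2 * k) * 1 * (C (k - 1) * real n ^ k)
        + real (k * (k - 1)) * (C (k - 2) * real n ^ k)"
    proof -
      have "x\<^sup>2 \<le> 1" using x by (subst abs_square_le_1) auto
      hence "\<bar>1 - x\<^sup>2\<bar> \<le> 1" using zero_le_power2 [of x] by linarith
      moreover have "\<bar>x\<bar> \<le> 1" using x by auto
      ultimately show ?thesis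
        by (intro add_mono mult_mono C' n) (simp_all add: C(1))
    qed
    finally show ?thesis by (simp add: algebra_simps)
  qed
  thus ?thesis using C(1)
    by (intro exI [of _ "C k + real (2 * k) * C (k - 1) + real (k * (k - 1)) * C (k - 2)"]) auto
qed

lemma nodal_derivs_interior:
  assumes x: "x \<in> {-1<..<1}"
  obtains C where "C \<ge> 0" "\<forall>n\<ge>1. \<forall>k\<le>m. norm (poly (derivs k (nodal n)) (complex_of_real x)) \<le> C * real n ^ k"
proof -
  have "\<forall>k. \<exists>C\<ge>0. \<forall>n\<ge>1. norm (poly (derivs k (nodal n)) (complex_of_real x)) \<le> C * real n ^ k"
    using nodal_interior_bound [OF x] by blast
  then obtain C where C: "\<And>k. C k \<ge> 0" "\<And>n k. n \<ge> 1 \<Longrightarrow> norm (poly (derivs k (nodal n)) (complex_of_real x)) \<le> C k * real n ^ k"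
    by metis
  show ?thesis
  proof (rule that [of "\<Sum>k\<le>m. C k"]; (intro allI impI ballI)?)
    show "(\<Sum>k\<le>m. C k) \<ge> 0" using C(1) by (intro sum_nonneg)
    fix n k assume n: "n \<ge> (1::nat)" and k: "k \<le> m"
    have "C k \<le> (\<Sum>k\<le>m. C k)" using C(1) k by (intro member_le_sum) auto
    thus "norm (poly (derivs k (nodal n)) (complex_of_real x)) \<le> (\<Sum>k\<le>m. C k) * real n ^ k"
      by (intro order_trans [OF C(2) [OF n]] mult_right_mono) auto
  qed
qed

lemma nodal_derivs_endpoint:
  assumes x: "x = 1 \<or> x = (-1::real)"
  obtains C where "C \<ge> 0" "\<forall>n\<ge>1. \<forall>k\<in>{1..m}.
      norm (poly (derivs k (nodal n)) (complex_of_real x)) \<le> C * real n powr (2 * real k - 1)"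
proof -
  have "\<forall>k. \<exists>C\<ge>0. \<forall>n\<ge>1. norm (poly (derivs (Suc k) (nodal n)) (complex_of_real x)) \<le> C * real n ^ (2 * k + 1)"
    using nodal_endpoint_bound [of "complex_of_real x"] x by auto
  then obtain C where C: "\<And>k. C k \<ge> 0" "\<And>n k. n \<ge> 1 \<Longrightarrow> norm (poly (derivs (Suc k) (nodal n)) (complex_of_real x)) \<le> C k * real n ^ (2 * k + 1)"
    by metis
  show ?thesis
  proof (rule that [of "\<Sum>k\<le>m. C k"]; (intro allI impI ballI)?)
    show "(\<Sum>k\<le>m. C k) \<ge> 0" using C(1) by (intro sum_nonneg)
    fix n k assume n: "n \<ge> (1::nat)" and "k \<in> {1..m}"
    hence k: "1 \<le> k" "k \<le> m" by auto
    obtain i where i: "k = Suc i" using k(1) by (cases k) auto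
    have "C i \<le> (\<Sum>k\<le>m. C k)" using C(1) k i by (intro member_le_sum) auto
    hence "norm (poly (derivs k (nodal n)) (complex_of_real x)) \<le> (\<Sum>k\<le>m. C k) * real n ^ (2 * i + 1)"
      unfolding i by (intro order_trans [OF C(2) [OF n]] mult_right_mono) auto
    also have "real n ^ (2 * i + 1) = real n powr (2 * real k - 1)"
      using n powr_realpow [of "real n" "2 * i + 1"] by (simp add: i)
    finally show "norm (poly (derivs k (nodal n)) (complex_of_real x)) \<le> (\<Sum>k\<le>m. C k) * real n powr (2 * real k - 1)" .
  qed
qed

lemma nodal_derivs_sum_interior:
  assumes x: "x \<in> {-1<..<1}"
  obtains C where "\<forall>n\<ge>1. (\<Sum>k\<le>m. norm (poly (derivs k (nodal n)) (complex_of_real x))) \<le> C * real n powr real m"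
proof -
  obtain C where C: "C \<ge> 0" "\<forall>n\<ge>1. \<forall>k\<le>m. norm (poly (derivs k (nodal n)) (complex_of_real x)) \<le> C * real n ^ k"
    using nodal_derivs_interior [where m = m, OF x] .
  show ?thesis
  proof (rule that [of "Suc m * C"], intro allI impI)
    fix n :: nat assume n: "n \<ge> 1"
    have "(\<Sum>k\<le>m. norm (poly (derivs k (nodal n)) (complex_of_real x))) \<le> (\<Sum>k\<le>m. C * real n ^ m)"
    proof (rule sum_mono)
      fix k assume "k \<in> {..m}"
      hence k: "k \<le> m" by simp
      have "C * real n ^ k \<le> C * real n ^ m" using C(1) n k by (intro mult_left_mono power_increasing) auto
      thus "norm (poly (derivs k (nodal n)) (complex_of_real x)) \<le> C * real n ^ m" using C(2) n k by fastforce
    qed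
    also have "\<dots> = Suc m * C * real n powr real m" using n by (simp add: powr_realpow)
    finally show "(\<Sum>k\<le>m. norm (poly (derivs k (nodal n)) (complex_of_real x))) \<le> Suc m * C * real n powr real m" .
  qed
qed

lemma nodal_derivs_sum_endpoint:
  assumes x: "x = 1 \<or> x = (-1::real)"
  obtains C where "\<forall>n\<ge>1. (\<Sum>k\<le>m. norm (poly (derivs k (nodal n)) (complex_of_real x))) \<le> C * real n powr (2 * real m - 1)"
proof -
  obtain C where C: "C \<ge> 0" "\<forall>n\<ge>1. \<forall>k\<in>{1..m}.
      norm (poly (derivs k (nodal n)) (complex_of_real x)) \<le> C * real n powr (2 * real k - 1)"
    using nodal_derivs_endpoint [where m = m, OF x] .
  have "complex_of_real (x\<^sup>2) = 1" using x by auto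
  hence zero: "poly (nodal n) (complex_of_real x) = 0" for n by (simp add: poly_nodal)
  show ?thesis
  proof (rule that [of "Suc m * C"], intro allI impI)
    fix n :: nat assume n: "n \<ge> 1"
    have "(\<Sum>k\<le>m. norm (poly (derivs k (nodal n)) (complex_of_real x))) \<le> (\<Sum>k\<le>m. C * real n powr (2 * real m - 1))"
    proof (rule sum_mono)
      fix k assume k: "k \<in> {..m}"
      show "norm (poly (derivs k (nodal n)) (complex_of_real x)) \<le> C * real n powr (2 * real m - 1)"
      proof (cases "k = 0")
        case True
        thus ?thesis using zero C(1) by simp
      next
        case False
        have "C * real n powr (2 * real k - 1) \<le> C * real n powr (2 * real m - 1)"
          using C(1) n k by (intro mult_left_mono powr_mono) auto
        moreover have "norm (poly (derivs k (nodal n)) (complex_of_real x)) \<le> C * real n powr (2 * real k - 1)"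
          using C(2) n False k by simp
        ultimately show ?thesis by linarith
      qed
    qed
    thus "(\<Sum>k\<le>m. norm (poly (derivs k (nodal n)) (complex_of_real x))) \<le> Suc m * C * real n powr (2 * real m - 1)" by simp
  qed
qed

section \<open>Size of the nodal polynomial off the interval\<close>

text \<open>The squared moduli separate into a real and an imaginary part.  Hence \<open>\<bar>sin (n w)\<bar> \<ge> sinh (n \<bar>Im w\<bar>)\<close>, which
is the source of the exponential growth of the nodal polynomial off \<open>[-1,1]\<close>.\<close>

lemma norm_cos_sin_sinh:
  "norm (cos z) ^ 2 = cos (Re z) ^ 2 + sinh (Im z) ^ 2"
  "norm (sin z) ^ 2 = sin (Re z) ^ 2 + sinh (Im z) ^ 2"
proof -
  show *: "norm (cos z) ^ 2 = cos (Re z) ^ 2 + sinh (Im z) ^ 2" for z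
    by (simp add: norm_cos_squared sinh_field_def power_divide exp_minus)
  show "norm (sin z) ^ 2 = sin (Re z) ^ 2 + sinh (Im z) ^ 2"
    using * [of "of_real pi / 2 - z"] by (simp add: sin_cos_eq)
qed

text \<open>For \<open>z = cos w\<close> the sum of the distances to the foci \<open>\<plusminus>1\<close> is \<open>2 cosh (Im w)\<close>: level curves are the
Bernstein ellipses.  Expressing the hypothesis through this sum avoids any discussion of the branch
of \<open>w\<close>.\<close>

lemma nodal_lower_bound:
  assumes b: "b \<ge> 0" "2 * cosh b \<le> norm (z - 1) + norm (z + 1)"
  shows "sqrt (norm (1 - z\<^sup>2)) * sinh (real n * b) \<le> norm (poly (nodal n) z)"
proof -
  define w where "w = Arccos z"
  have z: "z = cos w" by (simp add: w_def)
  define y where "y = \<bar>Im w\<bar>"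
  have cs: "norm (cos (w / 2)) ^ 2 + norm (sin (w / 2)) ^ 2 = cosh y"
    using cosh_double [of "y / 2"] cosh_square_eq [of "y / 2"] sin_cos_squared_add [of "Re w / 2"]
    by (simp add: norm_cos_sin_sinh y_def abs_if split: if_splits)
  have "z + 1 = 2 * cos (w / 2) ^ 2" "z - 1 = - (2 * sin (w / 2) ^ 2)"
    using cos_double_cos [of "w / 2"] cos_double_sin [of "w / 2"]
    by (simp_all add: z cos_squared_eq)
  hence "norm (z - 1) + norm (z + 1) = 2 * cosh y"
    unfolding cs [symmetric] by (simp add: norm_mult norm_power)
  with b have "cosh b \<le> cosh y" by simp
  moreover have "0 \<le> y" by (simp add: y_def)
  ultimately have "b \<le> y" using b(1) cosh_real_nonneg_le_iff by blast
  hence "sinh (real n * b) \<le> sinh (real n * y)"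
    by (simp add: mult_left_mono)
  also have "\<dots> \<le> norm (sin (of_nat n * w))"
  proof (rule power2_le_imp_le)
    show "sinh (real n * y) ^ 2 \<le> norm (sin (of_nat n * w)) ^ 2"
      by (simp add: norm_cos_sin_sinh y_def abs_if)
  qed auto
  finally have "sinh (real n * b) \<le> norm (sin (of_nat n * w))" .
  moreover have "sqrt (norm (1 - z\<^sup>2)) = norm (sin w)"
    unfolding z one_minus_cos_squared by (simp add: norm_power)
  ultimately show ?thesis
    unfolding z poly_nodal_cos norm_mult by (simp add: mult_left_mono)
qed

lemma norm_nodal_le_1:
  assumes "x \<in> {-1..1}"
  shows "norm (poly (nodal n) (of_real x)) \<le> 1"
proof -
  define t where "t = arccos x"
  have "x = cos t" using assms by (simp add: t_def)
  hence "poly (nodal n) (of_real x) = sin (of_real t) * sin (of_nat n * of_real t)"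
    by (simp add: poly_nodal_cos flip: cos_of_real)
  also have "\<dots> = of_real (sin t * sin (real n * t))" by (simp flip: sin_of_real)
  finally have "norm (poly (nodal n) (of_real x)) = \<bar>sin t\<bar> * \<bar>sin (real n * t)\<bar>"
    by (simp only: norm_of_real abs_mult)
  also have "\<dots> \<le> 1 * 1" by (intro mult_mono) auto
  finally show ?thesis by simp
qed

lemma nodal_nonzero:
  assumes n: "n \<ge> 1" and z: "z \<notin> complex_of_real ` {-1..1}"
  shows "poly (nodal n) z \<noteq> 0"
proof
  assume *: "poly (nodal n) z = 0"
  define w where "w = Arccos z"
  have zw: "z = cos w" by (simp add: w_def)
  have "sin w = 0 \<or> sin (of_nat n * w) = 0"
    using * unfolding zw poly_nodal_cos by simp
  hence "\<exists>r::real. w = of_real r"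
  proof
    assume "sin w = 0"
    thus ?thesis unfolding sin_eq_0 by blast
  next
    assume "sin (of_nat n * w) = 0"
    then obtain k :: int where "of_nat n * w = of_real (real_of_int k * pi)"
      unfolding sin_eq_0 by blast
    hence "w = of_real (real_of_int k * pi / real n)"
      using n by (simp add: field_simps)
    thus ?thesis by blast
  qed
  then obtain r where "w = of_real r" by blast
  hence "z = of_real (cos r)" by (simp add: zw cos_of_real)
  moreover have "cos r \<in> {-1..1}" by simp
  ultimately show False using z by blast
qed

lemma cosh_le_1_plus_square:
  assumes "0 \<le> x" "x \<le> (1::real)"
  shows "cosh x \<le> 1 + x\<^sup>2"
proof -
  have *: "exp y \<le> 1 + y + y\<^sup>2" if "\<bar>y\<bar> \<le> 1" for y :: real
  proof (cases "y \<ge> 0")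
    case True thus ?thesis using exp_bound [of y] that by simp
  next
    case False
    have "exp y \<le> 1 + y + y\<^sup>2 / 2"
    proof -
      obtain t where "\<bar>t\<bar> \<le> \<bar>y\<bar>" "exp y = (\<Sum>m<3. (y ^ m) / fact m) + exp t / fact 3 * y ^ 3"
        using Maclaurin_exp_le [of y 3] by blast
      moreover have "exp t / fact 3 * y ^ 3 \<le> 0"
        using False by (intro mult_nonneg_nonpos) (auto simp: power_less_zero_eq less_imp_le)
      ultimately show ?thesis by (simp add: eval_nat_numeral)
    qed
    also have "\<dots> \<le> 1 + y + y\<^sup>2" by simp
    finally show ?thesis .
  qed
  show ?thesis using * [of x] * [of "- x"] assms by (simp add: cosh_field_def)
qed

text \<open>Reflect one of the two segments in the real axis: the sum is the length of a broken line with
horizontal extent 2 and vertical extent \<open>2 * \<bar>Im w\<bar>\<close>.\<close>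

lemma focal_sum_ge_Im: "2 * sqrt (1 + (Im w)\<^sup>2) \<le> norm (w - 1) + norm (w + 1)"
proof -
  have "norm (2 * z) = 2 * norm z" for z :: complex by (simp add: norm_mult)
  hence "2 * sqrt (1 + (Im w)\<^sup>2) = norm (2 * Complex 1 (- Im w))"
    by (simp only:) (simp add: cmod_def)
  also have "2 * Complex 1 (- Im w) = - (w - 1) + cnj (w + 1)" by (simp add: complex_eq_iff)
  also have "norm \<dots> \<le> norm (w - 1) + norm (w + 1)"
    by (rule order_trans [OF norm_triangle_ineq]) (simp only: norm_minus_cancel complex_mod_cnj order_refl)
  finally show ?thesis .
qed

text \<open>A point at distance \<open>\<delta>\<close> from the interval either lies off the real axis by \<open>\<delta> / 2\<close> or overshoots an end
point by \<open>\<delta> / 2\<close>; in both cases it lies outside a fixed Bernstein ellipse.\<close>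

lemma focal_sum_lower_bound:
  assumes \<delta>: "0 < \<delta>" "\<delta> \<le> 1" and w: "\<And>x. x \<in> {-1..1} \<Longrightarrow> \<delta> \<le> norm (w - complex_of_real x)"
  shows "2 * cosh (\<delta> / 4) \<le> norm (w - 1) + norm (w + 1)"
proof -
  have c: "cosh (\<delta> / 4) \<le> 1 + (\<delta> / 4)\<^sup>2" using \<delta> by (intro cosh_le_1_plus_square) auto
  show ?thesis
  proof (cases "\<bar>Im w\<bar> \<ge> \<delta> / 2")
    case True
    have "(1 + (\<delta> / 4)\<^sup>2)\<^sup>2 \<le> 1 + (\<delta> / 2)\<^sup>2"
    proof -
      have "\<delta> ^ 4 \<le> \<delta> ^ 2" using \<delta> by (intro power_decreasing) auto
      moreover have "(1 + (\<delta> / 4)\<^sup>2)\<^sup>2 = 1 + \<delta> ^ 2 / 8 + \<delta> ^ 4 / 256"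
        by (simp add: eval_nat_numeral field_simps)
      moreover have "(\<delta> / 2)\<^sup>2 = \<delta> ^ 2 / 4" by (simp add: power_divide)
      ultimately show ?thesis using zero_le_power2 [of \<delta>] by linarith
    qed
    also have "\<dots> \<le> 1 + (Im w)\<^sup>2"
      using power_mono [OF True, of 2] \<delta> by simp
    finally have "1 + (\<delta> / 4)\<^sup>2 \<le> sqrt (1 + (Im w)\<^sup>2)" by (intro real_le_rsqrt)
    hence "2 * cosh (\<delta> / 4) \<le> 2 * sqrt (1 + (Im w)\<^sup>2)" using c by linarith
    also have "\<dots> \<le> norm (w - 1) + norm (w + 1)" by (rule focal_sum_ge_Im)
    finally show ?thesis .
  next
    case False
    define x where "x = max (-1) (min 1 (Re w))"
    have x: "x \<in> {-1..1}" by (auto simp: x_def)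
    have "\<delta> \<le> \<bar>Re (w - of_real x)\<bar> + \<bar>Im (w - of_real x)\<bar>"
      by (rule order_trans [OF w [OF x] cmod_le])
    hence "\<bar>Re w - x\<bar> \<ge> \<delta> / 2" using False by simp
    hence Re: "\<bar>Re w\<bar> \<ge> 1 + \<delta> / 2" using \<delta> unfolding x_def by linarith
    have "2 * cosh (\<delta> / 4) \<le> 2 * (1 + (\<delta> / 4)\<^sup>2)" using c by simp
    also have "(\<delta> / 4)\<^sup>2 \<le> \<delta> / 2" using mult_left_mono [of \<delta> 1 \<delta>] \<delta> by (simp add: power2_eq_square)
    hence "2 * (1 + (\<delta> / 4)\<^sup>2) \<le> 2 * \<bar>Re w\<bar>" using Re by simp
    also have "\<dots> = \<bar>Re ((w - 1) + (w + 1))\<bar>" by simp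
    also have "\<dots> \<le> norm ((w - 1) + (w + 1))" by (rule abs_Re_le_cmod)
    also have "\<dots> \<le> norm (w - 1) + norm (w + 1)" by (rule norm_triangle_ineq)
    finally show ?thesis by simp
  qed
qed

lemma nodal_lower_bound_far:
  assumes \<delta>: "0 < \<delta>" "\<delta> \<le> 1" and w: "\<And>x. x \<in> {-1..1} \<Longrightarrow> \<delta> \<le> norm (w - complex_of_real x)"
  shows "\<delta> * sinh (real n * (\<delta> / 4)) \<le> norm (poly (nodal n) w)"
proof -
  have "\<delta>\<^sup>2 \<le> norm (w - 1) * norm (w + 1)"
    unfolding power2_eq_square using w [of 1] w [of "-1"] \<delta> by (intro mult_mono) auto
  also have "\<dots> = norm (1 - w\<^sup>2)"
    by (simp add: power2_eq_square algebra_simps norm_minus_commute flip: norm_mult)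
  finally have "\<delta> \<le> sqrt (norm (1 - w\<^sup>2))" by (rule real_le_rsqrt)
  hence "\<delta> * sinh (real n * (\<delta> / 4)) \<le> sqrt (norm (1 - w\<^sup>2)) * sinh (real n * (\<delta> / 4))"
    using \<delta> by (intro mult_right_mono) auto
  also have "\<dots> \<le> norm (poly (nodal n) w)"
    using focal_sum_lower_bound [OF assms] \<delta> by (intro nodal_lower_bound) auto
  finally show ?thesis .
qed

lemma half_width_bound:
  assumes "0 \<le> u" "u \<le> 1"
  shows "cosh (u / 2) \<le> sqrt (1 + u\<^sup>2)" "cosh (u / 2) \<le> 1 + u\<^sup>2"
proof -
  have *: "cosh (u / 2) \<le> 1 + (u / 2)\<^sup>2" using assms by (intro cosh_le_1_plus_square) auto
  have "u ^ 4 \<le> u ^ 2" using assms by (intro power_decreasing) auto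
  moreover have "(1 + (u / 2)\<^sup>2)\<^sup>2 = 1 + u ^ 2 / 2 + u ^ 4 / 16"
    by (simp add: eval_nat_numeral field_simps)
  ultimately have "(1 + (u / 2)\<^sup>2)\<^sup>2 \<le> 1 + u\<^sup>2" using zero_le_power2 [of u] by linarith
  hence "1 + (u / 2)\<^sup>2 \<le> sqrt (1 + u\<^sup>2)" by (rule real_le_rsqrt)
  thus "cosh (u / 2) \<le> sqrt (1 + u\<^sup>2)" using * by linarith
  have "(u / 2)\<^sup>2 \<le> u\<^sup>2" by (simp add: power_divide)
  thus "cosh (u / 2) \<le> 1 + u\<^sup>2" using * by linarith
qed

text \<open>This separates the two properties of \<open>1 / sinh\<close> that enter the integrals over the rays: it is
\<open>O(1/x)\<close> at the origin and decays exponentially.\<close>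

lemma sinh_lower_bound: "x / 4 * exp (x / 2) \<le> sinh (x::real)" if "x \<ge> 0"
proof -
  have "exp (- x) * exp (- (x / 2)) \<le> 1 * exp (- (x / 2))"
    using that by (intro mult_right_mono) auto
  moreover have "1 + x / 2 \<le> exp (x / 2)" by (rule exp_ge_add_one_self)
  moreover have "exp (- (x / 2)) \<le> 1" using that by simp
  ultimately have "x / 2 \<le> exp (x / 2) - exp (- x) * exp (- (x / 2))" by linarith
  hence "x / 2 * exp (x / 2) \<le> (exp (x / 2) - exp (- x) * exp (- (x / 2))) * exp (x / 2)"
    by (intro mult_right_mono) auto
  also have "\<dots> = exp x - exp (- x)"
    by (simp add: algebra_simps flip: exp_add)
  finally have *: "x / 2 * exp (x / 2) \<le> exp x - exp (- x)" .
  thus ?thesis by (simp add: sinh_field_def)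
qed

lemma lobatto_point_bounds: "lobatto_point n j \<in> {-1..1}"
  by (simp add: lobatto_point_def)

lemma inj_on_lobatto_point:
  assumes "n \<ge> 1"
  shows "inj_on (lobatto_point n) {..n}"
proof (rule inj_onI)
  fix i j assume ij: "i \<in> {..n}" "j \<in> {..n}" "lobatto_point n i = lobatto_point n j"
  have *: "0 \<le> real k * pi / real n \<and> real k * pi / real n \<le> pi" if "k \<in> {..n}" for k
    using that assms by (simp add: field_simps)
  have "real i * pi / real n = real j * pi / real n"
    using cos_inj_pi [of "real i * pi / real n" "real j * pi / real n"] * [OF ij(1)] * [OF ij(2)] ij(3)
    by (simp add: lobatto_point_def)
  thus "i = j" using assms by (simp add: field_simps)
qed

lemma poly_nodal_lobatto_point:
  assumes "n \<ge> 1"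
  shows "poly (nodal n) (of_real (lobatto_point n j)) = 0"
proof -
  have "sin (real n * (real j * pi / real n)) = 0"
    using assms by (simp add: sin_npi)
  hence "sin (of_nat n * complex_of_real (real j * pi / real n)) = 0"
    by (metis of_real_0 of_real_mult of_real_of_nat_eq sin_of_real)
  thus ?thesis unfolding lobatto_point_def cos_of_real [symmetric] poly_nodal_cos by simp
qed

lemma lobatto_poly_unique:
  assumes n: "n \<ge> 1" and deg: "degree p \<le> n" "degree q \<le> n"
    and eq: "\<And>j. j \<le> n \<Longrightarrow> poly p (complex_of_real (lobatto_point n j)) = poly q (of_real (lobatto_point n j))"
  shows "p = q"
proof (rule poly_eqI_degree)
  define A where "A = (\<lambda>j. complex_of_real (lobatto_point n j)) ` {..n}"
  have "inj_on (\<lambda>j. complex_of_real (lobatto_point n j)) {..n}"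
    using inj_on_lobatto_point [OF n] by (auto simp: inj_on_def)
  hence "card A = Suc n" unfolding A_def by (subst card_image) auto
  thus "degree p < card A" "degree q < card A" using deg by auto
  show "poly p x = poly q x" if "x \<in> A" for x using that eq unfolding A_def by auto
qed

text \<open>Both sides have degree at most \<open>n + 1\<close>, the same coefficient of order \<open>n + 1\<close>, and the \<open>n + 1\<close>
Lobatto points as zeros, so their difference has degree at most \<open>n\<close> and too many zeros.\<close>

lemma nodal_factorization:
  assumes n: "n \<ge> 1"
  shows "nodal n = smult (coeff (nodal n) (Suc n)) (\<Prod>j\<le>n. [:- of_real (lobatto_point n j), 1:])"
proof -
  define Q where "Q = (\<Prod>j\<le>n. [:- complex_of_real (lobatto_point n j), 1:])"
  have dQ: "degree Q = Suc n" unfolding Q_def by (subst degree_prod_eq_sum_degree) auto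
  have lQ: "coeff Q (Suc n) = 1"
    using lead_coeff_prod [of "\<lambda>j. [:- complex_of_real (lobatto_point n j), 1:]" "{..n}"]
    unfolding Q_def [symmetric] dQ by simp
  define R where "R = nodal n - smult (coeff (nodal n) (Suc n)) Q"
  have "coeff R i = 0" if "i > n" for i
  proof (cases "i = Suc n")
    case False
    thus ?thesis using that degree_nodal [OF n] dQ by (simp add: R_def coeff_eq_0)
  qed (simp add: R_def lQ)
  hence "degree R \<le> n" by (auto intro: degree_le)
  have "R = 0"
  proof (rule lobatto_poly_unique [OF n \<open>degree R \<le> n\<close>])
    fix j assume "j \<le> n"
    hence "poly Q (of_real (lobatto_point n j)) = 0"
      unfolding Q_def poly_prod by (auto intro!: prod_zero bexI [of _ j])
    thus "poly R (of_real (lobatto_point n j)) = poly 0 (of_real (lobatto_point n j))"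
      unfolding R_def by (simp add: poly_nodal_lobatto_point [OF n])
  qed auto
  thus ?thesis by (simp add: R_def Q_def)
qed

text \<open>All zeros are real, so every factor \<open>\<bar>z - x\<^sub>j\<bar>\<close> decreases when \<open>z\<close> is projected to the real axis.
This makes the ratio \<open>L \<xi> / L (\<xi> + \<i> u)\<close> harmless even for \<open>u\<close> much smaller than \<open>1 / n\<close>, where
\<open>sinh (n u)\<close> gives no information.\<close>

lemma norm_nodal_vertical:
  assumes n: "n \<ge> 1"
  shows "norm (poly (nodal n) (of_real (Re z))) \<le> norm (poly (nodal n) z)"
proof -
  have "(\<Prod>j\<le>n. norm (complex_of_real (Re z) - of_real (lobatto_point n j)))
      \<le> (\<Prod>j\<le>n. norm (z - of_real (lobatto_point n j)))"
  proof (intro prod_mono conjI)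
    fix j
    have "norm (complex_of_real (Re z) - of_real (lobatto_point n j)) = \<bar>Re (z - of_real (lobatto_point n j))\<bar>"
      by (simp flip: of_real_diff)
    also have "\<dots> \<le> norm (z - of_real (lobatto_point n j))" by (rule abs_Re_le_cmod)
    finally show "norm (complex_of_real (Re z) - of_real (lobatto_point n j)) \<le> norm (z - of_real (lobatto_point n j))" .
  qed auto
  hence *: "norm (coeff (nodal n) (Suc n)) * (\<Prod>j\<le>n. norm (complex_of_real (Re z) - of_real (lobatto_point n j)))
      \<le> norm (coeff (nodal n) (Suc n)) * (\<Prod>j\<le>n. norm (z - of_real (lobatto_point n j)))"
    by (rule mult_left_mono) auto
  have "norm (poly (nodal n) y) = norm (coeff (nodal n) (Suc n)) * (\<Prod>j\<le>n. norm (y - of_real (lobatto_point n j)))" for y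
    by (subst nodal_factorization [OF n]) (simp add: norm_mult poly_prod prod_norm)
  thus ?thesis using * by simp
qed

section \<open>Interpolation of a simple pole\<close>

definition lagrange :: "nat \<Rightarrow> nat \<Rightarrow> complex poly" where
  "lagrange n j = (\<Prod>i\<in>{..n} - {j}. smult (1 / of_real (lobatto_point n j - lobatto_point n i))
                                        [:- of_real (lobatto_point n i), 1:])"

lemma degree_lagrange: "j \<le> n \<Longrightarrow> degree (lagrange n j) \<le> n"
proof -
  assume "j \<le> n"
  have "degree (lagrange n j) \<le> (\<Sum>i\<in>{..n} - {j}. 1)"
    unfolding lagrange_def
    by (rule order_trans [OF degree_prod_sum_le sum_mono]) (auto intro: order_trans [OF degree_smult_le])
  also have "\<dots> = n" using \<open>j \<le> n\<close> by simp
  finally show ?thesis .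
qed

lemma poly_lagrange:
  assumes "n \<ge> 1" "i \<le> n" "j \<le> n"
  shows "poly (lagrange n j) (of_real (lobatto_point n i)) = (if i = j then 1 else 0)"
proof (cases "i = j")
  case True
  have "lobatto_point n j \<noteq> lobatto_point n k" if "k \<in> {..n} - {j}" for k
    using inj_on_lobatto_point [OF assms(1)] that assms(3) by (auto simp: inj_on_def)
  thus ?thesis unfolding True lagrange_def poly_prod
    by (auto intro!: prod.neutral simp: diff_divide_distrib [symmetric] simp flip: of_real_diff)
next
  case False
  thus ?thesis using assms unfolding lagrange_def poly_prod
    by (auto intro!: prod_zero bexI [of _ i])
qed

lemma lagrange_interpolation:
  assumes n: "n \<ge> 1" and p: "degree p \<le> n"
  shows "p = (\<Sum>j\<le>n. smult (poly p (of_real (lobatto_point n j))) (lagrange n j))"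
proof (rule lobatto_poly_unique [OF n p])
  show "degree (\<Sum>j\<le>n. smult (poly p (of_real (lobatto_point n j))) (lagrange n j)) \<le> n"
    by (intro degree_sum_le) (auto intro: order_trans [OF degree_smult_le] degree_lagrange)
  fix i assume "i \<le> n"
  thus "poly p (of_real (lobatto_point n i))
      = poly (\<Sum>j\<le>n. smult (poly p (of_real (lobatto_point n j))) (lagrange n j)) (of_real (lobatto_point n i))"
    using n by (simp add: poly_sum poly_lagrange if_distrib [of "\<lambda>x. _ * x"] sum.delta cong: if_cong)
qed

lemma poly_derivs_lobatto:
  assumes n: "n \<ge> 1" and p: "degree p \<le> n"
  shows "poly (derivs m p) z = (\<Sum>j\<le>n. poly p (of_real (lobatto_point n j)) * poly (derivs m (lagrange n j)) z)"
  by (subst lagrange_interpolation [OF n p]) (simp add: higher_pderiv_sum higher_pderiv_smult poly_sum)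

text \<open>The \<open>m\<close>-th derivative of \<open>x \<mapsto> L x / (L w (w - x))\<close>, written out by the Leibniz rule.\<close>

definition pole_error :: "nat \<Rightarrow> nat \<Rightarrow> complex \<Rightarrow> complex \<Rightarrow> complex" where
  "pole_error n m w x =
     (\<Sum>k\<le>m. fact m / fact k * poly (derivs k (nodal n)) x / (w - x) ^ (Suc m - k)) / poly (nodal n) w"

text \<open>With \<open>L = (X - w) q + L w\<close>, the polynomial \<open>q / L w\<close> has degree at most \<open>n\<close> and agrees with \<open>1 / (w - x)\<close>
where \<open>L\<close> vanishes, so it is the interpolant.  Differentiating the division identity relates the
derivatives of \<open>q\<close> to those of \<open>L\<close>.  The interpolant appears through the Lagrange basis because in this form it
is a fixed finite combination of the values at the nodes, which commutes with integration over \<open>w\<close>.\<close>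

lemma pole_interpolation_error:
  assumes n: "n \<ge> 1" and w: "w \<notin> complex_of_real ` {-1..1}" and wx: "w \<noteq> x"
  shows "fact m / (w - x) ^ Suc m
          - (\<Sum>j\<le>n. 1 / (w - of_real (lobatto_point n j)) * poly (derivs m (lagrange n j)) x)
         = pole_error n m w x"
proof -
  define q where "q = synthetic_div (nodal n) w"
  define L where "L = poly (nodal n) w"
  have L0: "L \<noteq> 0" unfolding L_def by (rule nodal_nonzero [OF n w])
  have q: "nodal n = [:- w, 1:] * q + [:L:]"
    using synthetic_div_correct' [of w "nodal n"] by (simp add: q_def L_def)
  have "degree q \<le> n"
    unfolding q_def using degree_nodal [OF n] by (simp add: degree_synthetic_div)
  have node: "poly q (of_real (lobatto_point n j)) = L / (w - of_real (lobatto_point n j))" for j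
  proof -
    have "w \<noteq> of_real (lobatto_point n j)" using w lobatto_point_bounds by blast
    moreover have "0 = (of_real (lobatto_point n j) - w) * poly q (of_real (lobatto_point n j)) + L"
      using arg_cong [OF q, of "\<lambda>p. poly p (of_real (lobatto_point n j))"]
            poly_nodal_lobatto_point [OF n, of j] by (simp add: algebra_simps)
    ultimately show ?thesis by (simp add: field_simps)
  qed
  have rec: "poly (derivs (Suc k) (nodal n)) x
       = of_nat (Suc k) * poly (derivs k q) x - (w - x) * poly (derivs (Suc k) q) x" for k
  proof -
    have pn: "pderiv (of_nat i * y) = of_nat i * pderiv y" for i and y :: "complex poly"
      by (simp add: pderiv_mult)
    have pw: "pderiv [:- w, 1:] = 1" by (simp add: pderiv_pCons)
    have *: "derivs (Suc k) (nodal n) = of_nat (Suc k) * derivs k q + [:- w, 1:] * derivs (Suc k) q"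
    proof (induction k)
      case 0
      show ?case
        by (subst q) (simp add: pderiv_add pderiv_mult [of "[:- w, 1:]"] pw pderiv_pCons [of L]
                      del: mult_pCons_left)
    next
      case (Suc k)
      have "derivs (Suc (Suc k)) (nodal n)
          = pderiv (of_nat (Suc k) * derivs k q + [:- w, 1:] * derivs (Suc k) q)"
        using Suc.IH by simp
      also have "\<dots> = of_nat (Suc k) * derivs (Suc k) q
          + ([:- w, 1:] * derivs (Suc (Suc k)) q + derivs (Suc k) q * 1)"
        by (simp only: pderiv_add pn pderiv_mult [of "[:- w, 1:]"] pw funpow.simps o_apply)
      finally show ?case by (simp add: algebra_simps del: mult_pCons_left)
    qed
    show ?thesis using arg_cong [OF *, of "\<lambda>p. poly p x"] by (simp add: algebra_simps)
  qed
  define Y where "Y m = (\<Sum>k\<le>m. fact m / fact k * poly (derivs k (nodal n)) x / (w - x) ^ (Suc m - k))" for m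
  have Y_Suc: "Y (Suc m) = (of_nat (Suc m) * Y m + poly (derivs (Suc m) (nodal n)) x) / (w - x)" for m
  proof -
    have "Y (Suc m) = (\<Sum>k\<le>m. fact (Suc m) / fact k * poly (derivs k (nodal n)) x / (w - x) ^ (Suc (Suc m) - k))
          + poly (derivs (Suc m) (nodal n)) x / (w - x)"
      unfolding Y_def by (simp del: fact_Suc)
    also have "(\<Sum>k\<le>m. fact (Suc m) / fact k * poly (derivs k (nodal n)) x / (w - x) ^ (Suc (Suc m) - k))
       = (\<Sum>k\<le>m. of_nat (Suc m) / (w - x) * (fact m / fact k * poly (derivs k (nodal n)) x / (w - x) ^ (Suc m - k)))"
      by (intro sum.cong refl) (simp add: Suc_diff_le mult_ac)
    also have "\<dots> = of_nat (Suc m) / (w - x) * Y m" unfolding Y_def sum_distrib_left ..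
    finally show ?thesis by (simp add: add_divide_distrib del: of_nat_Suc)
  qed
  have Y: "Y m = fact m * L / (w - x) ^ Suc m - poly (derivs m q) x"
  proof (induction m)
    case 0
    have "poly (nodal n) x = L - (w - x) * poly q x"
      by (subst q) (simp add: algebra_simps)
    thus ?case using wx by (simp add: Y_def diff_divide_distrib)
  next
    case (Suc m)
    have *: "(N * (F / y ^ Suc m - Q) + (N * Q - y * Q')) / y = N * F / y ^ Suc (Suc m) - Q'"
      if "y \<noteq> 0" for N F y Q Q' :: complex
      using that by (simp add: field_simps)
    show ?case unfolding Y_Suc rec Suc.IH using wx
      by (subst *) (simp_all add: algebra_simps)
  qed
  have "(\<Sum>j\<le>n. 1 / (w - of_real (lobatto_point n j)) * poly (derivs m (lagrange n j)) x)
       = poly (derivs m q) x / L"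
    unfolding poly_derivs_lobatto [OF n \<open>degree q \<le> n\<close>] node using L0
    by (simp add: sum_divide_distrib)
  moreover have "pole_error n m w x = Y m / L"
    by (simp add: pole_error_def Y_def L_def)
  ultimately show ?thesis unfolding Y using L0 by (simp add: diff_divide_distrib)
qed

section \<open>Superpositions of simple poles\<close>

text \<open>By the mean value inequality the difference quotients inherit the bound on the derivatives, so
dominated convergence applies.  Convexity of \<open>S\<close> lets the statement cover the segment
\<open>[-1,1]\<close> as well as open half-planes.\<close>

lemma has_field_derivative_integral_dominated:
  fixes f f' :: "complex \<Rightarrow> 'a \<Rightarrow> complex"
  assumes S: "convex S" "x0 \<in> S"
    and deriv: "\<And>x t. x \<in> S \<Longrightarrow> t \<in> space M \<Longrightarrow> ((\<lambda>x. f x t) has_field_derivative f' x t) (at x within S)"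
    and int: "\<And>x. x \<in> S \<Longrightarrow> integrable M (f x)" "f' x0 \<in> borel_measurable M" "integrable M G"
    and bound: "\<And>x t. x \<in> S \<Longrightarrow> t \<in> space M \<Longrightarrow> norm (f' x t) \<le> G t"
  shows "((\<lambda>x. \<integral>t. f x t \<partial>M) has_field_derivative (\<integral>t. f' x0 t \<partial>M)) (at x0 within S)"
  unfolding has_field_derivative_iff tendsto_at_iff_sequentially
proof (intro allI impI)
  fix X :: "nat \<Rightarrow> complex"
  assume X: "\<forall>i. X i \<in> S - {x0}" "X \<longlonglongrightarrow> x0"
  define q where "q i t = (f (X i) t - f x0 t) / (X i - x0)" for i t
  have "(\<lambda>i. \<integral>t. q i t \<partial>M) \<longlonglongrightarrow> (\<integral>t. f' x0 t \<partial>M)"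
  proof (rule integral_dominated_convergence [where w = G])
    show "q i \<in> borel_measurable M" for i
      unfolding q_def using int(1) [of "X i"] int(1) [of x0] X S
      by (intro borel_measurable_divide borel_measurable_diff) auto
    show "AE t in M. (\<lambda>i. q i t) \<longlonglongrightarrow> f' x0 t"
    proof (rule AE_I2)
      fix t assume "t \<in> space M"
      thus "(\<lambda>i. q i t) \<longlonglongrightarrow> f' x0 t"
        using deriv [OF S(2)] X
        unfolding has_field_derivative_iff tendsto_at_iff_sequentially q_def by (auto simp: o_def)
    qed
    show "AE t in M. norm (q i t) \<le> G t" for i
    proof (rule AE_I2)
      fix t assume t: "t \<in> space M"
      have "norm (f (X i) t - f x0 t) \<le> G t * norm (X i - x0)"
        using field_differentiable_bound [OF S(1) deriv [OF _ t] bound [OF _ t]] X S(2) by auto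
      thus "norm (q i t) \<le> G t"
        using X by (simp add: q_def norm_divide field_simps)
    qed
  qed (use int in auto)
  moreover have "(\<integral>t. q i t \<partial>M) = ((\<integral>t. f (X i) t \<partial>M) - (\<integral>t. f x0 t \<partial>M)) / (X i - x0)" for i
    unfolding q_def using int(1) [of "X i"] int(1) [of x0] X S by simp
  ultimately show "((\<lambda>y. ((\<integral>t. f y t \<partial>M) - (\<integral>t. f x0 t \<partial>M)) / (y - x0)) \<circ> X) \<longlonglongrightarrow> (\<integral>t. f' x0 t \<partial>M)"
    by (simp add: o_def)
qed

lemma nth_deriv_eqI:
  assumes D: "\<And>k x. k < m \<Longrightarrow> x \<in> {-1..1} \<Longrightarrow> (D k has_vector_derivative D (Suc k) x) (at x within {-1..1})"
    and f: "\<And>x. x \<in> {-1..1} \<Longrightarrow> f x = D 0 x" and x: "x \<in> {-1..1}"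
  shows "nth_deriv m f x = D m x"
  using D x
proof (induction m arbitrary: x)
  case 0
  thus ?case by (simp add: nth_deriv_def f)
next
  case (Suc m)
  have IH: "nth_deriv m f y = D m y" if "y \<in> {-1..1}" for y
    using Suc.IH [OF _ that] Suc.prems(1) by auto
  have "(D m has_vector_derivative D (Suc m) x) (at x within {-1..1})"
    using Suc.prems by auto
  hence "(nth_deriv m f has_vector_derivative D (Suc m) x) (at x within {-1..1})"
    by (rule has_vector_derivative_transform [OF Suc.prems(2), rotated]) (simp add: IH)
  hence "vector_derivative (nth_deriv m f) (at x within cbox (-1) 1) = D (Suc m) x"
    using Suc.prems(2) by (intro vector_derivative_within_cbox) auto
  thus ?case by (simp add: nth_deriv_def)
qed

text \<open>The poles \<open>w t\<close> with density \<open>\<mu> t\<close> may accumulate at a point of \<open>[-1,1]\<close>, but only so fast that the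
superposition can be differentiated \<open>m\<close> times under the integral, uniformly on \<open>[-1,1]\<close>.  The
function \<open>d\<close> is a lower bound for the distance from the pole to the interval.\<close>

definition pole_density :: "nat \<Rightarrow> real measure \<Rightarrow> (real \<Rightarrow> complex) \<Rightarrow> (real \<Rightarrow> complex) \<Rightarrow> bool" where
  "pole_density m M w \<mu> \<longleftrightarrow> w \<in> borel_measurable M \<and> \<mu> \<in> borel_measurable M \<and>
     (\<exists>d. (\<forall>t\<in>space M. 0 < d t \<and> (\<forall>x\<in>{-1..1}. d t \<le> norm (w t - of_real x))) \<and>
          (\<forall>k\<le>m. integrable M (\<lambda>t. norm (\<mu> t) / d t ^ Suc k)))"

lemma pole_density_integrable:
  assumes pd: "pole_density m M w \<mu>" and k: "k \<le> m" and x: "x \<in> {-1..1::real}"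
  shows "integrable M (\<lambda>t. c * \<mu> t / (w t - of_real x) ^ Suc k)"
proof -
  obtain d where meas: "w \<in> borel_measurable M" "\<mu> \<in> borel_measurable M"
    and d: "\<And>t x. t \<in> space M \<Longrightarrow> 0 < d t" "\<And>t x. t \<in> space M \<Longrightarrow> x \<in> {-1..1} \<Longrightarrow> d t \<le> norm (w t - of_real x)"
    and int: "integrable M (\<lambda>t. norm (\<mu> t) / d t ^ Suc k)"
    using pd k unfolding pole_density_def by blast
  show ?thesis
  proof (rule Bochner_Integration.integrable_bound)
    show "integrable M (\<lambda>t. norm c * (norm (\<mu> t) / d t ^ Suc k))"
      by (intro Bochner_Integration.integrable_mult_right int)
    show "(\<lambda>t. c * \<mu> t / (w t - of_real x) ^ Suc k) \<in> borel_measurable M"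
      using meas by measurable
    show "AE t in M. norm (c * \<mu> t / (w t - of_real x) ^ Suc k) \<le> norm (norm c * (norm (\<mu> t) / d t ^ Suc k))"
    proof (rule AE_I2)
      fix t assume t: "t \<in> space M"
      have "norm (\<mu> t) / norm (w t - of_real x) ^ Suc k \<le> norm (\<mu> t) / d t ^ Suc k"
        using d(1) [OF t] d(2) [OF t x] by (intro divide_left_mono power_mono mult_pos_pos zero_less_power) auto
      thus "norm (c * \<mu> t / (w t - of_real x) ^ Suc k) \<le> norm (norm c * (norm (\<mu> t) / d t ^ Suc k))"
        using d(1) [OF t]
        by (simp add: norm_mult norm_divide norm_power abs_mult mult_left_mono flip: times_divide_eq_right del: power_Suc)
    qed
  qed
qed

lemma has_vector_derivative_pole_integral:
  assumes pd: "pole_density m M w \<mu>" and k: "k < m" and x: "x \<in> {-1..1::real}"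
  shows "((\<lambda>x. \<integral>t. fact k * \<mu> t / (w t - of_real x) ^ Suc k \<partial>M) has_vector_derivative
           (\<integral>t. fact (Suc k) * \<mu> t / (w t - of_real x) ^ Suc (Suc k) \<partial>M)) (at x within {-1..1})"
proof -
  define S where "S = complex_of_real ` {-1..1}"
  obtain d where meas: "w \<in> borel_measurable M" "\<mu> \<in> borel_measurable M"
    and d: "\<And>t x. t \<in> space M \<Longrightarrow> 0 < d t" "\<And>t x. t \<in> space M \<Longrightarrow> x \<in> {-1..1} \<Longrightarrow> d t \<le> norm (w t - of_real x)"
    and int: "integrable M (\<lambda>t. norm (\<mu> t) / d t ^ Suc (Suc k))"
    using pd k unfolding pole_density_def by (metis Suc_leI)
  have "((\<lambda>z. \<integral>t. fact k * \<mu> t / (w t - z) ^ Suc k \<partial>M) has_field_derivative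
           (\<integral>t. fact (Suc k) * \<mu> t / (w t - of_real x) ^ Suc (Suc k) \<partial>M)) (at (of_real x) within S)"
  proof (rule has_field_derivative_integral_dominated)
    show "convex S" unfolding S_def by (intro convex_linear_image) (auto simp: linear_iff scaleR_conv_of_real)
    show "complex_of_real x \<in> S" using x by (simp add: S_def)
    show "integrable M (\<lambda>t. fact k * \<mu> t / (w t - z) ^ Suc k)" if "z \<in> S" for z
      using that pole_density_integrable [OF pd, of k] k unfolding S_def by force
    show "(\<lambda>t. fact (Suc k) * \<mu> t / (w t - of_real x) ^ Suc (Suc k)) \<in> borel_measurable M"
      using meas by measurable
    show "integrable M (\<lambda>t. fact (Suc k) * (norm (\<mu> t) / d t ^ Suc (Suc k)))"
      by (intro Bochner_Integration.integrable_mult_right int)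
    fix z t assume z: "z \<in> S" and t: "t \<in> space M"
    from z obtain y where y: "y \<in> {-1..1}" "z = of_real y" unfolding S_def by blast
    have nz: "w t - z \<noteq> 0" using d(1) [OF t] d(2) [OF t y(1)] y(2) by auto
    have "((\<lambda>z. fact k * \<mu> t * inverse ((w t - z) ^ Suc k)) has_field_derivative
            fact (Suc k) * \<mu> t / (w t - z) ^ Suc (Suc k)) (at z within S)"
      using nz by (auto intro!: derivative_eq_intros simp: field_simps simp del: of_nat_Suc power_Suc)
         (simp add: power_Suc)
    thus "((\<lambda>z. fact k * \<mu> t / (w t - z) ^ Suc k) has_field_derivative
            fact (Suc k) * \<mu> t / (w t - z) ^ Suc (Suc k)) (at z within S)"
      by (simp add: divide_inverse)
    have "norm (\<mu> t) / norm (w t - z) ^ Suc (Suc k) \<le> norm (\<mu> t) / d t ^ Suc (Suc k)"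
      unfolding y(2)
      using d(1) [OF t] d(2) [OF t y(1)] by (intro divide_left_mono power_mono mult_pos_pos zero_less_power) auto
    hence "fact (Suc k) * (norm (\<mu> t) / norm (w t - z) ^ Suc (Suc k)) \<le> fact (Suc k) * (norm (\<mu> t) / d t ^ Suc (Suc k))"
      by (rule mult_left_mono) simp
    thus "norm (fact (Suc k) * \<mu> t / (w t - z) ^ Suc (Suc k)) \<le> fact (Suc k) * (norm (\<mu> t) / d t ^ Suc (Suc k))"
      by (simp only: norm_mult norm_divide norm_power norm_fact times_divide_eq_right)
  qed
  hence *: "((\<lambda>z. \<integral>t. fact k * \<mu> t / (w t - z) ^ Suc k \<partial>M) has_field_derivative
           (\<integral>t. fact (Suc k) * \<mu> t / (w t - of_real x) ^ Suc (Suc k) \<partial>M)) (at (of_real x) within of_real ` {-1..1})"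
    by (simp add: S_def)
  have "(complex_of_real has_vector_derivative 1) (at x within {-1..1})"
    unfolding has_vector_derivative_def
    by (auto intro!: derivative_eq_intros simp: scaleR_conv_of_real)
  from field_vector_diff_chain_within [OF this *] show ?thesis
    by (simp add: o_def del: power_Suc fact_Suc)
qed

text \<open>Evaluation at the nodes, the Lagrange basis and, by domination, the \<open>m\<close>-th derivative all commute with
the integrals, so the error of the superposition is the superposition of the errors.\<close>

lemma interp_error_pole_integrals:
  assumes I: "finite I" and pd: "\<And>i. i \<in> I \<Longrightarrow> pole_density m (M i) (w i) (\<mu> i)"
    and f: "\<And>x. x \<in> {-1..1} \<Longrightarrow> f x = (\<Sum>i\<in>I. \<integral>t. \<mu> i t / (w i t - of_real x) \<partial>M i)"
    and p: "lobatto_interpolant n f p" and n: "n \<ge> 1" and x: "x \<in> {-1..1}"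
  shows "i \<in> I \<Longrightarrow> integrable (M i) (\<lambda>t. \<mu> i t * pole_error n m (w i t) (of_real x))"
    and "interp_error m f p x = (\<Sum>i\<in>I. \<integral>t. \<mu> i t * pole_error n m (w i t) (of_real x) \<partial>M i)"
proof -
  define D where "D k x = (\<Sum>i\<in>I. \<integral>t. fact k * \<mu> i t / (w i t - of_real x) ^ Suc k \<partial>M i)" for k and x :: real
  have deriv: "nth_deriv m f x = D m x"
  proof (rule nth_deriv_eqI [OF _ _ x])
    show "f y = D 0 y" if "y \<in> {-1..1}" for y using f [OF that] by (simp add: D_def)
    show "(D k has_vector_derivative D (Suc k) y) (at y within {-1..1})" if "k < m" "y \<in> {-1..1}" for k y
      unfolding D_def using pd that by (intro has_vector_derivative_sum has_vector_derivative_pole_integral) auto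
  qed
  define l where "l j = poly (derivs m (lagrange n j)) (of_real x)" for j
  define y where "y j = lobatto_point n j" for j
  have y: "y j \<in> {-1..1}" for j unfolding y_def by (rule lobatto_point_bounds)
  have rewrite: "fact m * \<mu> i t / (w i t - of_real x) ^ Suc m - (\<Sum>j\<le>n. l j * \<mu> i t / (w i t - of_real (y j)) ^ Suc 0)
      = \<mu> i t * pole_error n m (w i t) (of_real x)" if i: "i \<in> I" and t: "t \<in> space (M i)" for i t
  proof -
    have *: "w i t \<noteq> of_real z" if "z \<in> {-1..1}" for z
      using pd [OF i] t that unfolding pole_density_def by fastforce
    have "w i t \<notin> of_real ` {-1..1}" using * by blast
    from pole_interpolation_error [OF n this * [OF x], of m, symmetric]
    show ?thesis
      by (simp add: l_def y_def right_diff_distrib sum_distrib_left mult_ac del: power_Suc)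
  qed
  have int: "integrable (M i) (\<lambda>t. fact m * \<mu> i t / (w i t - of_real x) ^ Suc m)"
     "integrable (M i) (\<lambda>t. l j * \<mu> i t / (w i t - of_real (y j)) ^ Suc 0)" if "i \<in> I" for i j
    using pole_density_integrable [OF pd [OF that]] x y by blast+
  show int': "integrable (M i) (\<lambda>t. \<mu> i t * pole_error n m (w i t) (of_real x))" if "i \<in> I" for i
  proof -
    have "integrable (M i) (\<lambda>t. fact m * \<mu> i t / (w i t - of_real x) ^ Suc m - (\<Sum>j\<le>n. l j * \<mu> i t / (w i t - of_real (y j)) ^ Suc 0))"
      using int [OF that] by (intro Bochner_Integration.integrable_diff Bochner_Integration.integrable_sum)
    thus ?thesis by (rule Bochner_Integration.integrable_cong [THEN iffD1, rotated 2]) (use rewrite that in auto)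
  qed
  have "poly (derivs m p) (of_real x) = (\<Sum>j\<le>n. f (y j) * l j)"
    using p poly_derivs_lobatto [OF n, of p m "of_real x"] unfolding lobatto_interpolant_def y_def l_def by auto
  also have "\<dots> = (\<Sum>i\<in>I. \<Sum>j\<le>n. \<integral>t. l j * \<mu> i t / (w i t - of_real (y j)) ^ Suc 0 \<partial>M i)"
    unfolding f [OF y] sum_distrib_right
    by (subst sum.swap) (simp add: mult.commute [of _ "l _"] flip: times_divide_eq_right)
  finally have "interp_error m f p x = (\<Sum>i\<in>I. (\<integral>t. fact m * \<mu> i t / (w i t - of_real x) ^ Suc m \<partial>M i)
      - (\<Sum>j\<le>n. \<integral>t. l j * \<mu> i t / (w i t - of_real (y j)) ^ Suc 0 \<partial>M i))"
    unfolding interp_error_def deriv D_def by (simp only: sum_subtractf)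
  also have "\<dots> = (\<Sum>i\<in>I. \<integral>t. \<mu> i t * pole_error n m (w i t) (of_real x) \<partial>M i)"
  proof (rule sum.cong [OF refl])
    fix i assume i: "i \<in> I"
    have "(\<integral>t. fact m * \<mu> i t / (w i t - of_real x) ^ Suc m \<partial>M i)
      - (\<Sum>j\<le>n. \<integral>t. l j * \<mu> i t / (w i t - of_real (y j)) ^ Suc 0 \<partial>M i)
      = (\<integral>t. fact m * \<mu> i t / (w i t - of_real x) ^ Suc m - (\<Sum>j\<le>n. l j * \<mu> i t / (w i t - of_real (y j)) ^ Suc 0) \<partial>M i)"
      using int [OF i] by (subst Bochner_Integration.integral_diff) (auto simp: Bochner_Integration.integral_sum)
    also have "\<dots> = (\<integral>t. \<mu> i t * pole_error n m (w i t) (of_real x) \<partial>M i)"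
      by (rule Bochner_Integration.integral_cong) (use rewrite i in auto)
    finally show "(\<integral>t. fact m * \<mu> i t / (w i t - of_real x) ^ Suc m \<partial>M i)
      - (\<Sum>j\<le>n. \<integral>t. l j * \<mu> i t / (w i t - of_real (y j)) ^ Suc 0 \<partial>M i)
      = (\<integral>t. \<mu> i t * pole_error n m (w i t) (of_real x) \<partial>M i)" .
  qed
  finally show "interp_error m f p x = (\<Sum>i\<in>I. \<integral>t. \<mu> i t * pole_error n m (w i t) (of_real x) \<partial>M i)" .
qed

section \<open>Real powers as Stieltjes integrals\<close>

abbreviation lborel_on :: "real set \<Rightarrow> real measure" where
  "lborel_on A \<equiv> restrict_space lborel A"

lemma nonneg_has_integral_imp_lborel_on:
  fixes f :: "real \<Rightarrow> real"
  assumes f: "f \<in> borel_measurable borel" and A: "A \<in> sets borel"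
    and nonneg: "\<And>x. x \<in> A \<Longrightarrow> 0 \<le> f x" and I: "(f has_integral I) A"
  shows "integrable (lborel_on A) f" "integral\<^sup>L (lborel_on A) f = I"
proof -
  define h where "h x = indicator A x *\<^sub>R f x" for x
  have h: "h \<in> borel_measurable lborel" "\<And>x. 0 \<le> h x"
    using f A nonneg unfolding h_def by (auto simp: indicator_def)
  have "(\<lambda>x. if x \<in> A then f x else 0) = h" by (auto simp: h_def fun_eq_iff)
  hence "(h has_integral I) UNIV" using I has_integral_restrict_UNIV [of A f I] by simp
  hence nn: "integral\<^sup>N lborel h = ennreal I"
    using h by (intro nn_integral_has_integral_lborel) auto
  have "integrable lborel h"
    by (rule integrableI_nn_integral_finite [OF h(1) _ nn]) (simp add: h)
  moreover have "I \<ge> 0" using I nonneg by (rule has_integral_nonneg)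
  hence "integral\<^sup>L lborel h = I"
    using h nn by (subst integral_eq_nn_integral) auto
  ultimately show "integrable (lborel_on A) f" "integral\<^sup>L (lborel_on A) f = I"
    using A by (simp_all add: integrable_restrict_space integral_restrict_space h_def [abs_def])
qed

lemma integral_lborel_on:
  fixes f :: "real \<Rightarrow> real"
  assumes "A \<in> sets borel"
  shows "integral\<^sup>L (lborel_on A) f = (\<integral>u. indicator A u * f u \<partial>lborel)"
  using assms by (simp add: integral_restrict_space)

lemma lborel_on_powr:
  assumes "a > -1" "T > 0"
  shows "integrable (lborel_on {0<..<T}) (\<lambda>u. u powr a)"
    and "integral\<^sup>L (lborel_on {0<..<T}) (\<lambda>u. u powr a) = T powr (a + 1) / (a + 1)"
proof -
  have "((\<lambda>u. u powr a) has_integral T powr (a + 1) / (a + 1)) {0<..<T}"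
    using has_integral_powr_from_0 [of a T] assms by (simp add: has_integral_Icc_iff_Ioo)
  from nonneg_has_integral_imp_lborel_on [OF _ _ _ this]
  show "integrable (lborel_on {0<..<T}) (\<lambda>u. u powr a)"
    "integral\<^sup>L (lborel_on {0<..<T}) (\<lambda>u. u powr a) = T powr (a + 1) / (a + 1)"
    by auto
qed

lemma integrable_powr_to_inf:
  assumes "a < -1" "T > 0"
  shows "integrable (lborel_on {T..}) (\<lambda>u. u powr a)"
  by (rule nonneg_has_integral_imp_lborel_on [OF _ _ _ has_integral_powr_to_inf [OF assms]]) auto

lemma integrable_lborel_on_bound:
  fixes f :: "real \<Rightarrow> 'a::{banach, second_countable_topology}"
  assumes "integrable (lborel_on A) g" "f \<in> borel_measurable borel" "A \<in> sets borel"
    and "\<And>u. u \<in> A \<Longrightarrow> norm (f u) \<le> g u"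
  shows "integrable (lborel_on A) f"
proof (rule Bochner_Integration.integrable_bound [OF assms(1)])
  show "f \<in> borel_measurable (lborel_on A)"
    using assms(2) by (intro measurable_restrict_space1) simp
  show "AE u in lborel_on A. norm (f u) \<le> norm (g u)"
    using assms(4) by (intro AE_I2) (auto simp: space_restrict_space intro: order_trans [OF _ abs_ge_self])
qed

lemma integrable_stieltjes_kernel:
  assumes \<kappa>: "\<kappa> > -2" "T > 0" "v > 0"
  shows "integrable (lborel_on {0<..<T}) (\<lambda>u. u powr (\<kappa> + 1) / (u\<^sup>2 + v))"
proof (rule integrable_lborel_on_bound)
  show "integrable (lborel_on {0<..<T}) (\<lambda>u. u powr (\<kappa> + 1) / v)"
    using lborel_on_powr(1) [of "\<kappa> + 1" T] assms by auto
  show "norm (u powr (\<kappa> + 1) / (u\<^sup>2 + v)) \<le> u powr (\<kappa> + 1) / v" if "u \<in> {0<..<T}" for u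
    using assms that by (auto intro!: divide_left_mono mult_pos_pos add_pos_pos simp: abs_of_pos add_pos_pos)
qed auto

text \<open>The part of \<open>\<integral> u powr (\<kappa> + 1) / (u\<^sup>2 + v) du\<close> whose poles \<open>v = - u\<^sup>2\<close> stay to the left of \<open>- T\<^sup>2\<close>.\<close>

definition stieltjes_tail :: "real \<Rightarrow> real \<Rightarrow> complex \<Rightarrow> complex" where
  "stieltjes_tail \<kappa> T v = (\<integral>u. of_real (u powr (\<kappa> + 1)) / (of_real (u\<^sup>2) + v) \<partial>lborel_on {T..})"

lemma stieltjes_tail_regular:
  assumes \<kappa>: "\<kappa> < 0" and T: "T > 0" and v: "Re v > - T\<^sup>2"
  shows "stieltjes_tail \<kappa> T field_differentiable at v"
    and "integrable (lborel_on {T..}) (\<lambda>u. of_real (u powr (\<kappa> + 1)) / (of_real (u\<^sup>2) + v))"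
proof -
  define \<delta> where "\<delta> = min (T\<^sup>2) ((Re v + T\<^sup>2) / 2)"
  define c where "c = \<delta> / T\<^sup>2"
  have \<delta>: "\<delta> > 0" "\<delta> \<le> T\<^sup>2" "Re v > - T\<^sup>2 + \<delta>"
    using v T by (auto simp: \<delta>_def min_def field_simps)
  have c: "c > 0" "c \<le> 1" using \<delta> T by (auto simp: c_def)
  define S where "S = {z. Re z > - T\<^sup>2 + \<delta>}"
  have S: "convex S" "open S" "v \<in> S"
    using \<delta> unfolding S_def by (auto simp: convex_halfspace_Re_gt open_halfspace_Re_gt)
  have lower: "c * u\<^sup>2 \<le> norm (of_real (u\<^sup>2) + z)" if u: "u \<in> {T..}" and z: "z \<in> S" for u z
  proof -
    have "T\<^sup>2 \<le> u\<^sup>2" using u T by (intro power_mono) auto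
    hence "(1 - c) * T\<^sup>2 \<le> (1 - c) * u\<^sup>2" using c by (intro mult_left_mono) auto
    moreover have "c * T\<^sup>2 = \<delta>" using T by (simp add: c_def)
    ultimately have "c * u\<^sup>2 \<le> u\<^sup>2 + (- T\<^sup>2 + \<delta>)" by (simp add: algebra_simps)
    also have "\<dots> \<le> Re (of_real (u\<^sup>2) + z)" using z by (simp add: S_def)
    also have "\<dots> \<le> norm (of_real (u\<^sup>2) + z)" by (rule complex_Re_le_cmod)
    finally show ?thesis .
  qed
  have pos: "c * u\<^sup>2 > 0" if "u \<in> {T..}" for u using that T c by auto
  have int: "integrable (lborel_on {T..}) (\<lambda>u. of_real (u powr (\<kappa> + 1)) / (of_real (u\<^sup>2) + z))" if z: "z \<in> S" for z
  proof (rule integrable_lborel_on_bound)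
    show "integrable (lborel_on {T..}) (\<lambda>u. 1 / c * u powr (\<kappa> - 1))"
      using integrable_powr_to_inf [of "\<kappa> - 1" T] \<kappa> T by (intro Bochner_Integration.integrable_mult_right) auto
    fix u assume u: "u \<in> {T..}"
    have "norm (of_real (u powr (\<kappa> + 1)) / (of_real (u\<^sup>2) + z)) = u powr (\<kappa> + 1) / norm (of_real (u\<^sup>2) + z)"
      by (simp add: norm_divide)
    also have "\<dots> \<le> u powr (\<kappa> + 1) / (c * u\<^sup>2)"
      using lower [OF u z] pos [OF u] by (intro frac_le) auto
    also have "\<dots> = 1 / c * u powr (\<kappa> - 1)"
      using powr_add [of u "\<kappa> - 1" 2] u T by (simp add: powr_numeral add.commute)
    finally show "norm (of_real (u powr (\<kappa> + 1)) / (of_real (u\<^sup>2) + z)) \<le> 1 / c * u powr (\<kappa> - 1)" .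
  qed auto
  show "integrable (lborel_on {T..}) (\<lambda>u. of_real (u powr (\<kappa> + 1)) / (of_real (u\<^sup>2) + v))"
    by (rule int [OF S(3)])
  have "((\<lambda>z. \<integral>u. of_real (u powr (\<kappa> + 1)) / (of_real (u\<^sup>2) + z) \<partial>lborel_on {T..}) has_field_derivative
     (\<integral>u. - (of_real (u powr (\<kappa> + 1)) / (of_real (u\<^sup>2) + v)\<^sup>2) \<partial>lborel_on {T..})) (at v within S)"
  proof (rule has_field_derivative_integral_dominated [OF S(1) S(3)])
    show "integrable (lborel_on {T..}) (\<lambda>u. 1 / c\<^sup>2 * u powr (\<kappa> - 3))"
      using integrable_powr_to_inf [of "\<kappa> - 3" T] \<kappa> T by (intro Bochner_Integration.integrable_mult_right) auto
    show "(\<lambda>u. - (complex_of_real (u powr (\<kappa> + 1)) / (of_real (u\<^sup>2) + v)\<^sup>2)) \<in> borel_measurable (lborel_on {T..})"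
      by (intro measurable_restrict_space1) simp
    fix z u assume z: "z \<in> S" and "u \<in> space (lborel_on {T..})"
    hence u: "u \<in> {T..}" by (simp add: space_restrict_space)
    have nz: "of_real (u\<^sup>2) + z \<noteq> 0" using lower [OF u z] pos [OF u] by auto
    thus "((\<lambda>z. of_real (u powr (\<kappa> + 1)) / (of_real (u\<^sup>2) + z)) has_field_derivative
         - (of_real (u powr (\<kappa> + 1)) / (of_real (u\<^sup>2) + z)\<^sup>2)) (at z within S)"
      by (auto intro!: derivative_eq_intros simp: power2_eq_square)
    have "norm (- (of_real (u powr (\<kappa> + 1)) / (of_real (u\<^sup>2) + z)\<^sup>2)) = u powr (\<kappa> + 1) / norm (of_real (u\<^sup>2) + z) ^ 2"
      by (simp add: norm_divide norm_power)
    also have "\<dots> \<le> u powr (\<kappa> + 1) / (c * u\<^sup>2) ^ 2"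
      using lower [OF u z] pos [OF u] less_imp_le [OF pos [OF u]] by (intro frac_le power_mono zero_less_power) auto
    also have "\<dots> = 1 / c\<^sup>2 * u powr (\<kappa> - 3)"
      using powr_add [of u "\<kappa> - 3" 4] u T by (simp add: powr_numeral power_mult_distrib add.commute)
    finally show "norm (- (of_real (u powr (\<kappa> + 1)) / (of_real (u\<^sup>2) + z)\<^sup>2)) \<le> 1 / c\<^sup>2 * u powr (\<kappa> - 3)" .
  qed (use int in auto)
  thus "stieltjes_tail \<kappa> T field_differentiable at v"
    unfolding stieltjes_tail_def [abs_def] field_differentiable_def using at_within_open [OF S(3,2)] by auto
qed

text \<open>Substitute \<open>sqrt v * u\<close> for \<open>u\<close>.\<close>

lemma stieltjes_scaling:
  assumes "v > 0"
  shows "(\<integral>u. u powr (\<kappa> + 1) / (u\<^sup>2 + v) \<partial>lborel_on {0<..}) = v powr (\<kappa> / 2) * (\<integral>u. u powr (\<kappa> + 1) / (u\<^sup>2 + 1) \<partial>lborel_on {0<..})"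
proof -
  define r where "r = sqrt v"
  have r: "r > 0" "v = r\<^sup>2" using assms by (auto simp: r_def)
  have "(\<integral>u. u powr (\<kappa> + 1) / (u\<^sup>2 + v) \<partial>lborel_on {0<..})
      = (\<integral>u. indicator {0<..} u * (u powr (\<kappa> + 1) / (u\<^sup>2 + v)) \<partial>lborel)"
    by (rule integral_lborel_on) auto
  also have "\<dots> = r * (\<integral>u. indicator {0<..} (r * u) * ((r * u) powr (\<kappa> + 1) / ((r * u)\<^sup>2 + v)) \<partial>lborel)"
    using r by (subst lborel_integral_real_affine [of r _ 0]) auto
  also have "(\<lambda>u. indicator {0<..} (r * u) * ((r * u) powr (\<kappa> + 1) / ((r * u)\<^sup>2 + v)))
      = (\<lambda>u. r powr (\<kappa> - 1) * (indicator {0<..} u * (u powr (\<kappa> + 1) / (u\<^sup>2 + 1))))"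
  proof
    fix u :: real
    show "indicator {0<..} (r * u) * ((r * u) powr (\<kappa> + 1) / ((r * u)\<^sup>2 + v))
       = r powr (\<kappa> - 1) * (indicator {0<..} u * (u powr (\<kappa> + 1) / (u\<^sup>2 + 1)))"
    proof (cases "u > 0")
      case True
      have "(r * u)\<^sup>2 + v = r\<^sup>2 * (u\<^sup>2 + 1)" by (simp add: r power_mult_distrib algebra_simps)
      moreover have "(r * u) powr (\<kappa> + 1) = r powr (\<kappa> - 1) * r\<^sup>2 * u powr (\<kappa> + 1)"
        using r True by (simp add: powr_mult powr_add powr_diff power2_eq_square)
      ultimately show ?thesis using True r by (simp add: indicator_def)
    qed (use r in \<open>auto simp: indicator_def zero_less_mult_iff\<close>)
  qed
  also have "(\<integral>u. r powr (\<kappa> - 1) * (indicator {0<..} u * (u powr (\<kappa> + 1) / (u\<^sup>2 + 1))) \<partial>lborel)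
      = r powr (\<kappa> - 1) * (\<integral>u. u powr (\<kappa> + 1) / (u\<^sup>2 + 1) \<partial>lborel_on {0<..})"
    by (subst integral_lborel_on) (auto simp only: Bochner_Integration.integral_mult_right_zero sets_borel open_greaterThan borel_open)
  also have "r * (r powr (\<kappa> - 1) * (\<integral>u. u powr (\<kappa> + 1) / (u\<^sup>2 + 1) \<partial>lborel_on {0<..}))
      = r powr \<kappa> * (\<integral>u. u powr (\<kappa> + 1) / (u\<^sup>2 + 1) \<partial>lborel_on {0<..})"
    using r by (simp add: powr_diff)
  also have "r powr \<kappa> = v powr (\<kappa> / 2)"
    using assms by (simp add: r_def powr_half_sqrt [symmetric] powr_powr)
  finally show ?thesis .
qed

lemma stieltjes_split:
  assumes \<kappa>: "\<kappa> > -2" "\<kappa> < 0" and T: "T > 0" and v: "v > 0"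
  shows "integrable (lborel_on {0<..}) (\<lambda>u. u powr (\<kappa> + 1) / (u\<^sup>2 + v))" (is ?int)
    and "of_real (\<integral>u. u powr (\<kappa> + 1) / (u\<^sup>2 + v) \<partial>lborel_on {0<..})
       = of_real (\<integral>u. u powr (\<kappa> + 1) / (u\<^sup>2 + v) \<partial>lborel_on {0<..<T}) + stieltjes_tail \<kappa> T (of_real v)" (is ?eq)
proof -
  define f where "f u = u powr (\<kappa> + 1) / (u\<^sup>2 + v)" for u
  have eq: "of_real (u powr (\<kappa> + 1)) / (of_real (u\<^sup>2) + of_real v) = complex_of_real (f u)" for u
    unfolding f_def by simp
  have tail: "Re (complex_of_real v) > - T\<^sup>2" using v T by (simp add: less_trans [of _ 0])
  have i1: "integrable (lborel_on {0<..<T}) f"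
    using integrable_stieltjes_kernel [OF \<kappa>(1) T v] by (simp add: f_def [abs_def])
  have i2: "integrable (lborel_on {T..}) f"
    using stieltjes_tail_regular(2) [OF \<kappa>(2) T tail] unfolding eq complex_of_real_integrable_eq .
  define f1 f2 where "f1 u = indicator {0<..<T} u *\<^sub>R f u" and "f2 u = indicator {T..} u *\<^sub>R f u" for u
  have j: "integrable lborel f1" "integrable lborel f2"
    using i1 i2 by (simp_all add: integrable_restrict_space f1_def [abs_def] f2_def [abs_def])
  have split: "(\<lambda>u. indicator {0<..} u *\<^sub>R f u) = (\<lambda>u. f1 u + f2 u)"
    using T by (auto simp: fun_eq_iff f1_def f2_def indicator_def)
  have "integrable lborel (\<lambda>u. indicator {0<..} u *\<^sub>R f u)"
    unfolding split using j by simp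
  thus ?int by (simp add: integrable_restrict_space f_def [abs_def])
  have "integral\<^sup>L (lborel_on {0<..}) f = integral\<^sup>L (lborel_on {0<..<T}) f + integral\<^sup>L (lborel_on {T..}) f"
  proof -
    have "integral\<^sup>L (lborel_on {0<..}) f = (\<integral>u. f1 u + f2 u \<partial>lborel)"
      by (subst integral_restrict_space) (simp_all only: split, simp)
    also have "\<dots> = integral\<^sup>L lborel f1 + integral\<^sup>L lborel f2"
      using j by (rule Bochner_Integration.integral_add)
    also have "integral\<^sup>L lborel f1 = integral\<^sup>L (lborel_on {0<..<T}) f"
      by (subst integral_restrict_space) (simp_all add: f1_def [abs_def])
    also have "integral\<^sup>L lborel f2 = integral\<^sup>L (lborel_on {T..}) f"
      by (subst integral_restrict_space) (simp_all add: f2_def [abs_def])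
    finally show ?thesis .
  qed
  moreover have "stieltjes_tail \<kappa> T (of_real v) = of_real (integral\<^sup>L (lborel_on {T..}) f)"
    unfolding stieltjes_tail_def eq by (rule integral_complex_of_real)
  ultimately show ?eq unfolding f_def by simp
qed

text \<open>For \<open>-2 < \<kappa> < 0\<close> the integral over the whole half-line converges and scaling shows that it is a positive
multiple of \<open>v powr (\<kappa> / 2)\<close>; its tail is holomorphic.  From \<open>\<kappa>\<close> one passes to \<open>\<kappa> + 2\<close> by multiplying with \<open>v\<close> and
using \<open>v / (u\<^sup>2 + v) = 1 - u\<^sup>2 / (u\<^sup>2 + v)\<close>.  Every positive \<open>\<kappa>\<close> that is not an even integer is
reached in this way; for even \<open>\<kappa>\<close> the power is a polynomial and the starting value \<open>\<kappa> = 0\<close> would diverge.\<close>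

lemma powr_as_pole_integral:
  fixes \<kappa> T :: real
  assumes \<kappa>: "\<kappa> > 0" and odd: "\<nexists>k::int. even k \<and> \<kappa> = of_int k" and T: "T > 0"
  obtains C :: real and A where "A holomorphic_on {v. Re v > - T\<^sup>2}"
    "\<And>v. v \<ge> 0 \<Longrightarrow> of_real (v powr (\<kappa> / 2)) =
        of_real (C * (\<integral>u. u powr (\<kappa> + 1) / (u\<^sup>2 + v) \<partial>lborel_on {0<..<T})) + A (of_real v)"
proof -
  define y where "y \<kappa> v = (\<integral>u. u powr (\<kappa> + 1) / (u\<^sup>2 + v) \<partial>lborel_on {0<..<T})" for \<kappa> v :: real
  define P where "P \<kappa> \<longleftrightarrow> (\<exists>C A. A holomorphic_on {v. Re v > - T\<^sup>2} \<and>
      (\<forall>v. v > 0 \<or> (v = 0 \<and> \<kappa> > 0) \<longrightarrow> of_real (v powr (\<kappa> / 2)) = of_real (C * y \<kappa> v) + A (of_real v)))" for \<kappa>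
  \<comment> \<open>The number of steps from the representative of \<open>\<kappa>\<close> modulo 2 in \<open>(-2,0)\<close>.\<close>
  define j where "j = nat \<lceil>\<kappa> / 2\<rceil>"
  define \<kappa>0 where "\<kappa>0 = \<kappa> - 2 * real j"
  have j: "real j = of_int \<lceil>\<kappa> / 2\<rceil>" using \<kappa> by (simp add: j_def)
  have \<kappa>0: "\<kappa>0 > -2" "\<kappa>0 < 0"
  proof -
    show "\<kappa>0 > -2" unfolding \<kappa>0_def j by linarith
    have "\<kappa>0 \<le> 0" unfolding \<kappa>0_def j by linarith
    moreover have "\<kappa>0 \<noteq> 0"
    proof
      assume "\<kappa>0 = 0"
      hence "\<kappa> = of_int (2 * int j)" by (simp add: \<kappa>0_def)
      thus False using odd by (metis dvd_triv_left)
    qed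
    ultimately show "\<kappa>0 < 0" by simp
  qed
  have base: "P \<kappa>0"
  proof -
    define W where "W = (\<integral>u. u powr (\<kappa>0 + 1) / (u\<^sup>2 + 1) \<partial>lborel_on {0<..})"
    have "W \<ge> (\<integral>u. u powr (\<kappa>0 + 1) / 2 \<partial>lborel_on {0<..<1})"
    proof -
      have i1: "integrable lborel (\<lambda>u. indicator {0<..<1} u *\<^sub>R (u powr (\<kappa>0 + 1) / 2))"
        using lborel_on_powr(1) [of "\<kappa>0 + 1" 1] \<kappa>0 by (simp add: integrable_restrict_space)
      have i2: "integrable lborel (\<lambda>u. indicator {0<..} u *\<^sub>R (u powr (\<kappa>0 + 1) / (u\<^sup>2 + 1)))"
        using stieltjes_split(1) [OF \<kappa>0 T, of 1] by (simp add: integrable_restrict_space)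
      have "(\<integral>u. indicator {0<..<1} u *\<^sub>R (u powr (\<kappa>0 + 1) / 2) \<partial>lborel)
         \<le> (\<integral>u. indicator {0<..} u *\<^sub>R (u powr (\<kappa>0 + 1) / (u\<^sup>2 + 1)) \<partial>lborel)"
      proof (rule integral_mono [OF i1 i2])
        fix u :: real
        have "u\<^sup>2 \<le> 1" if "0 < u" "u < 1" using that by (simp add: abs_square_le_1)
        hence "u powr (\<kappa>0 + 1) / 2 \<le> u powr (\<kappa>0 + 1) / (u\<^sup>2 + 1)" if "0 < u" "u < 1"
          using that by (intro divide_left_mono) (auto intro: add_nonneg_pos)
        thus "indicator {0<..<1} u *\<^sub>R (u powr (\<kappa>0 + 1) / 2) \<le> indicator {0<..} u *\<^sub>R (u powr (\<kappa>0 + 1) / (u\<^sup>2 + 1))"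
          by (auto simp: indicator_def)
      qed
      thus ?thesis by (simp add: W_def integral_restrict_space)
    qed
    moreover have "(\<integral>u. u powr (\<kappa>0 + 1) / 2 \<partial>lborel_on {0<..<1}) > 0"
      using lborel_on_powr(2) [of "\<kappa>0 + 1" 1] \<kappa>0 by simp
    ultimately have W: "W > 0" by linarith
    have "stieltjes_tail \<kappa>0 T holomorphic_on {v. Re v > - T\<^sup>2}"
      unfolding holomorphic_on_def
      using stieltjes_tail_regular(1) [OF \<kappa>0(2) T] field_differentiable_at_within by blast
    hence "(\<lambda>v. of_real (1 / W) * stieltjes_tail \<kappa>0 T v) holomorphic_on {v. Re v > - T\<^sup>2}"
      by (intro holomorphic_intros)
    moreover have "of_real (v powr (\<kappa>0 / 2)) = of_real (1 / W * y \<kappa>0 v) + of_real (1 / W) * stieltjes_tail \<kappa>0 T (of_real v)"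
      if v: "v > 0" for v
    proof -
      have "complex_of_real (v powr (\<kappa>0 / 2)) = of_real (1 / W) * of_real (v powr (\<kappa>0 / 2) * W)" using W by simp
      also have "v powr (\<kappa>0 / 2) * W = (\<integral>u. u powr (\<kappa>0 + 1) / (u\<^sup>2 + v) \<partial>lborel_on {0<..})"
        using stieltjes_scaling [OF v, of \<kappa>0] by (simp add: W_def)
      also have "complex_of_real \<dots> = of_real (y \<kappa>0 v) + stieltjes_tail \<kappa>0 T (of_real v)"
        using stieltjes_split(2) [OF \<kappa>0 T v] by (simp add: y_def)
      finally show ?thesis by (simp add: algebra_simps add_divide_distrib)
    qed
    ultimately show ?thesis unfolding P_def using \<kappa>0(2)
      by (intro exI [of _ "1 / W"] exI [of _ "\<lambda>v. of_real (1 / W) * stieltjes_tail \<kappa>0 T v"] conjI)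
         (blast, metis less_asym)
  qed
  have step: "P (\<kappa> + 2)" if P: "P \<kappa>" and \<kappa>: "\<kappa> > -2" for \<kappa>
  proof -
    from P obtain C A where A: "A holomorphic_on {v. Re v > - T\<^sup>2}"
      and eq: "\<And>v. v > 0 \<Longrightarrow> of_real (v powr (\<kappa> / 2)) = of_real (C * y \<kappa> v) + A (of_real v)"
      unfolding P_def by blast
    define E where "E = T powr (\<kappa> + 2) / (\<kappa> + 2)"
    have E: "(\<integral>u. u powr (\<kappa> + 1) \<partial>lborel_on {0<..<T}) = E"
      using lborel_on_powr(2) [of "\<kappa> + 1" T] \<kappa> T by (simp add: E_def add.commute)
    have "(\<lambda>v. v * A v + of_real (C * E)) holomorphic_on {v. Re v > - T\<^sup>2}"
      using A by (intro holomorphic_intros)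
    moreover have "of_real (v powr ((\<kappa> + 2) / 2)) = of_real (- C * y (\<kappa> + 2) v) + (of_real v * A (of_real v) + of_real (C * E))"
      if v: "v > 0" for v
    proof -
      have "v * y \<kappa> v = (\<integral>u. v * (u powr (\<kappa> + 1) / (u\<^sup>2 + v)) \<partial>lborel_on {0<..<T})"
        by (simp only: y_def Bochner_Integration.integral_mult_right_zero)
      also have "\<dots> = (\<integral>u. u powr (\<kappa> + 1) - u powr (\<kappa> + 2 + 1) / (u\<^sup>2 + v) \<partial>lborel_on {0<..<T})"
      proof (rule Bochner_Integration.integral_cong [OF refl])
        fix u assume "u \<in> space (lborel_on {0<..<T})"
        hence u: "u > 0" by (simp add: space_restrict_space)
        have "u\<^sup>2 + v \<noteq> 0" using v by (simp add: add_nonneg_pos less_imp_neq [symmetric])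
        moreover have "u powr (\<kappa> + 2 + 1) = u\<^sup>2 * u powr (\<kappa> + 1)"
          using powr_add [of u "\<kappa> + 1" 2] u by (simp add: add_ac powr_numeral)
        ultimately show "v * (u powr (\<kappa> + 1) / (u\<^sup>2 + v)) = u powr (\<kappa> + 1) - u powr (\<kappa> + 2 + 1) / (u\<^sup>2 + v)"
          by (simp add: field_simps)
      qed
      also have "\<dots> = E - y (\<kappa> + 2) v"
        using integrable_stieltjes_kernel [of "\<kappa> + 2" T v] lborel_on_powr(1) [of "\<kappa> + 1" T] \<kappa> T v E
        by (subst Bochner_Integration.integral_diff) (auto simp: y_def)
      finally have rec: "v * y \<kappa> v = E - y (\<kappa> + 2) v" .
      have "complex_of_real (v powr ((\<kappa> + 2) / 2)) = of_real v * of_real (v powr (\<kappa> / 2))"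
        using v by (simp add: add_divide_distrib powr_add)
      also have "\<dots> = of_real (C * (v * y \<kappa> v)) + of_real v * A (of_real v)"
        unfolding eq [OF v] by (simp add: algebra_simps)
      finally show ?thesis unfolding rec by (simp add: algebra_simps)
    qed
    \<comment> \<open>At \<open>v = 0\<close> the kernel is the integrable power \<open>u powr (\<kappa> + 1)\<close> and the two terms cancel.\<close>
    moreover have "y (\<kappa> + 2) 0 = E"
      unfolding E [symmetric] y_def
    proof (rule Bochner_Integration.integral_cong [OF refl])
      fix u assume "u \<in> space (lborel_on {0<..<T})"
      hence u: "u > 0" by (simp add: space_restrict_space)
      have "u powr (\<kappa> + 2 + 1) = u powr (\<kappa> + 1) * u\<^sup>2"
        using powr_add [of u "\<kappa> + 1" 2] u by (simp add: add_ac powr_numeral)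
      thus "u powr (\<kappa> + 2 + 1) / (u\<^sup>2 + 0) = u powr (\<kappa> + 1)" using u by simp
    qed
    hence "of_real (0 powr ((\<kappa> + 2) / 2)) = of_real (- C * y (\<kappa> + 2) 0) + (of_real 0 * A (of_real 0) + of_real (C * E))"
      by simp
    ultimately show ?thesis unfolding P_def
      by (intro exI [of _ "- C"] exI [of _ "\<lambda>v. v * A v + of_real (C * E)"]) auto
  qed
  have "P (\<kappa>0 + 2 * real i)" for i
  proof (induction i)
    case (Suc i)
    show ?case using step [OF Suc.IH] \<kappa>0 by (simp add: algebra_simps)
  qed (use base in auto)
  from this [of j] have "P \<kappa>" by (simp add: \<kappa>0_def)
  then obtain C A where "A holomorphic_on {v. Re v > - T\<^sup>2}"
      "\<And>v. v > 0 \<or> (v = 0 \<and> \<kappa> > 0) \<Longrightarrow> of_real (v powr (\<kappa> / 2)) = of_real (C * y \<kappa> v) + A (of_real v)"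
    unfolding P_def by blast
  thus ?thesis using that [of A C] \<kappa> unfolding y_def by (metis less_eq_real_def)
qed

section \<open>Holomorphic functions near the interval\<close>

definition slab :: "real \<Rightarrow> complex set" where
  "slab \<eta> = {z. \<bar>Re z\<bar> < 1 + \<eta> \<and> \<bar>Im z\<bar> < \<eta>}"

lemma slab_eq_box: "slab \<eta> = box (Complex (- 1 - \<eta>) (- \<eta>)) (Complex (1 + \<eta>) \<eta>)"
  by (auto simp: slab_def in_box_complex_iff abs_less_iff)

lemma slab_open_convex: "open (slab \<eta>)" "convex (slab \<eta>)"
  unfolding slab_eq_box by (auto simp: open_box convex_box)

lemma analytic_on_slab:
  assumes "g analytic_on (complex_of_real ` {-1..1})"
  obtains \<eta> where "\<eta> > 0" "\<eta> \<le> 1" "g holomorphic_on slab \<eta>"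
proof -
  obtain V where V: "open V" "complex_of_real ` {-1..1} \<subseteq> V" "g holomorphic_on V"
    using assms unfolding analytic_on_holomorphic by blast
  have "compact (complex_of_real ` {-1..1})"
    by (intro compact_continuous_image continuous_intros) auto
  then obtain e where e: "e > 0" "(\<Union>x\<in>complex_of_real ` {-1..1}. ball x e) \<subseteq> V"
    using compact_subset_open_imp_ball_epsilon_subset V by metis
  define \<eta> where "\<eta> = min 1 (e / 2)"
  have "slab \<eta> \<subseteq> V"
  proof
    fix z assume z: "z \<in> slab \<eta>"
    define x where "x = max (-1) (min 1 (Re z))"
    have "norm (complex_of_real x - z) \<le> \<bar>Re (of_real x - z)\<bar> + \<bar>Im (of_real x - z)\<bar>" by (rule cmod_le)
    also have "\<dots> < \<eta> + \<eta>"
    proof (rule add_le_less_mono)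
      have "\<eta> > 0" "\<bar>Re z\<bar> < 1 + \<eta>" using z e(1) by (auto simp: slab_def \<eta>_def)
      hence "\<bar>x - Re z\<bar> \<le> \<eta>" unfolding x_def by linarith
      thus "\<bar>Re (of_real x - z)\<bar> \<le> \<eta>" by simp
      show "\<bar>Im (of_real x - z)\<bar> < \<eta>" using z by (simp add: slab_def)
    qed
    also have "\<dots> \<le> e" by (simp add: \<eta>_def)
    finally have "z \<in> ball (of_real x) e" by (simp add: dist_norm)
    moreover have "x \<in> {-1..1}" by (auto simp: x_def)
    ultimately show "z \<in> V" using e(2) by blast
  qed
  thus ?thesis using e(1) V(3) by (intro that [of \<eta>]) (auto simp: \<eta>_def intro: holomorphic_on_subset)
qed

lemma measurable_lborel_on_continuous:
  fixes f :: "real \<Rightarrow> complex"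
  assumes "continuous_on {0<..<T} f"
  shows "f \<in> borel_measurable (lborel_on {0<..<T})"
  using borel_measurable_continuous_on_restrict [OF assms]
  by (subst measurable_cong_sets [OF sets_restrict_space_cong [OF sets_lborel] refl])

lemma lborel_on_Ioo_integral:
  fixes f :: "real \<Rightarrow> complex"
  assumes "continuous_on {0..T} f"
  shows "integrable (lborel_on {0<..<T}) f" "integral\<^sup>L (lborel_on {0<..<T}) f = integral {0..T} f"
proof -
  have "set_integrable lborel {0..T} f" by (rule borel_integrable_atLeastAtMost' [OF assms])
  hence *: "set_integrable lborel {0<..<T} f" by (rule set_integrable_subset) auto
  thus "integrable (lborel_on {0<..<T}) f"
    by (simp add: set_integrable_def integrable_restrict_space)
  show "integral\<^sup>L (lborel_on {0<..<T}) f = integral {0..T} f"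
    using set_borel_integral_eq_integral(2) [OF *]
    by (simp add: set_lebesgue_integral_def integral_restrict_space integral_open_interval_real)
qed

text \<open>This is Cauchy's integral formula on a rectangle around \<open>[-1,1]\<close>, one family of poles for each side.\<close>

lemma holomorphic_as_pole_integrals:
  assumes h: "h holomorphic_on slab \<eta>" and \<eta>: "\<eta> > 0"
  obtains \<delta> B and w \<mu> :: "nat \<Rightarrow> real \<Rightarrow> complex" where "0 < \<delta>" "\<delta> \<le> 1" "B \<ge> 0"
    "\<And>i. w i \<in> borel_measurable (lborel_on {0<..<1})" "\<And>i. i < 4 \<Longrightarrow> \<mu> i \<in> borel_measurable (lborel_on {0<..<1})"
    "\<And>i t. i < 4 \<Longrightarrow> t \<in> {0<..<1} \<Longrightarrow> norm (\<mu> i t) \<le> B"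
    "\<And>i t x. i < 4 \<Longrightarrow> t \<in> {0<..<1} \<Longrightarrow> x \<in> {-1..1} \<Longrightarrow> \<delta> \<le> norm (w i t - of_real x)"
    "\<And>x. x \<in> {-1..1} \<Longrightarrow> h (of_real x) = (\<Sum>i<4. \<integral>t. \<mu> i t / (w i t - of_real x) \<partial>lborel_on {0<..<1})"
proof -
  \<comment> \<open>The corners \<open>a\<close>, \<open>b\<close>, \<open>c\<close>, \<open>d\<close> span a rectangle of half the width of the slab.\<close>
  define e where "e = \<eta> / 2"
  have e: "0 < e" "e < \<eta>" using \<eta> by (auto simp: e_def)
  define a where "a = Complex (- 1 - e) (- e)"
  define b where "b = Complex (1 + e) (- e)"
  define c where "c = Complex (1 + e) e"
  define d where "d = Complex (- 1 - e) e"
  define v where "v i = [a, b, c, d, a] ! i" for i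
  define w where "w i = linepath (v i) (v (Suc i))" for i
  define \<mu> where "\<mu> i t = h (w i t) * (v (Suc i) - v i) / (2 * pi * \<i>)" for i t
  have w: "w 0 = linepath a b" "w 1 = linepath b c" "w 2 = linepath c d" "w 3 = linepath d a"
    by (simp_all add: w_def v_def numeral_2_eq_2 numeral_3_eq_3)
  have rect: "rectpath a c = linepath a b +++ linepath b c +++ linepath c d +++ linepath d a"
    by (simp add: rectpath_def a_def b_def c_def d_def Let_def)
  have img: "path_image (rectpath a c) = cbox a c - box a c"
    using e by (intro path_image_rectpath_cbox_minus_box) (auto simp: a_def c_def)
  have sub: "path_image (rectpath a c) \<subseteq> slab \<eta>"
    using e unfolding img by (auto simp: slab_def in_cbox_complex_iff a_def c_def abs_le_iff)
  have w_img: "w i t \<in> path_image (rectpath a c)" if "i < 4" "t \<in> {0..1}" for i t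
  proof -
    have "path_image (rectpath a c) = path_image (w 0) \<union> (path_image (w 1) \<union> (path_image (w 2) \<union> path_image (w 3)))"
      unfolding rect w by (simp add: path_image_join)
    moreover have "w i t \<in> path_image (w i)" using that(2) by (simp add: path_image_def)
    moreover from that(1) consider "i = 0" | "i = 1" | "i = 2" | "i = 3" by linarith
    ultimately show ?thesis by cases blast+
  qed
  have far: "min e 1 \<le> norm (z - complex_of_real x)" if z: "z \<in> path_image (rectpath a c)" and x: "x \<in> {-1..1}" for z x
  proof -
    have "Re z = - 1 - e \<or> Re z = 1 + e \<or> Im z = - e \<or> Im z = e"
      using z e by (auto simp: path_image_rectpath a_def c_def)
    hence "e \<le> \<bar>Re (z - of_real x)\<bar> \<or> e \<le> \<bar>Im (z - of_real x)\<bar>"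
      using x e by (elim disjE) auto
    thus ?thesis using abs_Re_le_cmod [of "z - of_real x"] abs_Im_le_cmod [of "z - of_real x"] by linarith
  qed
  have h_cont: "continuous_on (path_image (rectpath a c)) h"
    using h sub by (meson holomorphic_on_imp_continuous_on holomorphic_on_subset)
  have wc: "continuous_on A (w i)" for A i unfolding w_def by (rule continuous_on_linepath)
  have hw: "continuous_on {0..1} (\<lambda>t. h (w i t))" if "i < 4" for i
    by (rule continuous_on_compose2 [OF h_cont wc]) (use w_img that in auto)
  have \<mu>c: "continuous_on {0..1} (\<mu> i)" if "i < 4" for i
    unfolding \<mu>_def using hw [OF that] by (intro continuous_intros) auto
  have "compact (path_image (rectpath a c))" by (intro compact_path_image) auto
  hence "\<exists>K. \<forall>i<4. \<forall>t\<in>{0..1}. norm (\<mu> i t) \<le> K"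
  proof -
    have "\<exists>K. \<forall>t\<in>{0..1}. norm (\<mu> i t) \<le> K" if "i < 4" for i
      using compact_imp_bounded [OF compact_continuous_image [OF \<mu>c [OF that] compact_Icc]]
      unfolding bounded_iff by auto
    then obtain K where K: "\<And>i t. i < 4 \<Longrightarrow> t \<in> {0..1} \<Longrightarrow> norm (\<mu> i t) \<le> K i" by metis
    show ?thesis
    proof (intro exI [of _ "\<Sum>i<4. \<bar>K i\<bar>"] allI impI ballI)
      fix i :: nat and t :: real assume i: "i < 4" and t: "t \<in> {0..1}"
      have "norm (\<mu> i t) \<le> \<bar>K i\<bar>" using K [OF i t] by linarith
      also have "\<dots> \<le> (\<Sum>i<4. \<bar>K i\<bar>)" using i by (intro member_le_sum) auto
      finally show "norm (\<mu> i t) \<le> (\<Sum>i<4. \<bar>K i\<bar>)" .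
    qed
  qed
  then obtain K where K: "\<And>i t. i < 4 \<Longrightarrow> t \<in> {0..1} \<Longrightarrow> norm (\<mu> i t) \<le> K" by blast
  show ?thesis
  proof (rule that [of "min e 1" "max K 0" w \<mu>])
    show "w i \<in> borel_measurable (lborel_on {0<..<1})" for i
      by (intro measurable_lborel_on_continuous wc)
    show "\<mu> i \<in> borel_measurable (lborel_on {0<..<1})" if "i < 4" for i
      by (intro measurable_lborel_on_continuous continuous_on_subset [OF \<mu>c [OF that]]) auto
    show "norm (\<mu> i t) \<le> max K 0" if "i < 4" "t \<in> {0<..<1}" for i t
      using K [of i t] that by auto
    show "min e 1 \<le> norm (w i t - of_real x)" if "i < 4" "t \<in> {0<..<1}" "x \<in> {-1..1}" for i t x
      using far [OF w_img that(3)] that by auto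
    fix x :: real assume x: "x \<in> {-1..1}"
    define F where "F z = h z / (z - of_real x)" for z
    have nz: "z - of_real x \<noteq> 0" if "z \<in> path_image (rectpath a c)" for z
      using far [OF that x] e by auto
    have xb: "of_real x \<in> box a c" using x e by (auto simp: in_box_complex_iff a_def c_def)
    have "(F has_contour_integral (2 * pi * \<i> * winding_number (rectpath a c) (of_real x) * h (of_real x))) (rectpath a c)"
      unfolding F_def
    proof (rule Cauchy_integral_formula_convex_simple [OF slab_open_convex(2) h])
      show "of_real x \<in> interior (slab \<eta>)"
        using x e unfolding interior_open [OF slab_open_convex(1)] by (auto simp: slab_def)
      show "path_image (rectpath a c) \<subseteq> slab \<eta> - {of_real x}"
        using sub nz by auto
    qed auto
    hence "contour_integral (rectpath a c) F = 2 * pi * \<i> * h (of_real x)"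
      using winding_number_rectpath [OF xb] contour_integral_unique by fastforce
    moreover have Fc: "continuous_on (path_image (rectpath a c)) F"
      unfolding F_def using nz by (intro continuous_intros h_cont) auto
    have "contour_integral (rectpath a c) F = (\<Sum>i<4. contour_integral (w i) F)"
    proof -
      have sub': "closed_segment (v i) (v (Suc i)) \<subseteq> path_image (rectpath a c)" if "i < 4" for i
        using w_img [OF that] unfolding w_def by (auto simp flip: path_image_linepath simp: path_image_def)
      have "F contour_integrable_on w i" if "i < 4" for i
        unfolding w_def by (intro contour_integrable_continuous_linepath continuous_on_subset [OF Fc sub'] that)
      from this [of 0] this [of 1] this [of 2] this [of 3]
      show ?thesis unfolding rect
        by (simp add: w [unfolded One_nat_def numeral_2_eq_2 numeral_3_eq_3] eval_nat_numeral contour_integrable_joinI)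
    qed
    moreover have "contour_integral (w i) F = 2 * pi * \<i> * (\<integral>t. \<mu> i t / (w i t - of_real x) \<partial>lborel_on {0<..<1})" if i: "i < 4" for i
    proof -
      have "contour_integral (w i) F = integral {0..1} (\<lambda>t. F (w i t) * (v (Suc i) - v i))"
        unfolding contour_integral_integral w_def by simp
      also have "(\<lambda>t. F (w i t) * (v (Suc i) - v i)) = (\<lambda>t. 2 * pi * \<i> * (\<mu> i t / (w i t - of_real x)))"
        by (auto simp: F_def \<mu>_def)
      also have "integral {0..1} \<dots> = (\<integral>t. 2 * pi * \<i> * (\<mu> i t / (w i t - of_real x)) \<partial>lborel_on {0<..<1})"
        using nz w_img [OF i] by (intro lborel_on_Ioo_integral(2) [symmetric] continuous_intros \<mu>c wc i) auto
      finally show ?thesis by (simp only: Bochner_Integration.integral_mult_right_zero)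
    qed
    ultimately have "2 * pi * \<i> * h (of_real x) = 2 * pi * \<i> * (\<Sum>i<4. \<integral>t. \<mu> i t / (w i t - of_real x) \<partial>lborel_on {0<..<1})"
      by (simp add: sum_distrib_left)
    thus "h (of_real x) = (\<Sum>i<4. \<integral>t. \<mu> i t / (w i t - of_real x) \<partial>lborel_on {0<..<1})" by simp
  qed (use e in auto)
qed

text \<open>The divided difference \<open>(g z - g w) / (z - w)\<close> has a removable singularity at \<open>z = w\<close>.  Writing it as
\<open>\<integral> g' (w + \<theta> (z - w)) d\<theta>\<close> over \<open>0 \<le> \<theta> \<le> 1\<close> gives a jointly continuous integrand in \<open>(u, \<theta>)\<close>, so the Leibniz
rule on a rectangle shows that the integral over \<open>u\<close> is holomorphic also on the curve \<open>r\<close>.\<close>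

lemma divided_difference_integral:
  fixes r \<rho> :: "real \<Rightarrow> complex"
  assumes g: "g holomorphic_on U" and U: "open U" "convex U"
    and r: "continuous_on {0..T} r" "\<And>u. u \<in> {0..T} \<Longrightarrow> r u \<in> U" and \<rho>: "continuous_on {0..T} \<rho>"
  obtains \<psi> where "\<psi> holomorphic_on U"
    "\<And>z. z \<in> U \<Longrightarrow> (\<And>u. u \<in> {0<..<T} \<Longrightarrow> r u \<noteq> z) \<Longrightarrow>
        \<psi> z = (\<integral>u. \<rho> u * ((g z - g (r u)) / (z - r u)) \<partial>lborel_on {0<..<T}) \<and>
        integrable (lborel_on {0<..<T}) (\<lambda>u. \<rho> u * ((g z - g (r u)) / (z - r u)))"
proof -
  define pt where "pt z p = r (fst p) + of_real (snd p) * (z - r (fst p))" for z and p :: "real \<times> real"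
  define F where "F z p = \<rho> (fst p) * deriv g (pt z p)" for z p
  define D where "D z p = \<rho> (fst p) * (of_real (snd p) * deriv (deriv g) (pt z p))" for z p
  define Q :: "(real \<times> real) set" where "Q = cbox (0, 0) (T, 1)"
  have Q: "fst p \<in> {0..T} \<and> snd p \<in> {0..1}" if "p \<in> Q" for p
    using that unfolding Q_def by (cases p) (auto simp: cbox_Pair_eq)
  have pt: "pt z p \<in> U" if "z \<in> U" "p \<in> Q" for z p
  proof -
    have "pt z p = (1 - snd p) *\<^sub>R r (fst p) + snd p *\<^sub>R z"
      by (simp add: pt_def scaleR_conv_of_real algebra_simps)
    thus ?thesis using Q [OF that(2)] r(2) that U(2) by (simp add: convexD_alt)
  qed
  have g1: "deriv g holomorphic_on U" and g2: "deriv (deriv g) holomorphic_on U"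
    using g U by (auto intro!: holomorphic_deriv)
  have c1: "continuous_on U (deriv g)" and c2: "continuous_on U (deriv (deriv g))"
    using g1 g2 by (auto intro: holomorphic_on_imp_continuous_on)
  have rc: "continuous_on (U \<times> Q) (\<lambda>x. r (fst (snd x)))" "continuous_on (U \<times> Q) (\<lambda>x. \<rho> (fst (snd x)))"
    by (rule continuous_on_compose2 [OF r(1)] continuous_on_compose2 [OF \<rho>], intro continuous_intros, use Q in force)+
  have ptc: "continuous_on (U \<times> Q) (\<lambda>x. pt (fst x) (snd x))"
    unfolding pt_def by (intro continuous_intros rc)
  have Dc: "continuous_on (U \<times> Q) (\<lambda>(z, p). D z p)"
    unfolding D_def case_prod_unfold
    by (intro continuous_intros rc continuous_on_compose2 [OF c2 ptc]) (use pt in auto)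
  have "continuous_on (U \<times> Q) (\<lambda>x. F (fst x) (snd x))"
    unfolding F_def by (intro continuous_intros rc continuous_on_compose2 [OF c1 ptc]) (use pt in auto)
  hence Fc: "continuous_on Q (F z)" if "z \<in> U" for z
    by (rule continuous_on_compose2 [of _ "\<lambda>x. F (fst x) (snd x)" Q "\<lambda>p. (z, p)", simplified])
       (use that in \<open>auto intro!: continuous_intros\<close>)
  define \<psi> where "\<psi> z = integral Q (F z)" for z
  have hol: "\<psi> holomorphic_on U"
    unfolding \<psi>_def Q_def
  proof (rule leibniz_rule_holomorphic [OF _ _ _ U(2)])
    fix z p assume z: "z \<in> U" and p: "p \<in> cbox (0, 0) (T, 1::real)"
    hence "(deriv g has_field_derivative deriv (deriv g) (pt z p)) (at (pt z p))"
      by (intro holomorphic_derivI [OF g1 U(1)] pt) (simp_all add: Q_def)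
    hence "((\<lambda>z. deriv g (pt z p)) has_field_derivative deriv (deriv g) (pt z p) * of_real (snd p)) (at z)"
      by (rule DERIV_chain2) (auto simp: pt_def intro!: derivative_eq_intros)
    hence "((\<lambda>z. F z p) has_field_derivative \<rho> (fst p) * (deriv (deriv g) (pt z p) * of_real (snd p))) (at z)"
      unfolding F_def by (rule DERIV_cmult)
    thus "((\<lambda>z. F z p) has_field_derivative D z p) (at z within U)"
      by (simp add: D_def mult_ac has_field_derivative_at_within)
  next
    show "F z integrable_on cbox (0, 0) (T, 1)" if "z \<in> U" for z
      using Fc [OF that] unfolding Q_def by (rule integrable_continuous)
    show "continuous_on (U \<times> cbox (0, 0) (T, 1)) (\<lambda>(z, p). D z p)"
      using Dc unfolding Q_def .
  qed
  show ?thesis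
  proof (rule that [OF hol])
    fix z assume z: "z \<in> U" and nz: "\<And>u. u \<in> {0<..<T} \<Longrightarrow> r u \<noteq> z"
    define q where "q u = \<rho> u * integral {0..1} (\<lambda>\<theta>. deriv g (pt z (u, \<theta>)))" for u
    have \<psi>: "\<psi> z = integral {0..T} q"
      unfolding \<psi>_def Q_def using Fc [OF z] unfolding Q_def
      by (subst integral_prod_continuous) (simp_all add: F_def q_def [abs_def])
    have "continuous_on ({0..T} \<times> cbox 0 1) (\<lambda>(u, \<theta>). deriv g (pt z (u, \<theta>)))"
    proof -
      have "continuous_on Q (\<lambda>p. pt z p)"
        by (rule continuous_on_compose2 [OF ptc, of Q "\<lambda>p. (z, p)", simplified])
           (use z in \<open>auto intro!: continuous_intros\<close>)
      hence "continuous_on Q (\<lambda>p. deriv g (pt z p))"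
        by (rule continuous_on_compose2 [OF c1]) (use pt z in auto)
      thus ?thesis by (simp add: Q_def cbox_Pair_eq case_prod_unfold)
    qed
    hence "continuous_on {0..T} (\<lambda>u. integral (cbox 0 1) (\<lambda>\<theta>. deriv g (pt z (u, \<theta>))))"
      by (rule integral_continuous_on_param)
    hence qc: "continuous_on {0..T} q" unfolding q_def by (intro continuous_intros \<rho>) simp
    have eq: "q u = \<rho> u * ((g z - g (r u)) / (z - r u))" if u: "u \<in> {0<..<T}" for u
    proof -
      have ru: "r u \<in> U" using u r(2) by auto
      have "((\<lambda>\<theta>. (z - r u) * deriv g (pt z (u, \<theta>))) has_integral (g (pt z (u, 1)) - g (pt z (u, 0)))) {0..1}"
      proof (rule fundamental_theorem_of_calculus)
        fix \<theta> :: real assume \<theta>: "\<theta> \<in> {0..1}"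
        have "(u, \<theta>) \<in> Q" using \<theta> u by (auto simp: Q_def cbox_Pair_eq)
        hence "(g has_field_derivative deriv g (pt z (u, \<theta>))) (at (pt z (u, \<theta>)))"
          by (intro holomorphic_derivI [OF g U(1)] pt z)
        moreover have "((\<lambda>\<theta>. pt z (u, \<theta>)) has_vector_derivative (z - r u)) (at \<theta> within {0..1})"
          unfolding pt_def has_vector_derivative_def
          by (auto intro!: derivative_eq_intros simp: scaleR_conv_of_real)
        ultimately show "((\<lambda>\<theta>. g (pt z (u, \<theta>))) has_vector_derivative (z - r u) * deriv g (pt z (u, \<theta>))) (at \<theta> within {0..1})"
          using field_vector_diff_chain_within [of "\<lambda>\<theta>. pt z (u, \<theta>)" "z - r u" \<theta> "{0..1}" g "deriv g (pt z (u, \<theta>))"]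
          by (auto simp: o_def has_field_derivative_at_within)
      qed simp
      from integral_unique [OF this]
      have "(z - r u) * integral {0..1} (\<lambda>\<theta>. deriv g (pt z (u, \<theta>))) = g (pt z (u, 1)) - g (pt z (u, 0))"
        by (simp only: integral_mult_right)
      also have "\<dots> = g z - g (r u)" by (simp add: pt_def)
      finally have "(z - r u) * integral {0..1} (\<lambda>\<theta>. deriv g (pt z (u, \<theta>))) = g z - g (r u)" .
      hence "integral {0..1} (\<lambda>\<theta>. deriv g (pt z (u, \<theta>))) = (g z - g (r u)) / (z - r u)"
        using nz [OF u] by (simp add: eq_divide_eq mult.commute)
      thus ?thesis by (simp add: q_def)
    qed
    have "integrable (lborel_on {0<..<T}) q" "\<psi> z = integral\<^sup>L (lborel_on {0<..<T}) q"
      using lborel_on_Ioo_integral [OF qc] \<psi> by auto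
    moreover have "integral\<^sup>L (lborel_on {0<..<T}) q = (\<integral>u. \<rho> u * ((g z - g (r u)) / (z - r u)) \<partial>lborel_on {0<..<T})"
      by (rule Bochner_Integration.integral_cong [OF refl]) (simp add: space_restrict_space eq)
    moreover have "integrable (lborel_on {0<..<T}) q \<longleftrightarrow> integrable (lborel_on {0<..<T}) (\<lambda>u. \<rho> u * ((g z - g (r u)) / (z - r u)))"
      by (rule Bochner_Integration.integrable_cong [OF refl]) (simp add: space_restrict_space eq)
    ultimately show "\<psi> z = (\<integral>u. \<rho> u * ((g z - g (r u)) / (z - r u)) \<partial>lborel_on {0<..<T}) \<and>
        integrable (lborel_on {0<..<T}) (\<lambda>u. \<rho> u * ((g z - g (r u)) / (z - r u)))" by simp
  qed
qed

text \<open>Since \<open>g(x) / (w - x) = g(w) / (w - x) - (g(x) - g(w)) / (x - w)\<close>, multiplication by \<open>g\<close> only multiplies the density by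
the values of \<open>g\<close> at the poles, up to an integral of divided differences.\<close>

lemma multiply_pole_integrals:
  fixes r \<rho> :: "nat \<Rightarrow> real \<Rightarrow> complex"
  assumes g: "g holomorphic_on slab \<eta>" and a: "a holomorphic_on slab \<eta>'" and \<eta>: "\<eta>' \<le> \<eta>" "0 < \<eta>'"
    and J: "finite J"
    and r: "\<And>j. j \<in> J \<Longrightarrow> continuous_on {0..T} (r j)" "\<And>j u. j \<in> J \<Longrightarrow> u \<in> {0..T} \<Longrightarrow> r j u \<in> slab \<eta>"
      "\<And>j u. j \<in> J \<Longrightarrow> u \<in> {0<..<T} \<Longrightarrow> r j u \<notin> complex_of_real ` {-1..1}"
    and \<rho>: "\<And>j. j \<in> J \<Longrightarrow> continuous_on {0..T} (\<rho> j)"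
    and int: "\<And>j x. j \<in> J \<Longrightarrow> x \<in> {-1..1} \<Longrightarrow> integrable (lborel_on {0<..<T}) (\<lambda>u. \<rho> j u / (r j u - of_real x))"
    and s: "\<And>x. x \<in> {-1..1} \<Longrightarrow> s x = (\<Sum>j\<in>J. \<integral>u. \<rho> j u / (r j u - of_real x) \<partial>lborel_on {0<..<T}) + a (of_real x)"
  obtains h where "h holomorphic_on slab \<eta>'"
    "\<And>x. x \<in> {-1..1} \<Longrightarrow> s x * g (of_real x) =
       (\<Sum>j\<in>J. \<integral>u. \<rho> j u * g (r j u) / (r j u - of_real x) \<partial>lborel_on {0<..<T}) + h (of_real x)"
proof -
  have sub: "slab \<eta>' \<subseteq> slab \<eta>" using \<eta> by (auto simp: slab_def)
  have "\<forall>j\<in>J. \<exists>\<psi>. \<psi> holomorphic_on slab \<eta> \<and> (\<forall>z. z \<in> slab \<eta> \<longrightarrow> (\<forall>u\<in>{0<..<T}. r j u \<noteq> z) \<longrightarrow>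
        \<psi> z = (\<integral>u. \<rho> j u * ((g z - g (r j u)) / (z - r j u)) \<partial>lborel_on {0<..<T}) \<and>
        integrable (lborel_on {0<..<T}) (\<lambda>u. \<rho> j u * ((g z - g (r j u)) / (z - r j u))))"
  proof
    fix j assume j: "j \<in> J"
    from divided_difference_integral [OF g slab_open_convex r(1) [OF j] r(2) [OF j] \<rho> [OF j]]
    obtain \<psi> where "\<psi> holomorphic_on slab \<eta>"
      "\<And>z. z \<in> slab \<eta> \<Longrightarrow> (\<And>u. u \<in> {0<..<T} \<Longrightarrow> r j u \<noteq> z) \<Longrightarrow>
        \<psi> z = (\<integral>u. \<rho> j u * ((g z - g (r j u)) / (z - r j u)) \<partial>lborel_on {0<..<T}) \<and>
        integrable (lborel_on {0<..<T}) (\<lambda>u. \<rho> j u * ((g z - g (r j u)) / (z - r j u)))" by blast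
    thus "\<exists>\<psi>. \<psi> holomorphic_on slab \<eta> \<and> (\<forall>z. z \<in> slab \<eta> \<longrightarrow> (\<forall>u\<in>{0<..<T}. r j u \<noteq> z) \<longrightarrow>
        \<psi> z = (\<integral>u. \<rho> j u * ((g z - g (r j u)) / (z - r j u)) \<partial>lborel_on {0<..<T}) \<and>
        integrable (lborel_on {0<..<T}) (\<lambda>u. \<rho> j u * ((g z - g (r j u)) / (z - r j u))))" by blast
  qed
  from bchoice [OF this] obtain \<psi> where \<psi>: "\<And>j. j \<in> J \<Longrightarrow> \<psi> j holomorphic_on slab \<eta>"
    "\<And>j z. j \<in> J \<Longrightarrow> z \<in> slab \<eta> \<Longrightarrow> (\<And>u. u \<in> {0<..<T} \<Longrightarrow> r j u \<noteq> z) \<Longrightarrow>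
        \<psi> j z = (\<integral>u. \<rho> j u * ((g z - g (r j u)) / (z - r j u)) \<partial>lborel_on {0<..<T}) \<and>
        integrable (lborel_on {0<..<T}) (\<lambda>u. \<rho> j u * ((g z - g (r j u)) / (z - r j u)))"
    by blast
  show ?thesis
  proof (rule that)
    show "(\<lambda>z. a z * g z - (\<Sum>j\<in>J. \<psi> j z)) holomorphic_on slab \<eta>'"
      using a g \<psi>(1) sub by (intro holomorphic_intros) (auto intro: holomorphic_on_subset)
    fix x :: real assume x: "x \<in> {-1..1}"
    define z where "z = complex_of_real x"
    have z: "z \<in> slab \<eta>" using x \<eta> by (auto simp: slab_def z_def)
    have rz: "r j u \<noteq> z" if "j \<in> J" "u \<in> {0<..<T}" for j u
      using r(3) [OF that] x by (auto simp: z_def)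
    have part: "(\<integral>u. \<rho> j u / (r j u - z) \<partial>lborel_on {0<..<T}) * g z
        = (\<integral>u. \<rho> j u * g (r j u) / (r j u - z) \<partial>lborel_on {0<..<T}) - \<psi> j z" if j: "j \<in> J" for j
    proof -
      have \<psi>j: "\<psi> j z = (\<integral>u. \<rho> j u * ((g z - g (r j u)) / (z - r j u)) \<partial>lborel_on {0<..<T})"
        "integrable (lborel_on {0<..<T}) (\<lambda>u. \<rho> j u * ((g z - g (r j u)) / (z - r j u)))"
        using \<psi>(2) [OF j z rz [OF j]] by auto
      have i: "integrable (lborel_on {0<..<T}) (\<lambda>u. \<rho> j u / (r j u - z) * g z)"
        using int [OF j x] unfolding z_def by (intro Bochner_Integration.integrable_mult_left)
      have "(\<integral>u. \<rho> j u / (r j u - z) \<partial>lborel_on {0<..<T}) * g z + \<psi> j z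
          = (\<integral>u. \<rho> j u / (r j u - z) * g z + \<rho> j u * ((g z - g (r j u)) / (z - r j u)) \<partial>lborel_on {0<..<T})"
        unfolding \<psi>j(1) using i \<psi>j(2)
        by (subst Bochner_Integration.integral_add) (simp_all only: Bochner_Integration.integral_mult_left_zero)
      also have "\<dots> = (\<integral>u. \<rho> j u * g (r j u) / (r j u - z) \<partial>lborel_on {0<..<T})"
      proof (rule Bochner_Integration.integral_cong [OF refl])
        fix u assume "u \<in> space (lborel_on {0<..<T})"
        hence "r j u \<noteq> z" using rz [OF j] by (simp add: space_restrict_space)
        thus "\<rho> j u / (r j u - z) * g z + \<rho> j u * ((g z - g (r j u)) / (z - r j u)) = \<rho> j u * g (r j u) / (r j u - z)"
          by (simp add: divide_simps) (simp add: algebra_simps)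
      qed
      finally show ?thesis by (simp add: algebra_simps)
    qed
    show "s x * g (of_real x) = (\<Sum>j\<in>J. \<integral>u. \<rho> j u * g (r j u) / (r j u - of_real x) \<partial>lborel_on {0<..<T})
        + (a (of_real x) * g (of_real x) - (\<Sum>j\<in>J. \<psi> j (of_real x)))"
      unfolding s [OF x] z_def [symmetric]
      by (simp add: distrib_right sum_distrib_right part sum_subtractf)
  qed
qed

section \<open>Error rates for poles on rays ending at the singularity\<close>

lemma integral_powr_exp:
  assumes \<beta>: "\<beta> > -1" and c: "c > 0"
  shows "integrable (lborel_on {0<..<T}) (\<lambda>u. u powr \<beta> * exp (- c * u))"
    and "(\<integral>u. u powr \<beta> * exp (- c * u) \<partial>lborel_on {0<..<T}) \<le> Gamma (\<beta> + 1) * c powr (- (\<beta> + 1))"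
proof -
  define G where "G t = indicator {0..} t * (t powr \<beta> / exp t)" for t :: real
  have HI: "((\<lambda>t. t powr \<beta> / exp t) has_integral Gamma (\<beta> + 1)) {0..}"
    using Gamma_integral_real [of "\<beta> + 1"] \<beta> by simp
  have int: "integrable (lborel_on {0..}) (\<lambda>t. t powr \<beta> / exp t)" "(\<integral>t. t powr \<beta> / exp t \<partial>lborel_on {0..}) = Gamma (\<beta> + 1)"
    using nonneg_has_integral_imp_lborel_on [OF _ _ _ HI] by auto
  hence G: "integrable lborel G" "integral\<^sup>L lborel G = Gamma (\<beta> + 1)"
    by (simp_all add: integrable_restrict_space integral_lborel_on G_def [abs_def])
  define H where "H u = indicator {0..} u * (u powr \<beta> * exp (- c * u))" for u
  have GH: "G (c * u) = c powr \<beta> * H u" for u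
    using c by (auto simp: G_def H_def indicator_def powr_mult exp_minus zero_le_mult_iff divide_inverse)
  have "integrable lborel (\<lambda>u. c powr \<beta> * H u)"
    using lborel_integrable_real_affine [OF G(1), of c 0] c by (simp add: GH)
  hence Hi: "integrable lborel H" using c by simp
  have "Gamma (\<beta> + 1) = c * (c powr \<beta> * integral\<^sup>L lborel H)"
    using lborel_integral_real_affine [of c G 0] c by (simp add: GH G(2))
  hence HG: "integral\<^sup>L lborel H = Gamma (\<beta> + 1) * c powr (- (\<beta> + 1))"
  proof -
    have "c powr (- (\<beta> + 1)) = inverse (c powr \<beta> * c)"
      using c by (simp only: powr_minus) (simp add: powr_add)
    moreover have "c powr \<beta> \<noteq> 0" using c by simp
    ultimately show ?thesis using c \<open>Gamma (\<beta> + 1) = c * (c powr \<beta> * integral\<^sup>L lborel H)\<close>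
      by (simp add: field_simps)
  qed
  define K where "K u = indicator {0<..<T} u *\<^sub>R (u powr \<beta> * exp (- c * u))" for u
  have KH: "norm (K u) \<le> H u" "K u \<le> H u" for u by (auto simp: K_def H_def indicator_def)
  have K: "integrable lborel K"
  proof (rule Bochner_Integration.integrable_bound [OF Hi])
    show "AE u in lborel. norm (K u) \<le> norm (H u)"
    proof (rule AE_I2)
      fix u show "norm (K u) \<le> norm (H u)" using KH(1) [of u] by (simp only: real_norm_def)
    qed
  qed (simp add: K_def [abs_def])
  thus "integrable (lborel_on {0<..<T}) (\<lambda>u. u powr \<beta> * exp (- c * u))"
    by (simp add: integrable_restrict_space K_def [abs_def])
  have "integral\<^sup>L lborel K \<le> integral\<^sup>L lborel H" by (rule integral_mono [OF K Hi KH(2)])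
  thus "(\<integral>u. u powr \<beta> * exp (- c * u) \<partial>lborel_on {0<..<T}) \<le> Gamma (\<beta> + 1) * c powr (- (\<beta> + 1))"
    by (simp add: integral_restrict_space K_def [abs_def] HG)
qed

text \<open>Terms with coefficient 0 may carry a non-integrable power; such terms occur when the nodal polynomial
vanishes at the evaluation point.\<close>

lemma integral_le_sum_powr_exp:
  assumes \<phi>: "integrable (lborel_on {0<..<T}) \<phi>" and c: "c > 0"
    and a: "\<And>k. k \<in> F \<Longrightarrow> a k \<ge> 0" "\<And>k. k \<in> F \<Longrightarrow> a k = 0 \<or> b k > -1"
    and le: "\<And>u. u \<in> {0<..<T} \<Longrightarrow> \<phi> u \<le> (\<Sum>k\<in>F. a k * (u powr b k * exp (- c * u)))"
  shows "integral\<^sup>L (lborel_on {0<..<T}) \<phi> \<le> (\<Sum>k\<in>F. a k * (Gamma (b k + 1) * c powr (- (b k + 1))))"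
proof -
  have i: "integrable (lborel_on {0<..<T}) (\<lambda>u. a k * (u powr b k * exp (- c * u)))" if "k \<in> F" for k
    using a(2) [OF that] integral_powr_exp(1) [OF _ c] by auto
  have "integral\<^sup>L (lborel_on {0<..<T}) \<phi> \<le> (\<integral>u. (\<Sum>k\<in>F. a k * (u powr b k * exp (- c * u))) \<partial>lborel_on {0<..<T})"
    using i by (intro integral_mono \<phi> Bochner_Integration.integrable_sum le) (auto simp: space_restrict_space)
  also have "\<dots> = (\<Sum>k\<in>F. \<integral>u. a k * (u powr b k * exp (- c * u)) \<partial>lborel_on {0<..<T})"
    using i by (rule Bochner_Integration.integral_sum)
  also have "\<dots> \<le> (\<Sum>k\<in>F. a k * (Gamma (b k + 1) * c powr (- (b k + 1))))"
  proof (rule sum_mono)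
    fix k assume k: "k \<in> F"
    have "(\<integral>u. a k * (u powr b k * exp (- c * u)) \<partial>lborel_on {0<..<T})
        = a k * (\<integral>u. u powr b k * exp (- c * u) \<partial>lborel_on {0<..<T})"
      by (rule Bochner_Integration.integral_mult_right_zero)
    also have "\<dots> \<le> a k * (Gamma (b k + 1) * c powr (- (b k + 1)))"
      using a(2) [OF k] integral_powr_exp(2) [OF _ c] a(1) [OF k] by (auto intro: mult_left_mono)
    finally show "(\<integral>u. a k * (u powr b k * exp (- c * u)) \<partial>lborel_on {0<..<T}) \<le> a k * (Gamma (b k + 1) * c powr (- (b k + 1)))" .
  qed
  finally show ?thesis .
qed

lemma norm_pole_error_le:
  "norm (pole_error n m w x) \<le> (\<Sum>k\<le>m. fact m * norm (poly (derivs k (nodal n)) x) / norm (w - x) ^ (Suc m - k)) / norm (poly (nodal n) w)"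
proof -
  have "norm (\<Sum>k\<le>m. fact m / fact k * poly (derivs k (nodal n)) x / (w - x) ^ (Suc m - k))
      \<le> (\<Sum>k\<le>m. fact m * norm (poly (derivs k (nodal n)) x) / norm (w - x) ^ (Suc m - k))"
  proof (rule sum_norm_le)
    fix k
    have "fact m * norm (poly (derivs k (nodal n)) x) / fact k \<le> fact m * norm (poly (derivs k (nodal n)) x) / 1"
      by (intro divide_left_mono) auto
    from divide_right_mono [OF this, of "norm (w - x) ^ (Suc m - k)"]
    show "norm (fact m / fact k * poly (derivs k (nodal n)) x / (w - x) ^ (Suc m - k))
        \<le> fact m * norm (poly (derivs k (nodal n)) x) / norm (w - x) ^ (Suc m - k)"
      by (simp add: norm_mult norm_divide norm_power)
  qed
  thus ?thesis unfolding pole_error_def norm_divide by (rule divide_right_mono) simp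
qed

lemma norm_pole_error_away:
  assumes \<delta>: "0 < \<delta>" "\<delta> \<le> 1" "\<delta> \<le> norm (w - x)"
  shows "norm (pole_error n m w x) \<le> fact m / \<delta> ^ Suc m * (\<Sum>k\<le>m. norm (poly (derivs k (nodal n)) x)) / norm (poly (nodal n) w)"
proof -
  have "(\<Sum>k\<le>m. fact m * norm (poly (derivs k (nodal n)) x) / norm (w - x) ^ (Suc m - k))
     \<le> (\<Sum>k\<le>m. fact m / \<delta> ^ Suc m * norm (poly (derivs k (nodal n)) x))"
  proof (rule sum_mono)
    fix k
    have "\<delta> ^ Suc m \<le> \<delta> ^ (Suc m - k)" using \<delta> by (intro power_decreasing) auto
    also have "\<dots> \<le> norm (w - x) ^ (Suc m - k)" using \<delta> by (intro power_mono) auto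
    finally have "fact m * norm (poly (derivs k (nodal n)) x) / norm (w - x) ^ (Suc m - k)
       \<le> fact m * norm (poly (derivs k (nodal n)) x) / \<delta> ^ Suc m"
      using \<delta> by (intro frac_le) auto
    thus "fact m * norm (poly (derivs k (nodal n)) x) / norm (w - x) ^ (Suc m - k)
       \<le> fact m / \<delta> ^ Suc m * norm (poly (derivs k (nodal n)) x)" by simp
  qed
  also have "\<dots> = fact m / \<delta> ^ Suc m * (\<Sum>k\<le>m. norm (poly (derivs k (nodal n)) x))" by (simp only: sum_distrib_left)
  finally show ?thesis
    by (rule order_trans [OF norm_pole_error_le divide_right_mono]) simp
qed

text \<open>The common form of the two singular cases: \<open>f\<close> is, up to a function holomorphic near \<open>[-1,1]\<close>, a
superposition of poles on finitely many rays \<open>r j u\<close>, \<open>0 < u < T\<close>, that end at \<open>\<xi>\<close>.  The exponent \<open>e\<close> is the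
order of contact in the parameter: the distance from \<open>r j u\<close> to \<open>\<xi>\<close> is of order \<open>u ^ e\<close>, with \<open>e = 1\<close> for
interior \<open>\<xi>\<close> and \<open>e = 2\<close> for \<open>\<xi> = \<plusminus>1\<close>.  The density is \<open>O(u powr (e * \<sigma> + e - 1))\<close>, and \<open>ratio_bound\<close> and
\<open>nodal_ratio_bound\<close> contain all that is needed about the size of the nodal polynomial on the rays.\<close>

locale pole_rays =
  fixes \<xi> \<sigma> T \<eta> B D :: real and e :: nat and J :: "nat set" and r \<mu> :: "nat \<Rightarrow> real \<Rightarrow> complex"
    and h :: "complex \<Rightarrow> complex" and f :: "real \<Rightarrow> complex"
  assumes J: "finite J" and \<sigma>: "\<sigma> > 0" and e: "e \<ge> 1" and \<eta>: "\<eta> > 0" and B: "B \<ge> 0" and D: "D \<ge> 0"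
    and r_cont: "\<And>j. j \<in> J \<Longrightarrow> continuous_on {0<..<T} (r j)"
    and \<mu>_cont: "\<And>j. j \<in> J \<Longrightarrow> continuous_on {0<..<T} (\<mu> j)"
    and r_dist: "\<And>j u x. j \<in> J \<Longrightarrow> u \<in> {0<..<T} \<Longrightarrow> x \<in> {-1..1} \<Longrightarrow> u ^ e \<le> norm (r j u - of_real x)"
    and r_away: "\<And>j u x. j \<in> J \<Longrightarrow> u \<in> {0<..<T} \<Longrightarrow> x \<in> {-1..1} \<Longrightarrow> \<bar>x - \<xi>\<bar> \<le> norm (r j u - of_real x)"
    and \<mu>_bound: "\<And>j u. j \<in> J \<Longrightarrow> u \<in> {0<..<T} \<Longrightarrow> norm (\<mu> j u) \<le> B * u powr (e * \<sigma> + e - 1)"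
    and ratio_bound: "\<And>j u n. j \<in> J \<Longrightarrow> u \<in> {0<..<T} \<Longrightarrow> n \<ge> 1 \<Longrightarrow>
        norm (\<mu> j u) / norm (poly (nodal n) (r j u)) \<le> D / real n * (u powr (e * \<sigma> - 1) * exp (- (real n / 4) * u))"
    and nodal_ratio_bound: "\<And>j u n. j \<in> J \<Longrightarrow> u \<in> {0<..<T} \<Longrightarrow> n \<ge> 1 \<Longrightarrow>
        norm (\<mu> j u) * norm (poly (nodal n) (of_real \<xi>)) / norm (poly (nodal n) (r j u)) \<le> D * (u powr (e * \<sigma>) * exp (- (real n / 4) * u))"
    and nodal_zero: "\<And>n. e = 1 \<or> poly (nodal n) (of_real \<xi>) = 0"
    and h: "h holomorphic_on slab \<eta>"
    and f: "\<And>x. x \<in> {-1..1} \<Longrightarrow> f x = (\<Sum>j\<in>J. \<integral>u. \<mu> j u / (r j u - of_real x) \<partial>lborel_on {0<..<T}) + h (of_real x)"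
begin

lemma pole_density_rays:
  assumes j: "j \<in> J" and m: "real m < \<sigma>"
  shows "pole_density m (lborel_on {0<..<T}) (r j) (\<mu> j)"
  unfolding pole_density_def
proof (intro conjI exI [of _ "\<lambda>u. u ^ e"] ballI allI impI)
  show "r j \<in> borel_measurable (lborel_on {0<..<T})" "\<mu> j \<in> borel_measurable (lborel_on {0<..<T})"
    using r_cont [OF j] \<mu>_cont [OF j] by (auto intro: measurable_lborel_on_continuous)
  show "0 < u ^ e" if "u \<in> space (lborel_on {0<..<T})" for u using that by (simp add: space_restrict_space)
  show "u ^ e \<le> norm (r j u - of_real x)" if "u \<in> space (lborel_on {0<..<T})" "x \<in> {-1..1}" for u x
    using r_dist [OF j] that by (simp add: space_restrict_space)
  fix k assume k: "k \<le> m"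
  show "integrable (lborel_on {0<..<T}) (\<lambda>u. norm (\<mu> j u) / (u ^ e) ^ Suc k)"
  proof (cases "T > 0")
    case True
    define b where "b = e * (\<sigma> - k) - 1"
    have b: "b > -1" using e k m by (simp add: b_def)
    show ?thesis
    proof (rule Bochner_Integration.integrable_bound)
      show "integrable (lborel_on {0<..<T}) (\<lambda>u. B * u powr b)"
        using lborel_on_powr(1) [OF b True] by (rule Bochner_Integration.integrable_mult_right)
      have "\<mu> j \<in> borel_measurable (lborel_on {0<..<T})"
        using \<mu>_cont [OF j] by (rule measurable_lborel_on_continuous)
      moreover have "(\<lambda>u. (u ^ e) ^ Suc k) \<in> borel_measurable (lborel_on {0<..<T})"
        by (intro measurable_restrict_space1) simp
      ultimately show "(\<lambda>u. norm (\<mu> j u) / (u ^ e) ^ Suc k) \<in> borel_measurable (lborel_on {0<..<T})"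
        by (intro borel_measurable_divide) auto
      show "AE u in lborel_on {0<..<T}. norm (norm (\<mu> j u) / (u ^ e) ^ Suc k) \<le> norm (B * u powr b)"
      proof (rule AE_I2)
        fix u assume "u \<in> space (lborel_on {0<..<T})"
        hence u: "u \<in> {0<..<T}" by (simp add: space_restrict_space)
        have "(u ^ e) ^ Suc k = u powr (e * Suc k)"
          using u powr_realpow [of u "e * Suc k"] by (simp only: power_mult of_nat_mult greaterThanLessThan_iff)
        hence "norm (\<mu> j u) / (u ^ e) ^ Suc k \<le> B * u powr (e * \<sigma> + e - 1) / u powr (e * Suc k)"
          using \<mu>_bound [OF j u] by (simp add: divide_right_mono)
        also have "\<dots> = B * u powr b"
        proof -
          have "e * \<sigma> + e - 1 - e * Suc k = b" by (simp add: b_def algebra_simps)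
          thus ?thesis by (simp only: powr_diff [symmetric] times_divide_eq_right [symmetric])
        qed
        finally show "norm (norm (\<mu> j u) / (u ^ e) ^ Suc k) \<le> norm (B * u powr b)"
          using u B by simp
      qed
    qed
  next
    case False
    hence "{0<..<T} = {}" by auto
    have "integrable (lborel_on {0<..<T}) (\<lambda>u. norm (\<mu> j u) / (u ^ e) ^ Suc k)
        \<longleftrightarrow> integrable (lborel_on {0<..<T}) (\<lambda>_. 0::real)"
      by (rule Bochner_Integration.integrable_cong [OF refl])
         (use \<open>{0<..<T} = {}\<close> in \<open>simp add: space_restrict_space\<close>)
    thus ?thesis by simp
  qed
qed

text \<open>The four families of poles on the rectangle contribute an exponentially small amount, because the
nodal polynomial is exponentially large there; only the rays matter.\<close>

lemma interp_error_bound: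
  assumes m: "real m < \<sigma>" and x: "x \<in> {-1..1}"
  shows "\<exists>C \<delta>. C \<ge> 0 \<and> \<delta> > 0 \<and> (\<forall>n p. n \<ge> 1 \<longrightarrow> lobatto_interpolant n f p \<longrightarrow>
     (\<forall>j\<in>J. integrable (lborel_on {0<..<T}) (\<lambda>u. norm (\<mu> j u) * norm (pole_error n m (r j u) (of_real x)))) \<and>
     norm (interp_error m f p x) \<le> (\<Sum>j\<in>J. \<integral>u. norm (\<mu> j u) * norm (pole_error n m (r j u) (of_real x)) \<partial>lborel_on {0<..<T})
        + C * (\<Sum>k\<le>m. norm (poly (derivs k (nodal n)) (of_real x))) * exp (- \<delta> * real n))"
proof (rule holomorphic_as_pole_integrals [OF h \<eta>])
  fix \<delta> B' and w \<nu> :: "nat \<Rightarrow> real \<Rightarrow> complex"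
  assume \<delta>: "0 < \<delta>" "\<delta> \<le> 1" and B': "B' \<ge> 0"
    and meas: "\<And>i. w i \<in> borel_measurable (lborel_on {0<..<1})" "\<And>i. i < 4 \<Longrightarrow> \<nu> i \<in> borel_measurable (lborel_on {0<..<1})"
    and \<nu>: "\<And>i t. i < 4 \<Longrightarrow> t \<in> {0<..<1} \<Longrightarrow> norm (\<nu> i t) \<le> B'"
    and w: "\<And>i t x. i < 4 \<Longrightarrow> t \<in> {0<..<1} \<Longrightarrow> x \<in> {-1..1} \<Longrightarrow> \<delta> \<le> norm (w i t - of_real x)"
    and heq: "\<And>x. x \<in> {-1..1} \<Longrightarrow> h (of_real x) = (\<Sum>i<4. \<integral>t. \<nu> i t / (w i t - of_real x) \<partial>lborel_on {0<..<1})"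
  have const: "integrable (lborel_on {0<..<1}) (\<lambda>_. c::real)" "(\<integral>_. c \<partial>lborel_on {0<..<1}) = c" for c
    by (simp add: integrable_restrict_space) (subst integral_lborel_on, simp_all)
  have pd: "pole_density m (lborel_on {0<..<1}) (w i) (\<nu> i)" if i: "i < 4" for i
    unfolding pole_density_def
  proof (intro conjI exI [of _ "\<lambda>_. \<delta>"] ballI allI impI)
    show "integrable (lborel_on {0<..<1}) (\<lambda>t. norm (\<nu> i t) / \<delta> ^ Suc k)" for k
    proof (rule Bochner_Integration.integrable_bound [OF const(1) [of "B' / \<delta> ^ Suc k"]])
      show "(\<lambda>t. norm (\<nu> i t) / \<delta> ^ Suc k) \<in> borel_measurable (lborel_on {0<..<1})" using meas(2) [OF i] by simp
      show "AE t in lborel_on {0<..<1}. norm (norm (\<nu> i t) / \<delta> ^ Suc k) \<le> norm (B' / \<delta> ^ Suc k)"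
        using \<nu> [OF i] \<delta> B' by (intro AE_I2) (auto simp: space_restrict_space abs_mult intro!: divide_right_mono)
    qed
  qed (use meas i w \<delta> in \<open>auto simp: space_restrict_space\<close>)
  define I where "I = {..<4::nat} <+> J"
  define M where "M i = (case i of Inl (_::nat) \<Rightarrow> lborel_on {0<..<1} | Inr (_::nat) \<Rightarrow> lborel_on {0<..<T})" for i
  define W where "W = case_sum w r"
  define N where "N = case_sum \<nu> \<mu>"
  have split: "(\<Sum>i\<in>I. F i) = (\<Sum>i<4. F (Inl i)) + (\<Sum>j\<in>J. F (Inr j))" for F :: "_ \<Rightarrow> complex"
    unfolding I_def using J by (subst sum.Plus) auto
  have I: "finite I" "\<And>i. i \<in> I \<Longrightarrow> pole_density m (M i) (W i) (N i)"
    using J pd pole_density_rays [OF _ m] by (auto simp: I_def M_def W_def N_def)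
  have fI: "f y = (\<Sum>i\<in>I. \<integral>t. N i t / (W i t - of_real y) \<partial>M i)" if "y \<in> {-1..1}" for y
    unfolding split f [OF that] heq [OF that] by (simp add: M_def W_def N_def)
  define C where "C = 4 * (B' * (fact m / \<delta> ^ Suc m * (16 / \<delta>\<^sup>2)))"
  define L where "L n = (\<Sum>k\<le>m. norm (poly (derivs k (nodal n)) (complex_of_real x)))" for n
  have L: "L n \<ge> 0" for n unfolding L_def by (intro sum_nonneg) auto
  show ?thesis
  proof (intro exI conjI allI impI)
    show "C \<ge> 0" using B' \<delta> by (simp add: C_def)
    show "\<delta> / 8 > 0" using \<delta> by simp
    fix n p assume n: "n \<ge> 1" and p: "lobatto_interpolant n f p"
    have err1: "integrable (M i) (\<lambda>t. N i t * pole_error n m (W i t) (of_real x))" if "i \<in> I" for i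
      by (rule interp_error_pole_integrals(1) [OF I(1) I(2) fI p n x that])
    have err2: "interp_error m f p x = (\<Sum>i\<in>I. \<integral>t. N i t * pole_error n m (W i t) (of_real x) \<partial>M i)"
      by (rule interp_error_pole_integrals(2) [OF I(1) I(2) fI p n x])
    show int: "\<forall>j\<in>J. integrable (lborel_on {0<..<T}) (\<lambda>u. norm (\<mu> j u) * norm (pole_error n m (r j u) (of_real x)))"
    proof
      fix j assume "j \<in> J"
      hence "Inr j \<in> I" by (auto simp: I_def)
      from integrable_norm [OF err1 [OF this]]
      show "integrable (lborel_on {0<..<T}) (\<lambda>u. norm (\<mu> j u) * norm (pole_error n m (r j u) (of_real x)))"
        by (simp add: M_def W_def N_def norm_mult)
    qed
    define E where "E i = (\<integral>t. N i t * pole_error n m (W i t) (of_real x) \<partial>M i)" for i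
    have "norm (E (Inl i)) \<le> C / 4 * L n * exp (- (\<delta> / 8) * real n)" if i: "i < 4" for i
    proof -
      have "Inl i \<in> I" using i by (auto simp: I_def)
      from integrable_norm [OF err1 [OF this]]
      have int': "integrable (lborel_on {0<..<1}) (\<lambda>t. norm (\<nu> i t * pole_error n m (w i t) (of_real x)))"
        by (simp add: M_def W_def N_def)
      have "norm (E (Inl i)) \<le> (\<integral>t. norm (\<nu> i t * pole_error n m (w i t) (of_real x)) \<partial>lborel_on {0<..<1})"
        unfolding E_def by (simp add: M_def W_def N_def)
      also have "\<dots> \<le> (\<integral>_. C / 4 * L n * exp (- (\<delta> / 8) * real n) \<partial>lborel_on {0<..<1})"
      proof (rule integral_mono [OF int' const(1)])
        fix t assume "t \<in> space (lborel_on {0<..<1})"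
        hence t: "t \<in> {0<..<1}" by (simp add: space_restrict_space)
        define y where "y = real n * (\<delta> / 4)"
        have y: "y \<ge> \<delta> / 4" using n \<delta> by (simp add: y_def)
        have "\<delta>\<^sup>2 / 16 * exp (y / 2) = \<delta> * (\<delta> / 4 / 4 * exp (y / 2))" by (simp add: power2_eq_square)
        also have "\<dots> \<le> \<delta> * (y / 4 * exp (y / 2))"
          using y \<delta> by (intro mult_left_mono mult_right_mono) auto
        also have "\<dots> \<le> \<delta> * sinh y" using y \<delta> by (intro mult_left_mono sinh_lower_bound) auto
        also have "\<dots> \<le> norm (poly (nodal n) (w i t))"
          unfolding y_def by (rule nodal_lower_bound_far [OF \<delta> w [OF i t]])
        finally have low: "\<delta>\<^sup>2 / 16 * exp (y / 2) \<le> norm (poly (nodal n) (w i t))" .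
        have "norm (pole_error n m (w i t) (of_real x)) \<le> fact m / \<delta> ^ Suc m * L n / norm (poly (nodal n) (w i t))"
          unfolding L_def by (rule norm_pole_error_away [OF \<delta> w [OF i t x]])
        also have "\<dots> \<le> fact m / \<delta> ^ Suc m * L n / (\<delta>\<^sup>2 / 16 * exp (y / 2))"
          using low \<delta> L by (intro frac_le) auto
        also have "\<dots> = fact m / \<delta> ^ Suc m * (16 / \<delta>\<^sup>2) * L n * exp (- (\<delta> / 8) * real n)"
          by (simp add: y_def exp_minus field_simps)
        finally have "norm (\<nu> i t) * norm (pole_error n m (w i t) (of_real x))
            \<le> B' * (fact m / \<delta> ^ Suc m * (16 / \<delta>\<^sup>2) * L n * exp (- (\<delta> / 8) * real n))"
          using \<nu> [OF i t] B' by (intro mult_mono) auto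
        thus "norm (\<nu> i t * pole_error n m (w i t) (of_real x)) \<le> C / 4 * L n * exp (- (\<delta> / 8) * real n)"
          by (simp add: norm_mult C_def mult_ac)
      qed
      also have "\<dots> = C / 4 * L n * exp (- (\<delta> / 8) * real n)" by (rule const(2))
      finally show ?thesis .
    qed
    hence contour: "norm (\<Sum>i<4. E (Inl i)) \<le> (\<Sum>i<4::nat. C / 4 * L n * exp (- (\<delta> / 8) * real n))"
      by (intro sum_norm_le) auto
    have rays: "norm (\<Sum>j\<in>J. E (Inr j)) \<le> (\<Sum>j\<in>J. \<integral>u. norm (\<mu> j u) * norm (pole_error n m (r j u) (of_real x)) \<partial>lborel_on {0<..<T})"
    proof (rule sum_norm_le)
      fix j
      have "norm (E (Inr j)) \<le> (\<integral>u. norm (\<mu> j u * pole_error n m (r j u) (of_real x)) \<partial>lborel_on {0<..<T})"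
        unfolding E_def by (simp add: M_def W_def N_def)
      thus "norm (E (Inr j)) \<le> (\<integral>u. norm (\<mu> j u) * norm (pole_error n m (r j u) (of_real x)) \<partial>lborel_on {0<..<T})"
        by (simp only: norm_mult)
    qed
    have "interp_error m f p x = (\<Sum>i<4. E (Inl i)) + (\<Sum>j\<in>J. E (Inr j))"
      unfolding err2 split E_def ..
    hence "norm (interp_error m f p x) \<le> norm (\<Sum>i<4. E (Inl i)) + norm (\<Sum>j\<in>J. E (Inr j))"
      by (simp only: norm_triangle_ineq)
    with contour rays show "norm (interp_error m f p x) \<le> (\<Sum>j\<in>J. \<integral>u. norm (\<mu> j u) * norm (pole_error n m (r j u) (of_real x)) \<partial>lborel_on {0<..<T})
        + C * (\<Sum>k\<le>m. norm (poly (derivs k (nodal n)) (of_real x))) * exp (- (\<delta> / 8) * real n)"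
      unfolding L_def [symmetric] by simp
  qed
qed

end

lemma bigo_powr_plus_exp:
  fixes F :: "nat \<Rightarrow> real"
  assumes F: "\<And>n. n \<ge> 1 \<Longrightarrow> F n \<le> A * real n powr b + C * real n powr a * exp (- \<delta> * real n)"
    and nonneg: "\<And>n. F n \<ge> 0" and \<delta>: "\<delta> > 0"
  shows "F \<in> O(\<lambda>n. real n powr b)"
proof -
  have "(\<lambda>n. real n powr a * exp (- \<delta> * real n)) \<in> O(\<lambda>n. real n powr b)"
    using \<delta> by real_asymp
  hence "(\<lambda>n. A * real n powr b + C * (real n powr a * exp (- \<delta> * real n))) \<in> O(\<lambda>n. real n powr b)"
    by (intro sum_in_bigo landau_o.big.mult_in_1) (auto intro: sum_in_bigo)
  moreover have "F \<in> O(\<lambda>n. A * real n powr b + C * (real n powr a * exp (- \<delta> * real n)))"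
    by (rule landau_o.big_mono, rule eventually_mono [OF eventually_ge_at_top [of 1]])
       (use F nonneg in \<open>fastforce simp: mult.assoc intro: order_trans [OF _ abs_ge_self]\<close>)
  ultimately show ?thesis by (rule landau_o.big_trans [rotated])
qed

context pole_rays
begin

text \<open>The kernel \<open>1 / (r j u - x)\<close> and its derivatives are bounded, so the ratio bound alone gives
\<open>(1 / n) * \<integral> u powr (e * \<sigma> - 1) * exp (- n * u / 4) du = O(n powr (- 1 - e * \<sigma>))\<close>, multiplied by the derivatives of the nodal polynomial at \<open>x\<close>.\<close>

lemma away_estimate:
  assumes m: "real m < \<sigma>" and x: "x \<in> {-1..1}" "x \<noteq> \<xi>"
    and C1: "\<And>n. n \<ge> 1 \<Longrightarrow> (\<Sum>k\<le>m. norm (poly (derivs k (nodal n)) (of_real x))) \<le> C1 * real n powr l"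
    and p: "\<And>n. n \<ge> 1 \<Longrightarrow> lobatto_interpolant n f (p n)"
  shows "(\<lambda>n. norm (interp_error m f (p n) x)) \<in> O(\<lambda>n. real n powr (l - 1 - e * \<sigma>))"
proof -
  define S where "S n = (\<Sum>k\<le>m. norm (poly (derivs k (nodal n)) (complex_of_real x)))" for n
  have S: "S n \<ge> 0" for n unfolding S_def by (intro sum_nonneg) auto
  define c where "c = min \<bar>x - \<xi>\<bar> 1"
  have c: "0 < c" "c \<le> 1" "c \<le> \<bar>x - \<xi>\<bar>" using x(2) by (auto simp: c_def)
  define P where "P = fact m / c ^ Suc m"
  have P: "P \<ge> 0" using c by (simp add: P_def)
  have e\<sigma>: "e * \<sigma> > 0" using e \<sigma> by simp
  obtain C d where C: "C \<ge> 0" and d: "d > 0" and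
    err: "\<And>n p. n \<ge> 1 \<Longrightarrow> lobatto_interpolant n f p \<Longrightarrow>
     (\<forall>j\<in>J. integrable (lborel_on {0<..<T}) (\<lambda>u. norm (\<mu> j u) * norm (pole_error n m (r j u) (of_real x)))) \<and>
     norm (interp_error m f p x) \<le> (\<Sum>j\<in>J. \<integral>u. norm (\<mu> j u) * norm (pole_error n m (r j u) (of_real x)) \<partial>lborel_on {0<..<T})
        + C * (\<Sum>k\<le>m. norm (poly (derivs k (nodal n)) (of_real x))) * exp (- d * real n)"
    using interp_error_bound [OF m x(1)] by blast
  define G where "G = P * D * Gamma (e * \<sigma>) * 4 powr (e * \<sigma>)"
  have G: "G \<ge> 0" using P D e\<sigma> by (simp add: G_def Gamma_real_nonneg)
  show ?thesis
  proof (rule bigo_powr_plus_exp [OF _ _ d])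
    fix n :: nat assume n: "n \<ge> 1"
    have ray: "(\<integral>u. norm (\<mu> j u) * norm (pole_error n m (r j u) (of_real x)) \<partial>lborel_on {0<..<T})
        \<le> G * C1 * real n powr (l - 1 - e * \<sigma>)" if j: "j \<in> J" for j
    proof -
      have "(\<integral>u. norm (\<mu> j u) * norm (pole_error n m (r j u) (of_real x)) \<partial>lborel_on {0<..<T})
        \<le> (\<Sum>k\<in>{0::nat}. P * S n * (D / real n) * (Gamma (e * \<sigma> - 1 + 1) * (real n / 4) powr (- (e * \<sigma> - 1 + 1))))"
      proof (rule integral_le_sum_powr_exp)
        show "integrable (lborel_on {0<..<T}) (\<lambda>u. norm (\<mu> j u) * norm (pole_error n m (r j u) (of_real x)))"
          using err [OF n p [OF n]] j by blast
        show "real n / 4 > 0" using n by simp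
        fix u assume u: "u \<in> {0<..<T}"
        have "norm (\<mu> j u) * norm (pole_error n m (r j u) (of_real x)) \<le> norm (\<mu> j u) * (P * S n / norm (poly (nodal n) (r j u)))"
          unfolding P_def S_def using r_away [OF j u x(1)] c by (intro mult_left_mono norm_pole_error_away) auto
        also have "\<dots> = P * S n * (norm (\<mu> j u) / norm (poly (nodal n) (r j u)))" by simp
        also have "\<dots> \<le> P * S n * (D / real n * (u powr (e * \<sigma> - 1) * exp (- (real n / 4) * u)))"
          by (intro mult_left_mono ratio_bound j u n) (simp add: P S)
        finally show "norm (\<mu> j u) * norm (pole_error n m (r j u) (of_real x))
            \<le> (\<Sum>k\<in>{0::nat}. P * S n * (D / real n) * (u powr (e * \<sigma> - 1) * exp (- (real n / 4) * u)))"
          by (simp only: mult.assoc sum.insert sum.empty finite.emptyI empty_iff not_False_eq_True add_0_right)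
      qed (use P S D e\<sigma> in auto)
      also have "\<dots> = G * S n * (real n powr (- 1) * real n powr (- (e * \<sigma>)))"
        using n by (simp add: G_def powr_divide powr_minus field_simps)
      also have "\<dots> \<le> G * (C1 * real n powr l) * (real n powr (- 1) * real n powr (- (e * \<sigma>)))"
        using C1 [OF n] G by (intro mult_right_mono mult_left_mono) (auto simp: S_def)
      also have "\<dots> = G * C1 * (real n powr l * (real n powr (- 1) * real n powr (- (e * \<sigma>))))" by simp
      also have "real n powr l * (real n powr (- 1) * real n powr (- (e * \<sigma>))) = real n powr (l - 1 - e * \<sigma>)"
      proof -
        have "l + (- 1 + - (e * \<sigma>)) = l - 1 - e * \<sigma>" by simp
        thus ?thesis by (simp only: powr_add [symmetric])
      qed
      finally show ?thesis .
    qed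
    have "norm (interp_error m f (p n) x) \<le> (\<Sum>j\<in>J. \<integral>u. norm (\<mu> j u) * norm (pole_error n m (r j u) (of_real x)) \<partial>lborel_on {0<..<T})
        + C * S n * exp (- d * real n)"
      using err [OF n p [OF n]] by (simp add: S_def)
    also have "\<dots> \<le> (\<Sum>j\<in>J. G * C1 * real n powr (l - 1 - e * \<sigma>)) + C * (C1 * real n powr l) * exp (- d * real n)"
      using C C1 [OF n] by (intro add_mono sum_mono ray mult_right_mono mult_left_mono) (auto simp: S_def)
    also have "\<dots> = (card J * G * C1) * real n powr (l - 1 - e * \<sigma>) + (C * C1) * real n powr l * exp (- d * real n)"
      by simp
    finally show "norm (interp_error m f (p n) x) \<le> (card J * G * C1) * real n powr (l - 1 - e * \<sigma>) + (C * C1) * real n powr l * exp (- d * real n)" .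
  qed auto
qed

text \<open>The term of the Leibniz rule with \<open>k\<close> derivatives on the nodal polynomial contains the factor
\<open>1 / u ^ (e * (m + 1 - k))\<close>.  For \<open>k \<ge> 1\<close> the resulting power of \<open>u\<close> is integrable because \<open>m < \<sigma>\<close>, and the growth
\<open>n ^ (e * k - e + 1)\<close> of the derivatives compensates exactly, so that all terms have the same order.  For \<open>k = 0\<close> one
power of \<open>u\<close> is missing; it is recovered from \<open>\<bar>L \<xi>\<bar> \<le> \<bar>L (r j u)\<bar>\<close> when \<open>e = 1\<close>, whereas \<open>L \<xi> = 0\<close> when
\<open>e = 2\<close>.\<close>

lemma singularity_estimate:
  assumes m: "real m < \<sigma>" and \<xi>: "\<xi> \<in> {-1..1}" and C1: "C1 \<ge> 0"
    and L0: "\<And>n. n \<ge> 1 \<Longrightarrow> norm (poly (nodal n) (of_real \<xi>)) \<le> C1"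
    and L: "\<And>n k. n \<ge> 1 \<Longrightarrow> 1 \<le> k \<Longrightarrow> k \<le> m \<Longrightarrow> norm (poly (derivs k (nodal n)) (of_real \<xi>)) \<le> C1 * real n powr (real e * k - e + 1)"
    and p: "\<And>n. n \<ge> 1 \<Longrightarrow> lobatto_interpolant n f (p n)"
  shows "(\<lambda>n. norm (interp_error m f (p n) \<xi>)) \<in> O(\<lambda>n. real n powr (real e * m - e * \<sigma>))"
proof -
  define L where "L n k = norm (poly (derivs k (nodal n)) (complex_of_real \<xi>))" for n k
  define b where "b k = e * \<sigma> - real e * real (Suc m - k) - (if k = 0 then 0 else 1)" for k
  obtain C d where C: "C \<ge> 0" and d: "d > 0" and
    err: "\<And>n p. n \<ge> 1 \<Longrightarrow> lobatto_interpolant n f p \<Longrightarrow>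
     (\<forall>j\<in>J. integrable (lborel_on {0<..<T}) (\<lambda>u. norm (\<mu> j u) * norm (pole_error n m (r j u) (of_real \<xi>)))) \<and>
     norm (interp_error m f p \<xi>) \<le> (\<Sum>j\<in>J. \<integral>u. norm (\<mu> j u) * norm (pole_error n m (r j u) (of_real \<xi>)) \<partial>lborel_on {0<..<T})
        + C * (\<Sum>k\<le>m. norm (poly (derivs k (nodal n)) (of_real \<xi>))) * exp (- d * real n)"
    using interp_error_bound [OF m \<xi>] by blast
  define G where "G k = fact m * (C1 + 1) * D * \<bar>Gamma (b k + 1)\<bar> * 4 powr (b k + 1)" for k
  have G: "G k \<ge> 0" for k using C1 D by (simp add: G_def)
  show ?thesis
  proof (rule bigo_powr_plus_exp [OF _ _ d])
    fix n :: nat assume n: "n \<ge> 1"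
    \<comment> \<open>The case distinction at \<open>k = 0\<close> is needed since \<open>b 0\<close> may be at most -1 if \<open>e = 2\<close>.\<close>
    define a where "a k = (if k = 0 then if L n 0 = 0 then 0 else fact m * D else fact m * L n k * (D / real n))" for k
    have a: "a k \<ge> 0" for k using D by (simp add: a_def L_def)
    have b: "b k > -1" if "1 \<le> k" "k \<le> m" for k
    proof -
      have "e * (\<sigma> - m - 1 + k) > 0" using that m e by (intro mult_pos_pos) auto
      thus ?thesis using that by (simp add: b_def of_nat_diff algebra_simps)
    qed
    have e1: "e = 1" if "L n 0 \<noteq> 0" using nodal_zero [of n] that by (simp add: L_def)
    have b0: "b 0 > -1" if "L n 0 \<noteq> 0" using e1 [OF that] m by (simp add: b_def)
    have summand: "a k * (Gamma (b k + 1) * (real n / 4) powr (- (b k + 1))) \<le> G k * real n powr (real e * m - e * \<sigma>)"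
      if k: "k \<le> m" for k
    proof -
      have "a k \<le> fact m * (C1 + 1) * D * real n powr (real e * m - e * \<sigma> + (b k + 1)) \<or> a k = 0"
      proof (cases "k = 0")
        case True
        show ?thesis
        proof (cases "L n 0 = 0")
          case False
          have "real n powr (real e * m - e * \<sigma> + (b 0 + 1)) = 1"
            using e1 [OF False] n by (simp add: b_def)
          moreover have "fact m * D \<le> fact m * (C1 + 1) * D"
            using C1 D by (simp add: mult_right_mono mult_left_mono algebra_simps)
          ultimately show ?thesis using True False by (simp add: a_def)
        qed (simp add: a_def True)
      next
        case False
        have "a k \<le> fact m * (C1 * real n powr (real e * k - e + 1)) * (D / real n)"
          using False D assms(5) [OF n _ k] unfolding a_def L_def
          by (simp, intro divide_right_mono mult_right_mono mult_left_mono) auto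
        also have "\<dots> = fact m * C1 * D * (real n powr (real e * k - e + 1) * real n powr (- 1))"
          using n by (simp add: powr_minus field_simps)
        also have "real n powr (real e * k - e + 1) * real n powr (- 1) = real n powr (real e * m - e * \<sigma> + (b k + 1))"
        proof -
          have "(real e * k - e + 1) + - 1 = real e * m - e * \<sigma> + (b k + 1)"
            using False k by (simp add: b_def of_nat_diff algebra_simps)
          thus ?thesis by (simp only: powr_add [symmetric])
        qed
        also have "fact m * C1 * D * real n powr (real e * m - e * \<sigma> + (b k + 1))
            \<le> fact m * (C1 + 1) * D * real n powr (real e * m - e * \<sigma> + (b k + 1))"
          using D C1 by (intro mult_right_mono mult_left_mono) auto
        finally show ?thesis ..
      qed
      thus ?thesis
      proof
        assume ak: "a k \<le> fact m * (C1 + 1) * D * real n powr (real e * m - e * \<sigma> + (b k + 1))"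
        have pw: "(real n / 4) powr (- (b k + 1)) = 4 powr (b k + 1) * real n powr (- (b k + 1))"
          using n by (simp add: powr_divide powr_minus field_simps del: minus_add_distrib)
        have "a k * (Gamma (b k + 1) * (real n / 4) powr (- (b k + 1)))
            \<le> a k * (\<bar>Gamma (b k + 1)\<bar> * (real n / 4) powr (- (b k + 1)))"
          using a by (intro mult_left_mono mult_right_mono) auto
        also have "\<dots> \<le> fact m * (C1 + 1) * D * real n powr (real e * m - e * \<sigma> + (b k + 1)) *
            (\<bar>Gamma (b k + 1)\<bar> * (real n / 4) powr (- (b k + 1)))"
          by (intro mult_right_mono ak) auto
        also have "fact m * (C1 + 1) * D * real n powr (real e * m - e * \<sigma> + (b k + 1)) *
            (\<bar>Gamma (b k + 1)\<bar> * (real n / 4) powr (- (b k + 1)))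
          = G k * (real n powr (real e * m - e * \<sigma> + (b k + 1)) * real n powr (- (b k + 1)))"
          by (simp only: pw G_def mult_ac)
        also have "real n powr (real e * m - e * \<sigma> + (b k + 1)) * real n powr (- (b k + 1)) = real n powr (real e * m - e * \<sigma>)"
          by (simp flip: powr_add)
        finally show ?thesis .
      qed (use G in simp)
    qed
    have ray: "(\<integral>u. norm (\<mu> j u) * norm (pole_error n m (r j u) (of_real \<xi>)) \<partial>lborel_on {0<..<T})
        \<le> (\<Sum>k\<le>m. G k) * real n powr (real e * m - e * \<sigma>)" if j: "j \<in> J" for j
    proof -
      have "(\<integral>u. norm (\<mu> j u) * norm (pole_error n m (r j u) (of_real \<xi>)) \<partial>lborel_on {0<..<T})
        \<le> (\<Sum>k\<le>m. a k * (Gamma (b k + 1) * (real n / 4) powr (- (b k + 1))))"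
      proof (rule integral_le_sum_powr_exp)
        show "integrable (lborel_on {0<..<T}) (\<lambda>u. norm (\<mu> j u) * norm (pole_error n m (r j u) (of_real \<xi>)))"
          using err [OF n p [OF n]] j by blast
        show "real n / 4 > 0" using n by simp
        show "a k \<ge> 0" for k by (rule a)
        show "a k = 0 \<or> b k > -1" if "k \<in> {..m}" for k
          using b [of k] b0 that by (cases "k = 0") (auto simp: a_def)
        fix u assume u: "u \<in> {0<..<T}"
        define q where "q = norm (poly (nodal n) (r j u))"
        have q: "q \<ge> 0" by (simp add: q_def)
        define E where "E = exp (- (real n / 4) * u)"
        have "norm (\<mu> j u) * norm (pole_error n m (r j u) (of_real \<xi>))
          \<le> norm (\<mu> j u) * ((\<Sum>k\<le>m. fact m * L n k / norm (r j u - of_real \<xi>) ^ (Suc m - k)) / q)"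
          unfolding L_def q_def by (intro mult_left_mono norm_pole_error_le) auto
        also have "\<dots> = (\<Sum>k\<le>m. norm (\<mu> j u) * L n k / q * (fact m / norm (r j u - of_real \<xi>) ^ (Suc m - k)))"
          by (simp add: sum_distrib_left sum_divide_distrib field_simps)
        also have "\<dots> \<le> (\<Sum>k\<le>m. a k * (u powr b k * E))"
        proof (rule sum_mono)
          fix k assume k: "k \<in> {..m}"
          define i where "i = Suc m - k"
          have "norm (\<mu> j u) * L n k / q * (fact m / norm (r j u - of_real \<xi>) ^ i) \<le> norm (\<mu> j u) * L n k / q * (fact m / (u ^ e) ^ i)"
            using r_dist [OF j u \<xi>] u q by (intro mult_left_mono frac_le power_mono) (auto simp: L_def)
          also have "(u ^ e) ^ i = u powr (e * i)"
            using u powr_realpow [of u "e * i"] by (simp only: power_mult greaterThanLessThan_iff)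
          also have "norm (\<mu> j u) * L n k / q * (fact m / u powr (e * i)) \<le> a k * (u powr b k * E)"
          proof (cases "k = 0")
            case True
            show ?thesis
            proof (cases "L n 0 = 0")
              case False
              have "norm (\<mu> j u) * L n 0 / q * (fact m / u powr (e * i)) \<le> D * (u powr (e * \<sigma>) * E) * (fact m / u powr (e * i))"
                using nodal_ratio_bound [OF j u n] unfolding q_def E_def L_def by (intro mult_right_mono) auto
              also have "\<dots> = fact m * D * (u powr (e * \<sigma>) / u powr (e * i) * E)" by simp
              also have "u powr (e * \<sigma>) / u powr (e * i) = u powr b k"
                by (simp add: b_def True i_def distrib_left flip: powr_diff)
              finally show ?thesis using True False by (simp add: a_def)
            qed (use True a in \<open>simp add: E_def\<close>)
          next
            case False
            have "norm (\<mu> j u) * L n k / q * (fact m / u powr (e * i)) = L n k * (fact m / u powr (e * i)) * (norm (\<mu> j u) / q)"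
              by (simp add: mult_ac)
            also have "\<dots> \<le> L n k * (fact m / u powr (e * i)) * (D / real n * (u powr (e * \<sigma> - 1) * E))"
              unfolding q_def E_def by (intro mult_left_mono ratio_bound j u n) (simp add: L_def)
            also have "\<dots> = fact m * L n k * (D / real n) * (u powr (e * \<sigma> - 1) / u powr (e * i) * E)"
              by (simp add: mult_ac)
            also have "u powr (e * \<sigma> - 1) / u powr (e * i) = u powr b k"
            proof -
              have "e * \<sigma> - 1 - real e * real i = b k" using False by (simp add: b_def i_def)
              thus ?thesis by (simp add: powr_diff [symmetric])
            qed
            finally show ?thesis using False by (simp add: a_def)
          qed
          finally show "norm (\<mu> j u) * L n k / q * (fact m / norm (r j u - of_real \<xi>) ^ (Suc m - k)) \<le> a k * (u powr b k * E)"
            unfolding i_def .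
        qed
        finally show "norm (\<mu> j u) * norm (pole_error n m (r j u) (of_real \<xi>)) \<le> (\<Sum>k\<le>m. a k * (u powr b k * exp (- (real n / 4) * u)))"
          unfolding E_def .
      qed
      also have "\<dots> \<le> (\<Sum>k\<le>m. G k * real n powr (real e * m - e * \<sigma>))"
        by (intro sum_mono summand) auto
      finally show ?thesis by (simp only: sum_distrib_right)
    qed
    have S: "(\<Sum>k\<le>m. L n k) \<le> real (Suc m) * C1 * real n powr (real e * m + 1)"
    proof -
      have "L n k \<le> C1 * real n powr (real e * m + 1)" if k: "k \<le> m" for k
      proof (cases "k = 0")
        case True
        have "1 \<le> real n powr (real e * m + 1)" using n by (intro ge_one_powr_ge_zero) auto
        hence "C1 * 1 \<le> C1 * real n powr (real e * m + 1)" using C1 by (intro mult_left_mono) auto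
        thus ?thesis using L0 [OF n] True by (simp add: L_def)
      next
        case False
        have "real e * k \<le> real e * m" using k by (intro mult_left_mono) auto
        hence "real n powr (real e * k - e + 1) \<le> real n powr (real e * m + 1)" using n by (intro powr_mono) auto
        thus ?thesis using assms(5) [OF n _ k] False C1 unfolding L_def
          by (meson less_one linorder_not_less mult_left_mono order_trans)
      qed
      hence "(\<Sum>k\<le>m. L n k) \<le> (\<Sum>k\<le>m. C1 * real n powr (real e * m + 1))" by (intro sum_mono) auto
      thus ?thesis by simp
    qed
    have "norm (interp_error m f (p n) \<xi>) \<le> (\<Sum>j\<in>J. \<integral>u. norm (\<mu> j u) * norm (pole_error n m (r j u) (of_real \<xi>)) \<partial>lborel_on {0<..<T})
        + C * (\<Sum>k\<le>m. L n k) * exp (- d * real n)"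
      using err [OF n p [OF n]] by (simp add: L_def)
    also have "\<dots> \<le> (\<Sum>j\<in>J. (\<Sum>k\<le>m. G k) * real n powr (real e * m - e * \<sigma>))
        + C * (real (Suc m) * C1 * real n powr (real e * m + 1)) * exp (- d * real n)"
      using C S by (intro add_mono sum_mono ray mult_right_mono mult_left_mono) auto
    also have "\<dots> = (card J * (\<Sum>k\<le>m. G k)) * real n powr (real e * m - e * \<sigma>) + (C * real (Suc m) * C1) * real n powr (real e * m + 1) * exp (- d * real n)"
      by (simp only: sum_constant mult.assoc)
    finally show "norm (interp_error m f (p n) \<xi>) \<le> (card J * (\<Sum>k\<le>m. G k)) * real n powr (real e * m - e * \<sigma>) + (C * real (Suc m) * C1) * real n powr (real e * m + 1) * exp (- d * real n)" .
  qed auto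
qed

end

section \<open>The two singular cases\<close>

text \<open>Multiplication by \<open>g\<close> and the passage from \<open>sinh\<close> to the two ratio bounds are common to both cases.  What
remains is to find rays and weights for \<open>s x = \<bar>x - \<xi>\<bar> powr \<sigma>\<close> alone, together with a lower bound for the nodal
polynomial on the rays in terms of \<open>sinh (n u / 2)\<close>.\<close>

lemma pole_rays_from_weights:
  fixes r \<rho> :: "nat \<Rightarrow> real \<Rightarrow> complex" and e :: nat and \<sigma> T \<eta> \<eta>' \<xi> B c0 :: real
  assumes J: "finite J" and \<sigma>: "\<sigma> > 0" and e: "e \<ge> 1" and T: "0 < T" and \<eta>: "0 < \<eta>'" "\<eta>' \<le> \<eta>"
    and g: "g holomorphic_on slab \<eta>" and a: "a holomorphic_on slab \<eta>'"
    and r: "\<And>j. j \<in> J \<Longrightarrow> continuous_on {0..T} (r j)" "\<And>j u. j \<in> J \<Longrightarrow> u \<in> {0..T} \<Longrightarrow> r j u \<in> slab \<eta>"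
    and \<rho>: "\<And>j. j \<in> J \<Longrightarrow> continuous_on {0..T} (\<rho> j)"
    and r_dist: "\<And>j u x. j \<in> J \<Longrightarrow> u \<in> {0<..<T} \<Longrightarrow> x \<in> {-1..1} \<Longrightarrow> u ^ e \<le> norm (r j u - of_real x)"
    and r_away: "\<And>j u x. j \<in> J \<Longrightarrow> u \<in> {0<..<T} \<Longrightarrow> x \<in> {-1..1} \<Longrightarrow> \<bar>x - \<xi>\<bar> \<le> norm (r j u - of_real x)"
    and \<rho>_bound: "\<And>j u. j \<in> J \<Longrightarrow> u \<in> {0<..<T} \<Longrightarrow> norm (\<rho> j u) \<le> B * u powr (e * \<sigma> + e - 1)"
    and int: "\<And>j x. j \<in> J \<Longrightarrow> x \<in> {-1..1} \<Longrightarrow> integrable (lborel_on {0<..<T}) (\<lambda>u. \<rho> j u / (r j u - of_real x))"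
    and s: "\<And>x. x \<in> {-1..1} \<Longrightarrow> s x = (\<Sum>j\<in>J. \<integral>u. \<rho> j u / (r j u - of_real x) \<partial>lborel_on {0<..<T}) + a (of_real x)"
    and c0: "c0 > 0" and lower: "\<And>j u n. j \<in> J \<Longrightarrow> u \<in> {0<..<T} \<Longrightarrow>
        c0 * u powr (real e - 1) * sinh (real n * (u / 2)) \<le> norm (poly (nodal n) (r j u))"
    and \<xi>: "\<xi> \<in> {-1..1}"
    and nodal_zero: "\<And>n. e = 1 \<or> poly (nodal n) (of_real \<xi>) = 0"
    and vertical: "\<And>j u. e = 1 \<Longrightarrow> j \<in> J \<Longrightarrow> u \<in> {0<..<T} \<Longrightarrow> Re (r j u) = \<xi>"
  shows "\<exists>B D h. pole_rays \<xi> \<sigma> T \<eta>' B D e J r (\<lambda>j u. \<rho> j u * g (r j u)) h (\<lambda>x. s x * g (of_real x))"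
proof -
  have off: "r j u \<notin> complex_of_real ` {-1..1}" if "j \<in> J" "u \<in> {0<..<T}" for j u
  proof
    assume "r j u \<in> complex_of_real ` {-1..1}"
    then obtain x where "x \<in> {-1..1}" "r j u = of_real x" by blast
    moreover have "u ^ e > 0" using that by simp
    ultimately show False using r_dist [OF that, of x] by simp
  qed
  obtain h where h: "h holomorphic_on slab \<eta>'" "\<And>x. x \<in> {-1..1} \<Longrightarrow> s x * g (of_real x) =
       (\<Sum>j\<in>J. \<integral>u. \<rho> j u * g (r j u) / (r j u - of_real x) \<partial>lborel_on {0<..<T}) + h (of_real x)"
    using multiply_pole_integrals [OF g a \<eta>(2,1) J r off \<rho> int s] by blast
  have gr: "continuous_on {0..T} (\<lambda>u. g (r j u))" if "j \<in> J" for j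
    by (rule continuous_on_compose2 [OF holomorphic_on_imp_continuous_on [OF g] r(1) [OF that]]) (use r(2) that in auto)
  have "\<exists>K. \<forall>u\<in>{0..T}. norm (g (r j u)) \<le> K" if "j \<in> J" for j
    using compact_imp_bounded [OF compact_continuous_image [OF gr [OF that] compact_Icc]]
    unfolding bounded_iff by auto
  then obtain K where K: "\<And>j u. j \<in> J \<Longrightarrow> u \<in> {0..T} \<Longrightarrow> norm (g (r j u)) \<le> K j" by metis
  define G where "G = (\<Sum>j\<in>J. \<bar>K j\<bar>)"
  have G0: "G \<ge> 0" unfolding G_def by (intro sum_nonneg) auto
  have G: "norm (g (r j u)) \<le> G" if j: "j \<in> J" and u: "u \<in> {0<..<T}" for j u
  proof -
    have "norm (g (r j u)) \<le> \<bar>K j\<bar>" using K [of j u] j u by auto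
    also have "\<dots> \<le> G" unfolding G_def using J j by (intro member_le_sum) auto
    finally show ?thesis .
  qed
  define B' where "B' = \<bar>B\<bar> * G"
  have B': "B' \<ge> 0" using G0 by (simp add: B'_def)
  have \<mu>: "norm (\<rho> j u * g (r j u)) \<le> B' * u powr (e * \<sigma> + e - 1)" if j: "j \<in> J" and u: "u \<in> {0<..<T}" for j u
  proof -
    have "norm (\<rho> j u) \<le> \<bar>B\<bar> * u powr (e * \<sigma> + e - 1)"
      by (rule order_trans [OF \<rho>_bound [OF j u]]) (intro mult_right_mono, auto)
    hence "norm (\<rho> j u * g (r j u)) \<le> (\<bar>B\<bar> * u powr (e * \<sigma> + e - 1)) * G"
      unfolding norm_mult using G [OF j u] by (intro mult_mono) auto
    thus ?thesis by (simp add: B'_def mult_ac)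
  qed
  \<comment> \<open>Large enough for the ratio bound and for both regimes \<open>n u \<le> 2\<close> and \<open>n u > 2\<close> of the second bound.\<close>
  define D where "D = B' * (2 + 8 / c0)"
  have D: "D \<ge> 0" using B' c0 by (simp add: D_def)
  have D1: "8 * B' / c0 \<le> D" and D2: "2 * B' \<le> D" and D4: "4 / c0 * B' \<le> D"
  proof -
    have "D = 2 * B' + 8 * B' / c0" by (simp add: D_def algebra_simps)
    moreover have "8 * B' / c0 \<ge> 0" "8 * B' / c0 = 2 * (4 / c0 * B')" using B' c0 by auto
    ultimately show "8 * B' / c0 \<le> D" "2 * B' \<le> D" "4 / c0 * B' \<le> D" using B' by linarith+
  qed
  have "pole_rays \<xi> \<sigma> T \<eta>' B' D e J r (\<lambda>j u. \<rho> j u * g (r j u)) h (\<lambda>x. s x * g (of_real x))"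
  proof
    fix j u assume j: "j \<in> J" and u: "u \<in> {0<..<T}"
    fix n :: nat assume n: "n \<ge> 1"
    define y where "y = real n * (u / 2)"
    have y: "y > 0" using u n by (simp add: y_def)
    have sinh_y: "y / 4 * exp (y / 2) \<le> sinh y" using y by (intro sinh_lower_bound) simp
    have up: "u powr (real e - 1) > 0" using u by simp
    have low: "c0 * u powr (real e - 1) * (y / 4 * exp (y / 2)) \<le> norm (poly (nodal n) (r j u))"
      using lower [OF j u, of n] sinh_y c0 up
      by (intro order_trans [OF mult_left_mono [OF sinh_y]]) (auto simp: y_def)
    have ey: "exp (- (real n / 4) * u) = exp (- (y / 2))" by (simp add: y_def)
    have "norm (\<rho> j u * g (r j u)) / norm (poly (nodal n) (r j u))
        \<le> B' * u powr (e * \<sigma> + e - 1) / (c0 * u powr (real e - 1) * (y / 4 * exp (y / 2)))"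
      using low \<mu> [OF j u] c0 up y B' by (intro frac_le) (auto intro!: mult_pos_pos)
    also have "u powr (e * \<sigma> + e - 1) = u powr (e * \<sigma> - 1) * (u powr (real e - 1) * u)"
    proof -
      have "e * \<sigma> + e - 1 = (e * \<sigma> - 1) + ((real e - 1) + 1)" by simp
      thus ?thesis using u by (simp only: powr_add powr_one greaterThanLessThan_iff less_imp_le)
    qed
    also have "B' * (u powr (e * \<sigma> - 1) * (u powr (real e - 1) * u)) / (c0 * u powr (real e - 1) * (y / 4 * exp (y / 2)))
       = (8 * B' / c0) / real n * (u powr (e * \<sigma> - 1) * exp (- (y / 2)))"
      using u n c0 up by (simp add: y_def exp_minus field_simps)
    also have "\<dots> \<le> D / real n * (u powr (e * \<sigma> - 1) * exp (- (y / 2)))"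
      using D1 by (intro mult_right_mono divide_right_mono) auto
    finally show "norm (\<rho> j u * g (r j u)) / norm (poly (nodal n) (r j u))
        \<le> D / real n * (u powr (e * \<sigma> - 1) * exp (- (real n / 4) * u))" unfolding ey .
    show "norm (\<rho> j u * g (r j u)) * norm (poly (nodal n) (of_real \<xi>)) / norm (poly (nodal n) (r j u))
        \<le> D * (u powr (e * \<sigma>) * exp (- (real n / 4) * u))"
    proof (cases "e = 1")
      case False
      thus ?thesis using nodal_zero [of n] D by simp
    next
      case True
      define q where "q = norm (poly (nodal n) (of_real \<xi>)) / norm (poly (nodal n) (r j u))"
      have nz: "norm (poly (nodal n) (r j u)) > 0" using nodal_nonzero [OF n off [OF j u]] by simp
      have low': "c0 * (y / 4 * exp (y / 2)) \<le> norm (poly (nodal n) (r j u))" using low True u by simp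
      have "B' * q \<le> D * exp (- (y / 2))"
      proof (cases "y \<le> 1")
        case y1: True
        have "norm (poly (nodal n) (of_real \<xi>)) \<le> norm (poly (nodal n) (r j u))"
          using norm_nodal_vertical [OF n, of "r j u"] vertical [OF True j u] by simp
        hence "q \<le> 1" using nz by (simp add: q_def)
        hence "B' * q \<le> 2 * B' * (1 / 2)" using B' by (simp add: mult_left_le)
        also have "\<dots> \<le> D * exp (- (y / 2))"
        proof (intro mult_mono D2 D)
          have "1 + - (y / 2) \<le> exp (- (y / 2))" by (rule exp_ge_add_one_self)
          thus "1 / 2 \<le> exp (- (y / 2))" using y1 by simp
        qed simp
        finally show ?thesis .
      next
        case y1: False
        have "c0 * (1 / 4 * exp (y / 2)) \<le> c0 * (y / 4 * exp (y / 2))"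
          using y1 c0 by (intro mult_left_mono mult_right_mono) auto
        from order_trans [OF this low'] have "q \<le> 1 / (c0 * (1 / 4 * exp (y / 2)))"
          unfolding q_def using norm_nodal_le_1 [OF \<xi>, of n] c0 by (intro frac_le) auto
        also have "\<dots> = 4 / c0 * exp (- (y / 2))" by (simp add: exp_minus field_simps)
        finally have "B' * q \<le> B' * (4 / c0 * exp (- (y / 2)))" using B' by (rule mult_left_mono)
        also have "\<dots> = 4 / c0 * B' * exp (- (y / 2))" by simp
        also have "\<dots> \<le> D * exp (- (y / 2))" using D4 by (intro mult_right_mono) auto
        finally show ?thesis .
      qed
      moreover have "norm (\<rho> j u * g (r j u)) * q \<le> B' * u powr (e * \<sigma>) * q"
        using \<mu> [OF j u] True by (intro mult_right_mono) (auto simp: q_def)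
      ultimately have "norm (\<rho> j u * g (r j u)) * q \<le> u powr (e * \<sigma>) * (D * exp (- (y / 2)))"
        by (smt (verit) mult.commute mult.left_commute mult_left_mono powr_ge_zero)
      thus ?thesis unfolding q_def ey by (simp add: mult_ac)
    qed
  next
    show "continuous_on {0<..<T} (r j)" if "j \<in> J" for j
      by (rule continuous_on_subset [OF r(1) [OF that]]) auto
    show "continuous_on {0<..<T} (\<lambda>u. \<rho> j u * g (r j u))" if "j \<in> J" for j
      by (rule continuous_on_subset [OF continuous_on_mult [OF \<rho> [OF that] gr [OF that]]]) auto
  qed (use J \<sigma> e \<eta>(1) B' D r_dist r_away \<mu> nodal_zero h in auto)
  thus ?thesis by blast
qed

text \<open>Here \<open>u / (u\<^sup>2 + (x - \<xi>)\<^sup>2)\<close> is split into partial fractions with poles at \<open>\<xi> \<plusminus> \<i> u\<close>.  The map \<open>z \<mapsto> (z - \<xi>)\<^sup>2\<close> sends the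
strip \<open>\<bar>Im z\<bar> < T\<close> into the half-plane in which the truncation term is holomorphic.\<close>

lemma interior_pole_rays:
  assumes \<xi>: "\<xi> \<in> {-1<..<1}" and g: "g analytic_on (complex_of_real ` {-1..1})"
    and \<sigma>: "\<sigma> > 0" "\<nexists>k::int. even k \<and> \<sigma> = of_int k"
  shows "\<exists>T \<eta> B D J r \<mu> h. pole_rays \<xi> \<sigma> T \<eta> B D 1 J r \<mu> h (sing_fun \<xi> \<sigma> g)"
proof -
  obtain \<eta> where \<eta>: "\<eta> > 0" "\<eta> \<le> 1" and g: "g holomorphic_on slab \<eta>"
    using analytic_on_slab [OF g] .
  define T where "T = \<eta> / 2"
  have T: "0 < T" "T < \<eta>" "T \<le> 1" using \<eta> by (auto simp: T_def)
  obtain C A where A: "A holomorphic_on {v. Re v > - T\<^sup>2}"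
    and rep: "\<And>v. v \<ge> 0 \<Longrightarrow> of_real (v powr (\<sigma> / 2)) =
        of_real (C * (\<integral>u. u powr (\<sigma> + 1) / (u\<^sup>2 + v) \<partial>lborel_on {0<..<T})) + A (of_real v)"
    using powr_as_pole_integral [OF \<sigma> T(1)] by blast
  define J where "J = {0, 1::nat}"
  define s :: "nat \<Rightarrow> real" where "s j = (if j = 0 then 1 else -1)" for j
  have s: "\<bar>s j\<bar> = 1" for j by (simp add: s_def)
  define r where "r j u = of_real \<xi> + \<i> * of_real (s j * u)" for j u
  define \<rho> where "\<rho> j u = \<i> / 2 * of_real (s j * C * u powr \<sigma>)" for j u
  define a where "a z = A ((z - of_real \<xi>)\<^sup>2)" for z
  have Re_r: "Re (r j u) = \<xi>" and Im_r: "Im (r j u) = s j * u" for j u by (simp_all add: r_def)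
  have Re_r': "Re (r j u - of_real x) = \<xi> - x" and Im_r': "Im (r j u - of_real x) = s j * u" for j u x
    by (simp_all add: r_def)
  have r_dist: "u \<le> norm (r j u - of_real x)" if "u \<ge> 0" for j u x
    using abs_Im_le_cmod [of "r j u - of_real x"] that s [of j] unfolding Im_r' abs_mult by simp
  have r_away: "\<bar>x - \<xi>\<bar> \<le> norm (r j u - of_real x)" for j u x
    using abs_Re_le_cmod [of "r j u - of_real x"] unfolding Re_r' by simp
  have int: "integrable (lborel_on {0<..<T}) (\<lambda>u. \<rho> j u / (r j u - of_real x))" for j x
  proof (rule integrable_lborel_on_bound)
    show "integrable (lborel_on {0<..<T}) (\<lambda>u. \<bar>C\<bar> * u powr (\<sigma> - 1))"
      using lborel_on_powr(1) [of "\<sigma> - 1" T] \<sigma>(1) T(1) by (intro Bochner_Integration.integrable_mult_right) auto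
    show "(\<lambda>u. \<rho> j u / (r j u - of_real x)) \<in> borel_measurable borel"
      unfolding \<rho>_def r_def by measurable
    fix u assume u: "u \<in> {0<..<T}"
    have "norm (\<rho> j u / (r j u - of_real x)) = \<bar>C\<bar> * u powr \<sigma> / 2 / norm (r j u - of_real x)"
      unfolding norm_divide [of "\<rho> j u"] using s [of j] by (simp add: \<rho>_def norm_mult norm_divide abs_mult)
    also have "\<dots> \<le> \<bar>C\<bar> * u powr \<sigma> / u"
      using u r_dist [of u j x] by (intro frac_le) auto
    also have "\<dots> = \<bar>C\<bar> * u powr (\<sigma> - 1)" using u by (simp add: powr_diff)
    finally show "norm (\<rho> j u / (r j u - of_real x)) \<le> \<bar>C\<bar> * u powr (\<sigma> - 1)" .
  qed auto
  have decomp: "complex_of_real (\<bar>x - \<xi>\<bar> powr \<sigma>) = (\<Sum>j\<in>J. \<integral>u. \<rho> j u / (r j u - of_real x) \<partial>lborel_on {0<..<T}) + a (of_real x)" for x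
  proof -
    define v where "v = (x - \<xi>)\<^sup>2"
    have "\<bar>x - \<xi>\<bar> powr \<sigma> = v powr (\<sigma> / 2)"
    proof (cases "x = \<xi>")
      case False
      hence "v = \<bar>x - \<xi>\<bar> powr 2" by (simp add: v_def powr_numeral)
      hence "v powr (\<sigma> / 2) = \<bar>x - \<xi>\<bar> powr (2 * (\<sigma> / 2))" by (simp only: powr_powr)
      thus ?thesis by simp
    qed (simp add: v_def)
    hence "complex_of_real (\<bar>x - \<xi>\<bar> powr \<sigma>) = of_real (C * (\<integral>u. u powr (\<sigma> + 1) / (u\<^sup>2 + v) \<partial>lborel_on {0<..<T})) + A (of_real v)"
      using rep [of v] by (simp only:) (simp add: v_def)
    also have "A (of_real v) = a (of_real x)" by (simp add: a_def v_def)
    also have "complex_of_real (C * (\<integral>u. u powr (\<sigma> + 1) / (u\<^sup>2 + v) \<partial>lborel_on {0<..<T}))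
        = (\<integral>u. complex_of_real (C * (u powr (\<sigma> + 1) / (u\<^sup>2 + v))) \<partial>lborel_on {0<..<T})"
      by (simp only: integral_complex_of_real Bochner_Integration.integral_mult_right_zero)
    also have "\<dots> = (\<integral>u. \<rho> 0 u / (r 0 u - of_real x) + \<rho> 1 u / (r 1 u - of_real x) \<partial>lborel_on {0<..<T})"
    proof (rule Bochner_Integration.integral_cong [OF refl])
      fix u assume "u \<in> space (lborel_on {0<..<T})"
      hence u: "u > 0" by (simp add: space_restrict_space)
      define y where "y = x - \<xi>"
      have "r 0 u - of_real x = \<i> * of_real u - of_real y" "r 1 u - of_real x = - (\<i> * of_real u) - of_real y"
        by (simp_all add: r_def s_def y_def)
      moreover have "\<i> * of_real u - of_real y \<noteq> 0" "- (\<i> * of_real u) - of_real y \<noteq> 0"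
        using u by (auto simp: complex_eq_iff)
      moreover have "complex_of_real (u\<^sup>2 + v) = (\<i> * of_real u - of_real y) * (- (\<i> * of_real u) - of_real y)"
        by (simp add: v_def y_def complex_eq_iff power2_eq_square algebra_simps)
      moreover have "u powr (\<sigma> + 1) = u powr \<sigma> * u" using u by (simp add: powr_add)
      ultimately show "complex_of_real (C * (u powr (\<sigma> + 1) / (u\<^sup>2 + v))) = \<rho> 0 u / (r 0 u - of_real x) + \<rho> 1 u / (r 1 u - of_real x)"
        unfolding of_real_mult of_real_divide
        by (simp add: \<rho>_def s_def divide_simps) (simp add: algebra_simps)
    qed
    also have "\<dots> = (\<Sum>j\<in>J. \<integral>u. \<rho> j u / (r j u - of_real x) \<partial>lborel_on {0<..<T})"
      by (subst Bochner_Integration.integral_add [OF int int]) (simp add: J_def)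
    finally show ?thesis .
  qed
  have "\<exists>B D h. pole_rays \<xi> \<sigma> T T B D 1 J r (\<lambda>j u. \<rho> j u * g (r j u)) h (\<lambda>x. complex_of_real (\<bar>x - \<xi>\<bar> powr \<sigma>) * g (of_real x))"
  proof (rule pole_rays_from_weights [where \<eta> = \<eta> and a = a and B = "\<bar>C\<bar>" and ?c0.0 = "sqrt (1 - \<xi>\<^sup>2)"])
    show "a holomorphic_on slab T"
      unfolding a_def
    proof (rule holomorphic_on_compose_gen [of "\<lambda>z. (z - of_real \<xi>)\<^sup>2" "slab T" A, unfolded o_def, OF _ A])
      show "(\<lambda>z. (z - of_real \<xi>)\<^sup>2) ` slab T \<subseteq> {v. Re v > - T\<^sup>2}"
      proof safe
        fix z assume "z \<in> slab T"
        hence "\<bar>Im z\<bar> < T" by (simp add: slab_def)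
        hence "\<bar>Im z\<bar>\<^sup>2 < T\<^sup>2" by (intro power_strict_mono) auto
        hence "(Im z)\<^sup>2 < T\<^sup>2" by simp
        moreover have "Re ((z - of_real \<xi>)\<^sup>2) = (Re z - \<xi>)\<^sup>2 - (Im z)\<^sup>2" by (simp add: power2_eq_square)
        ultimately show "Re ((z - of_real \<xi>)\<^sup>2) > - T\<^sup>2" using zero_le_power2 [of "Re z - \<xi>"] by linarith
      qed
    qed (intro holomorphic_intros)
    show "r j u \<in> slab \<eta>" if "u \<in> {0..T}" for j u
      using that \<xi> T s [of j] by (auto simp: slab_def Re_r Im_r abs_mult)
    show "continuous_on {0..T} (r j)" for j unfolding r_def by (intro continuous_intros)
    show "continuous_on {0..T} (\<rho> j)" for j unfolding \<rho>_def using \<sigma> by (intro continuous_intros continuous_on_powr') auto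
    show "norm (\<rho> j u) \<le> \<bar>C\<bar> * u powr (real 1 * \<sigma> + real 1 - 1)" for j u
      using s [of j] by (simp add: \<rho>_def norm_mult abs_mult)
    show "0 < sqrt (1 - \<xi>\<^sup>2)" using \<xi> by (simp add: abs_square_less_1 abs_less_iff)
    show "sqrt (1 - \<xi>\<^sup>2) * u powr (real 1 - 1) * sinh (real n * (u / 2)) \<le> norm (poly (nodal n) (r j u))"
      if u: "u \<in> {0<..<T}" for j u n
    proof -
      have "(1 - \<xi>) * (1 + \<xi>) \<le> norm (1 - r j u) * norm (1 + r j u)"
        using \<xi> complex_Re_le_cmod [of "1 - r j u"] complex_Re_le_cmod [of "1 + r j u"]
        by (intro mult_mono) (auto simp: Re_r)
      also have "\<dots> = norm (1 - (r j u)\<^sup>2)" by (simp add: power2_eq_square algebra_simps flip: norm_mult)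
      finally have "1 - \<xi>\<^sup>2 \<le> norm (1 - (r j u)\<^sup>2)" by (simp add: power2_eq_square algebra_simps)
      hence "sqrt (1 - \<xi>\<^sup>2) * sinh (real n * (u / 2)) \<le> sqrt (norm (1 - (r j u)\<^sup>2)) * sinh (real n * (u / 2))"
        using u by (intro mult_right_mono) auto
      also have "\<dots> \<le> norm (poly (nodal n) (r j u))"
      proof (rule nodal_lower_bound)
        have "(Im (r j u))\<^sup>2 = u\<^sup>2" using s [of j] by (simp add: Im_r power_mult_distrib abs_square_eq_1)
        thus "2 * cosh (u / 2) \<le> norm (r j u - 1) + norm (r j u + 1)"
          using focal_sum_ge_Im [of "r j u"] half_width_bound(1) [of u] u T by auto
      qed (use u in auto)
      finally show ?thesis using u by simp
    qed
    show "u ^ 1 \<le> norm (r j u - of_real x)" if "u \<in> {0<..<T}" for j u x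
      using r_dist [of u j x] that by simp
  qed (use \<sigma> T \<eta> \<xi> g int decomp r_away Re_r in \<open>auto simp: J_def\<close>)
  thus ?thesis unfolding sing_fun_def [abs_def] by blast
qed

text \<open>Since \<open>\<xi>\<^sup>2 = 1\<close>, the kernel \<open>1 / (u\<^sup>2 + 1 - \<xi> x)\<close> equals \<open>\<xi> / (\<xi> (1 + u\<^sup>2) - x)\<close>, a single pole on the real axis outside
the interval.  The exponent \<open>\<kappa> = 2 \<sigma>\<close> is an even integer only if \<open>\<sigma>\<close> is an integer.\<close>

lemma endpoint_pole_rays:
  assumes \<xi>: "\<xi> = 1 \<or> \<xi> = -1" and g: "g analytic_on (complex_of_real ` {-1..1})"
    and \<sigma>: "\<sigma> > 0" "\<sigma> \<notin> \<int>"
  shows "\<exists>T \<eta> B D J r \<mu> h. pole_rays \<xi> \<sigma> T \<eta> B D 2 J r \<mu> h (sing_fun \<xi> \<sigma> g)"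
proof -
  obtain \<eta> where \<eta>: "\<eta> > 0" "\<eta> \<le> 1" and g: "g holomorphic_on slab \<eta>"
    using analytic_on_slab [OF g] .
  have \<xi>': "\<bar>\<xi>\<bar> = 1" "\<xi>\<^sup>2 = 1" "\<xi> * \<xi> = 1" "\<xi> \<in> {-1..1}" using \<xi> by auto
  define T where "T = \<eta> / 2"
  have T: "0 < T" "T < \<eta>" "T \<le> 1" using \<eta> by (auto simp: T_def)
  have T2: "0 < T\<^sup>2" "T\<^sup>2 \<le> T" using T by (auto simp: power2_eq_square mult_le_cancel_left1)
  have \<kappa>: "2 * \<sigma> > 0" "\<nexists>k::int. even k \<and> 2 * \<sigma> = of_int k"
  proof -
    show "2 * \<sigma> > 0" using \<sigma> by simp
    show "\<nexists>k::int. even k \<and> 2 * \<sigma> = of_int k"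
    proof
      assume "\<exists>k::int. even k \<and> 2 * \<sigma> = of_int k"
      then obtain i :: int where "2 * \<sigma> = of_int (2 * i)" by (auto elim!: evenE)
      hence "\<sigma> = of_int i" by simp
      thus False using \<sigma> by simp
    qed
  qed
  obtain C A where A: "A holomorphic_on {v. Re v > - T\<^sup>2}"
    and rep: "\<And>v. v \<ge> 0 \<Longrightarrow> of_real (v powr (2 * \<sigma> / 2)) =
        of_real (C * (\<integral>u. u powr (2 * \<sigma> + 1) / (u\<^sup>2 + v) \<partial>lborel_on {0<..<T})) + A (of_real v)"
    using powr_as_pole_integral [OF \<kappa> T(1)] by blast
  define J where "J = {0::nat}"
  define r where "r = (\<lambda>(j::nat) u. complex_of_real (\<xi> * (1 + u\<^sup>2)))"
  define \<rho> where "\<rho> = (\<lambda>(j::nat) u. complex_of_real (\<xi> * C * u powr (2 * \<sigma> + 1)))"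
  define a where "a z = A (1 - of_real \<xi> * z)" for z
  have dist: "norm (r j u - of_real x) = u\<^sup>2 + (1 - \<xi> * x)" and v: "1 - \<xi> * x = \<bar>x - \<xi>\<bar>" "1 - \<xi> * x \<ge> 0" if "x \<in> {-1..1}" for j u x
  proof -
    show v: "1 - \<xi> * x = \<bar>x - \<xi>\<bar>" using \<xi> that by auto
    show "1 - \<xi> * x \<ge> 0" unfolding v by simp
    have "r j u - of_real x = of_real (\<xi> * (u\<^sup>2 + (1 - \<xi> * x)))"
      using \<xi>'(3) by (simp add: r_def algebra_simps flip: of_real_mult mult.assoc)
    hence "norm (r j u - of_real x) = \<bar>\<xi>\<bar> * \<bar>u\<^sup>2 + (1 - \<xi> * x)\<bar>" by (simp only: norm_of_real abs_mult)
    thus "norm (r j u - of_real x) = u\<^sup>2 + (1 - \<xi> * x)" unfolding v \<xi>' by simp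
  qed
  have int: "integrable (lborel_on {0<..<T}) (\<lambda>u. \<rho> j u / (r j u - of_real x))" if x: "x \<in> {-1..1}" for j x
  proof (rule integrable_lborel_on_bound)
    show "integrable (lborel_on {0<..<T}) (\<lambda>u. \<bar>C\<bar> * u powr (2 * \<sigma> - 1))"
      using lborel_on_powr(1) [of "2 * \<sigma> - 1" T] \<sigma>(1) T(1) by (intro Bochner_Integration.integrable_mult_right) auto
    show "(\<lambda>u. \<rho> j u / (r j u - of_real x)) \<in> borel_measurable borel"
      unfolding \<rho>_def r_def by measurable
    fix u assume u: "u \<in> {0<..<T}"
    have "norm (\<rho> j u / (r j u - of_real x)) = \<bar>C\<bar> * u powr (2 * \<sigma> + 1) / norm (r j u - of_real x)"
      unfolding norm_divide by (simp add: \<rho>_def norm_mult abs_mult \<xi>')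
    also have "\<dots> \<le> \<bar>C\<bar> * u powr (2 * \<sigma> + 1) / u\<^sup>2"
      using u dist [OF x, of j u] v(2) [OF x] by (intro frac_le) auto
    also have "\<dots> = \<bar>C\<bar> * u powr (2 * \<sigma> - 1)"
      using u powr_add [of u "2 * \<sigma> - 1" 2] by (simp add: powr_numeral add.commute)
    finally show "norm (\<rho> j u / (r j u - of_real x)) \<le> \<bar>C\<bar> * u powr (2 * \<sigma> - 1)" .
  qed auto
  have decomp: "complex_of_real (\<bar>x - \<xi>\<bar> powr \<sigma>) = (\<Sum>j\<in>J. \<integral>u. \<rho> j u / (r j u - of_real x) \<partial>lborel_on {0<..<T}) + a (of_real x)"
    if x: "x \<in> {-1..1}" for x
  proof -
    have "complex_of_real (\<bar>x - \<xi>\<bar> powr \<sigma>) = of_real (C * (\<integral>u. u powr (2 * \<sigma> + 1) / (u\<^sup>2 + (1 - \<xi> * x)) \<partial>lborel_on {0<..<T})) + A (of_real (1 - \<xi> * x))"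
      using rep [OF v(2) [OF x]] v(1) [OF x] by simp
    also have "A (of_real (1 - \<xi> * x)) = a (of_real x)" by (simp add: a_def)
    also have "complex_of_real (C * (\<integral>u. u powr (2 * \<sigma> + 1) / (u\<^sup>2 + (1 - \<xi> * x)) \<partial>lborel_on {0<..<T}))
        = (\<integral>u. complex_of_real (C * (u powr (2 * \<sigma> + 1) / (u\<^sup>2 + (1 - \<xi> * x)))) \<partial>lborel_on {0<..<T})"
      by (simp only: integral_complex_of_real Bochner_Integration.integral_mult_right_zero)
    also have "\<dots> = (\<integral>u. \<rho> 0 u / (r 0 u - of_real x) \<partial>lborel_on {0<..<T})"
    proof (rule Bochner_Integration.integral_cong [OF refl])
      fix u
      have "\<xi> * (1 + u\<^sup>2) - x = \<xi> * (u\<^sup>2 + (1 - \<xi> * x))"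
        using \<xi>'(3) by (simp add: algebra_simps flip: mult.assoc)
      moreover have "\<xi> \<noteq> 0" using \<xi>' by auto
      ultimately have "C * (u powr (2 * \<sigma> + 1) / (u\<^sup>2 + (1 - \<xi> * x))) = \<xi> * C * u powr (2 * \<sigma> + 1) / (\<xi> * (1 + u\<^sup>2) - x)"
        by simp
      thus "complex_of_real (C * (u powr (2 * \<sigma> + 1) / (u\<^sup>2 + (1 - \<xi> * x)))) = \<rho> 0 u / (r 0 u - of_real x)"
        unfolding \<rho>_def r_def of_real_diff [symmetric] of_real_divide [symmetric] by (simp only:)
    qed
    finally show ?thesis by (simp add: J_def)
  qed
  have nodal0: "poly (nodal n) (of_real \<xi>) = 0" for n
    using \<xi>'(2) by (simp add: poly_nodal flip: of_real_power)
  have "\<exists>B D h. pole_rays \<xi> \<sigma> T (T\<^sup>2) B D 2 J r (\<lambda>j u. \<rho> j u * g (r j u)) h (\<lambda>x. complex_of_real (\<bar>x - \<xi>\<bar> powr \<sigma>) * g (of_real x))"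
  proof (rule pole_rays_from_weights [where \<eta> = \<eta> and a = a and B = "\<bar>C\<bar>" and ?c0.0 = 1])
    show "a holomorphic_on slab (T\<^sup>2)"
      unfolding a_def
    proof (rule holomorphic_on_compose_gen [of "\<lambda>z. 1 - of_real \<xi> * z" "slab (T\<^sup>2)" A, unfolded o_def, OF _ A])
      show "(\<lambda>z. 1 - of_real \<xi> * z) ` slab (T\<^sup>2) \<subseteq> {v. Re v > - T\<^sup>2}"
        using \<xi> by (auto simp: slab_def)
    qed (intro holomorphic_intros)
    show "r j u \<in> slab \<eta>" if "u \<in> {0..T}" for j u
    proof -
      have "u\<^sup>2 \<le> T\<^sup>2" using that by (intro power_mono) auto
      hence "\<bar>\<xi> * (1 + u\<^sup>2)\<bar> < 1 + \<eta>" unfolding abs_mult \<xi>' using T T2 by simp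
      thus ?thesis using \<eta> by (simp add: slab_def r_def del: of_real_mult of_real_add)
    qed
    show "continuous_on {0..T} (r j)" for j unfolding r_def by (intro continuous_intros)
    show "continuous_on {0..T} (\<rho> j)" for j unfolding \<rho>_def using \<sigma> by (intro continuous_intros continuous_on_powr') auto
    show "norm (\<rho> j u) \<le> \<bar>C\<bar> * u powr (real 2 * \<sigma> + real 2 - 1)" for j u
    proof -
      have "norm (\<rho> j u) = \<bar>C\<bar> * u powr (2 * \<sigma> + 1)"
        unfolding \<rho>_def norm_of_real abs_mult \<xi>' by simp
      thus ?thesis by (simp add: add_ac)
    qed
    show "1 * u powr (real 2 - 1) * sinh (real n * (u / 2)) \<le> norm (poly (nodal n) (r j u))"
      if u: "u \<in> {0<..<T}" for j u n
    proof -
      have "1 - (r j u)\<^sup>2 = of_real (1 - (\<xi> * (1 + u\<^sup>2))\<^sup>2)" by (simp add: r_def)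
      also have "(\<xi> * (1 + u\<^sup>2))\<^sup>2 = (1 + u\<^sup>2)\<^sup>2" by (simp add: power_mult_distrib \<xi>'(2))
      also have "1 - (1 + u\<^sup>2)\<^sup>2 = - (u\<^sup>2 * (2 + u\<^sup>2))" by (simp add: power2_eq_square algebra_simps)
      finally have "1 - (r j u)\<^sup>2 = of_real (- (u\<^sup>2 * (2 + u\<^sup>2)))" .
      hence "norm (1 - (r j u)\<^sup>2) = u\<^sup>2 * (2 + u\<^sup>2)" by (simp only: norm_of_real) simp
      also have "\<dots> \<ge> u\<^sup>2 * 1" by (intro mult_left_mono) auto
      finally have "u \<le> sqrt (norm (1 - (r j u)\<^sup>2))" using u by (intro real_le_rsqrt) simp
      hence "u * sinh (real n * (u / 2)) \<le> sqrt (norm (1 - (r j u)\<^sup>2)) * sinh (real n * (u / 2))"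
        using u by (intro mult_right_mono) auto
      also have "\<dots> \<le> norm (poly (nodal n) (r j u))"
      proof (rule nodal_lower_bound)
        have "norm (r j u - 1) + norm (r j u + 1) = 2 * (1 + u\<^sup>2)"
          using dist [of 1 j u] dist [of "-1" j u] \<xi> by auto
        thus "2 * cosh (u / 2) \<le> norm (r j u - 1) + norm (r j u + 1)"
          using half_width_bound(2) [of u] u T by auto
      qed (use u in auto)
      finally show ?thesis using u by simp
    qed
    show "u ^ 2 \<le> norm (r j u - of_real x)" if "u \<in> {0<..<T}" "x \<in> {-1..1}" for j u x
      using dist [OF that(2), of j u] v(2) [OF that(2)] by simp
    show "\<bar>x - \<xi>\<bar> \<le> norm (r j u - of_real x)" if "x \<in> {-1..1}" for j u x
      using dist [OF that, of j u] v(1) [OF that] by simp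
    show "0 < T\<^sup>2" "T\<^sup>2 \<le> \<eta>" using T T2 by linarith+
  qed (use \<sigma> T \<eta> \<xi>' g int decomp nodal0 in \<open>auto simp: J_def\<close>)
  thus ?thesis unfolding sing_fun_def [abs_def] by blast
qed

section \<open>Error rates of Chebyshev--Lobatto interpolation\<close>

lemma interp_error_at_endpoints:
  assumes "n \<ge> 1" "lobatto_interpolant n f p" "x = 1 \<or> x = (-1::real)"
  shows "interp_error 0 f p x = 0"
proof -
  have "lobatto_point n 0 = 1" "lobatto_point n n = -1" using assms(1) by (auto simp: lobatto_point_def)
  moreover have "poly p (of_real (lobatto_point n j)) = f (lobatto_point n j)" if "j \<le> n" for j
    using assms(2) that by (simp add: lobatto_interpolant_def)
  ultimately have "poly p (of_real x) = f x" using assms(3) by (metis le0 order_refl)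
  thus ?thesis by (simp add: interp_error_def nth_deriv_def)
qed

theorem theorem3p1:
  fixes \<xi> \<sigma> :: real and g :: "complex \<Rightarrow> complex" and f :: "real \<Rightarrow> complex"
    and p :: "nat \<Rightarrow> complex poly" and m :: nat
  assumes xi: "\<xi> \<in> {-1..1}"
    and g: "g analytic_on (complex_of_real ` {-1..1})"
    and sigma_pos: "\<sigma> > 0"
    and sigma_interior: "\<xi> \<in> {-1<..<1} \<Longrightarrow> \<nexists>k::int. even k \<and> \<sigma> = of_int k"
    and sigma_endpoint: "\<xi> = 1 \<or> \<xi> = -1 \<Longrightarrow> \<sigma> \<notin> \<int>"
    and f: "f = sing_fun \<xi> \<sigma> g"
    and p: "\<And>n. n \<ge> 1 \<Longrightarrow> lobatto_interpolant n f (p n)"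
  shows
    "(\<xi> \<in> {-1<..<1} \<and> real m < min \<sigma> (1 + \<sigma> / 2) \<longrightarrow>
        (\<lambda>n. norm (interp_error m f (p n) \<xi>)) \<in> O(\<lambda>n. real n powr (real m - \<sigma>)) \<and>
        (\<forall>x\<in>{-1<..<\<xi>} \<union> {\<xi><..<1}.
           (\<lambda>n. norm (interp_error m f (p n) x)) \<in> O(\<lambda>n. real n powr (real m - 1 - \<sigma>))) \<and>
        (\<forall>x\<in>{-1, 1}.
           (m \<ge> 1 \<longrightarrow> (\<lambda>n. norm (interp_error m f (p n) x))
                          \<in> O(\<lambda>n. real n powr (2 * real m - 2 - \<sigma>))) \<and>
           (m = 0 \<longrightarrow> (\<forall>n\<ge>1. interp_error m f (p n) x = 0))))
   \<and> ((\<xi> = 1 \<or> \<xi> = -1) \<and> real m < \<sigma> \<longrightarrow>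
        (\<forall>x\<in>{-1<..<1}.
           (\<lambda>n. norm (interp_error m f (p n) x)) \<in> O(\<lambda>n. real n powr (real m - 1 - 2 * \<sigma>))) \<and>
        (m \<ge> 1 \<longrightarrow>
           (\<lambda>n. norm (interp_error m f (p n) \<xi>)) \<in> O(\<lambda>n. real n powr (2 * real m - 2 * \<sigma>)) \<and>
           (\<lambda>n. norm (interp_error m f (p n) (- \<xi>)))
              \<in> O(\<lambda>n. real n powr (2 * real m - 2 - 2 * \<sigma>))) \<and>
        (m = 0 \<longrightarrow>
           (\<forall>n\<ge>1. interp_error m f (p n) \<xi> = 0 \<and> interp_error m f (p n) (- \<xi>) = 0)))"
proof (intro conjI impI)
  assume "\<xi> \<in> {-1<..<1} \<and> real m < min \<sigma> (1 + \<sigma> / 2)"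
  hence \<xi>: "\<xi> \<in> {-1<..<1}" and m: "real m < \<sigma>" by auto
  obtain T \<eta> B D J r \<mu> h where "pole_rays \<xi> \<sigma> T \<eta> B D 1 J r \<mu> h f"
    using interior_pole_rays [OF \<xi> g sigma_pos sigma_interior [OF \<xi>]] unfolding f by (elim exE)
  then interpret pole_rays \<xi> \<sigma> T \<eta> B D 1 J r \<mu> h f .
  obtain C where C: "C \<ge> 0" "\<forall>n\<ge>1. \<forall>k\<le>m. norm (poly (derivs k (nodal n)) (complex_of_real \<xi>)) \<le> C * real n ^ k"
    using nodal_derivs_interior [where m = m, OF \<xi>] .
  have "(\<lambda>n. norm (interp_error m f (p n) \<xi>)) \<in> O(\<lambda>n. real n powr (real 1 * real m - real 1 * \<sigma>))"
  proof (rule singularity_estimate [OF m xi C(1) _ _ p])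
    show "norm (poly (nodal n) (of_real \<xi>)) \<le> C" if "n \<ge> 1" for n using C(2) that by fastforce
    show "norm (poly (derivs k (nodal n)) (of_real \<xi>)) \<le> C * real n powr (real 1 * real k - real 1 + 1)"
      if "n \<ge> 1" "k \<le> m" for n k using C(2) that by (simp add: powr_realpow)
  qed
  thus "(\<lambda>n. norm (interp_error m f (p n) \<xi>)) \<in> O(\<lambda>n. real n powr (real m - \<sigma>))" by simp
  show "\<forall>x\<in>{-1<..<\<xi>} \<union> {\<xi><..<1}. (\<lambda>n. norm (interp_error m f (p n) x)) \<in> O(\<lambda>n. real n powr (real m - 1 - \<sigma>))"
  proof
    fix x assume "x \<in> {-1<..<\<xi>} \<union> {\<xi><..<1}"
    hence x: "x \<in> {-1<..<1}" "x \<noteq> \<xi>" using \<xi> by auto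
    obtain C where C: "\<forall>n\<ge>1. (\<Sum>k\<le>m. norm (poly (derivs k (nodal n)) (complex_of_real x))) \<le> C * real n powr real m"
      using nodal_derivs_sum_interior [where m = m, OF x(1)] .
    from away_estimate [OF m _ x(2) C [rule_format] p]
    show "(\<lambda>n. norm (interp_error m f (p n) x)) \<in> O(\<lambda>n. real n powr (real m - 1 - \<sigma>))" using x by simp
  qed
  show "\<forall>x\<in>{-1, 1}. (m \<ge> 1 \<longrightarrow> (\<lambda>n. norm (interp_error m f (p n) x)) \<in> O(\<lambda>n. real n powr (2 * real m - 2 - \<sigma>))) \<and>
           (m = 0 \<longrightarrow> (\<forall>n\<ge>1. interp_error m f (p n) x = 0))"
  proof (intro ballI conjI impI allI)
    fix x :: real assume "x \<in> {-1, 1}"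
    hence x: "x = 1 \<or> x = -1" "x \<in> {-1..1}" "x \<noteq> \<xi>" using \<xi> by auto
    obtain C where C: "\<forall>n\<ge>1. (\<Sum>k\<le>m. norm (poly (derivs k (nodal n)) (complex_of_real x))) \<le> C * real n powr (2 * real m - 1)"
      using nodal_derivs_sum_endpoint [where m = m, OF x(1)] .
    from away_estimate [OF m x(2,3) C [rule_format] p]
    show "(\<lambda>n. norm (interp_error m f (p n) x)) \<in> O(\<lambda>n. real n powr (2 * real m - 2 - \<sigma>))" by simp
    show "interp_error m f (p n) x = 0" if "m = 0" "n \<ge> 1" for n
      using interp_error_at_endpoints [OF that(2) p [OF that(2)] x(1)] that(1) by simp
  qed
next
  assume "(\<xi> = 1 \<or> \<xi> = -1) \<and> real m < \<sigma>"
  hence \<xi>: "\<xi> = 1 \<or> \<xi> = -1" and m: "real m < \<sigma>" by auto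
  obtain T \<eta> B D J r \<mu> h where "pole_rays \<xi> \<sigma> T \<eta> B D 2 J r \<mu> h f"
    using endpoint_pole_rays [OF \<xi> g sigma_pos sigma_endpoint [OF \<xi>]] unfolding f by (elim exE)
  then interpret pole_rays \<xi> \<sigma> T \<eta> B D 2 J r \<mu> h f .
  show "\<forall>x\<in>{-1<..<1}. (\<lambda>n. norm (interp_error m f (p n) x)) \<in> O(\<lambda>n. real n powr (real m - 1 - 2 * \<sigma>))"
  proof
    fix x :: real assume x: "x \<in> {-1<..<1}"
    obtain C where C: "\<forall>n\<ge>1. (\<Sum>k\<le>m. norm (poly (derivs k (nodal n)) (complex_of_real x))) \<le> C * real n powr real m"
      using nodal_derivs_sum_interior [where m = m, OF x] .
    from away_estimate [OF m _ _ C [rule_format] p]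
    show "(\<lambda>n. norm (interp_error m f (p n) x)) \<in> O(\<lambda>n. real n powr (real m - 1 - 2 * \<sigma>))" using x \<xi> by auto
  qed
  obtain C where C: "C \<ge> 0" "\<forall>n\<ge>1. \<forall>k\<in>{1..m}.
      norm (poly (derivs k (nodal n)) (complex_of_real \<xi>)) \<le> C * real n powr (2 * real k - 1)"
    using nodal_derivs_endpoint [where m = m, OF \<xi>] .
  have "(\<lambda>n. norm (interp_error m f (p n) \<xi>)) \<in> O(\<lambda>n. real n powr (real 2 * real m - real 2 * \<sigma>))"
  proof (rule singularity_estimate [OF m xi C(1) _ _ p])
    show "norm (poly (nodal n) (of_real \<xi>)) \<le> C" for n using nodal_zero [of n] C(1) by simp
    show "norm (poly (derivs k (nodal n)) (of_real \<xi>)) \<le> C * real n powr (real 2 * real k - real 2 + 1)"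
      if "n \<ge> 1" "1 \<le> k" "k \<le> m" for n k using C(2) that by simp
  qed
  thus "(\<lambda>n. norm (interp_error m f (p n) \<xi>)) \<in> O(\<lambda>n. real n powr (2 * real m - 2 * \<sigma>))" by simp
  have \<xi>': "- \<xi> = 1 \<or> - \<xi> = -1" "- \<xi> \<in> {-1..1}" "- \<xi> \<noteq> \<xi>" using \<xi> by auto
  obtain C' where C': "\<forall>n\<ge>1. (\<Sum>k\<le>m. norm (poly (derivs k (nodal n)) (complex_of_real (- \<xi>)))) \<le> C' * real n powr (2 * real m - 1)"
    using nodal_derivs_sum_endpoint [where m = m, OF \<xi>'(1)] .
  from away_estimate [OF m \<xi>'(2,3) C' [rule_format] p]
  show "(\<lambda>n. norm (interp_error m f (p n) (- \<xi>))) \<in> O(\<lambda>n. real n powr (2 * real m - 2 - 2 * \<sigma>))" by simp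
  show "\<forall>n\<ge>1. interp_error m f (p n) \<xi> = 0 \<and> interp_error m f (p n) (- \<xi>) = 0" if "m = 0"
    using interp_error_at_endpoints [OF _ p \<xi>] interp_error_at_endpoints [OF _ p \<xi>'(1)] that by simp
qed

end
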